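(* Let $\chi$ be a primitive Dirichlet character modulo $q>1$ and put $m:=\min\{n\in\mathbb{Z}_{\geq 2}:\chi(n)\neq 0\}$. For $T>0$ let $N^{-}(T,\chi)$ and $N_1^{-}(T,\chi)$ denote the number of zeros of $L(s,\chi)$ and of $L'(s,\chi)$, respectively, in $\{\sigma+it:0<\sigma<1/2,~-T\leq t\leq T\}$, counted with multiplicity. Then for $T\geq 2$, \[ N^{-}(T,\chi)=N_1^{-}(T,\chi)+O(m^{1/2}\log(qT)), \] where the implied constant is absolute.
   Context: $L(s,\chi)$ is the Dirichlet $L$-function of $\chi$ and $L'(s,\chi)$ its derivative in $s$. *)

theory Defs
  imports "HOL-Complex_Analysis.Complex_Analysis"
begin

definition dirichlet_character :: "nat \<Rightarrow> (int \<Rightarrow> complex) \<Rightarrow> bool" where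
  "dirichlet_character q chi \<longleftrightarrow>
     q > 0 \<and>
     (\<forall>a b. chi (a * b) = chi a * chi b) \<and>
     (\<forall>a. chi (a + int q) = chi a) \<and>
     (\<forall>a. chi a \<noteq> 0 \<longleftrightarrow> coprime a (int q))"

text \<open>A character is primitive if it is not induced by a character of a proper divisor
  of its modulus.\<close>

definition primitive_character :: "nat \<Rightarrow> (int \<Rightarrow> complex) \<Rightarrow> bool" where
  "primitive_character q chi \<longleftrightarrow>
     dirichlet_character q chi \<and>
     (\<forall>d \<psi>. d dvd q \<longrightarrow> dirichlet_character d \<psi> \<longrightarrow>
        (\<forall>a. coprime a (int q) \<longrightarrow> chi a = \<psi> a) \<longrightarrow> d = q)"

text \<open>The entire continuation of the Dirichlet series. Among Dirichlet characters it exists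
  exactly for the non-principal ones, in particular for the primitive characters of modulus
  greater than 1; for principal characters \<open>dirichlet_L\<close> is unspecified.\<close>

definition entire_continuation_of_L_series :: "(int \<Rightarrow> complex) \<Rightarrow> (complex \<Rightarrow> complex) \<Rightarrow> bool" where
  "entire_continuation_of_L_series chi f \<longleftrightarrow>
     f holomorphic_on UNIV \<and>
     (\<forall>s. Re s > 1 \<longrightarrow>
        (\<lambda>n. chi (int (Suc n)) / of_nat (Suc n) powr s) sums f s)"

lemma entire_continuation_of_L_series_unique:
  assumes "entire_continuation_of_L_series chi f" "entire_continuation_of_L_series chi g"
  shows "f = g"
proof
  fix z
  have eq: "f s = g s" if "s \<in> {s. Re s > 1}" for s
    using assms that unfolding entire_continuation_of_L_series_def
    by (blast intro: sums_unique2)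
  show "f z = g z"
  proof (rule analytic_continuation_open[of "{s. Re s > 1}" UNIV f g])
    show "{s. Re s > 1} \<noteq> {}"
      by (auto intro!: exI[of _ "2 :: complex"])
  qed (use assms eq in \<open>auto simp: entire_continuation_of_L_series_def open_halfspace_Re_gt\<close>)
qed

definition dirichlet_L :: "(int \<Rightarrow> complex) \<Rightarrow> complex \<Rightarrow> complex" where
  "dirichlet_L chi = (THE f. entire_continuation_of_L_series chi f)"

definition left_half_box :: "real \<Rightarrow> complex set" where
  "left_half_box T = {s. 0 < Re s \<and> Re s < 1 / 2 \<and> - T \<le> Im s \<and> Im s \<le> T}"

text \<open>For a holomorphic function that does not vanish identically, \<^const>\<open>zorder\<close> at a
  zero is its multiplicity, and the zeros in a bounded set are finitely many.\<close>

definition zero_count :: "(complex \<Rightarrow> complex) \<Rightarrow> complex set \<Rightarrow> int" where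
  "zero_count f S = (\<Sum>z | z \<in> S \<and> f z = 0. zorder f z)"

definition N_minus :: "real \<Rightarrow> (int \<Rightarrow> complex) \<Rightarrow> int" where
  "N_minus T chi = zero_count (dirichlet_L chi) (left_half_box T)"

definition N1_minus :: "real \<Rightarrow> (int \<Rightarrow> complex) \<Rightarrow> int" where
  "N1_minus T chi = zero_count (deriv (dirichlet_L chi)) (left_half_box T)"

definition least_nonvanishing :: "(int \<Rightarrow> complex) \<Rightarrow> nat" where
  "least_nonvanishing chi = (LEAST n. n \<ge> 2 \<and> chi (int n) \<noteq> 0)"

end

theory Submission imports Defs begin

text \<open>Apply the argument principle to \<open>L' / L\<close> on a rectangle between \<open>Re s = 0\<close> and a line just
  left of \<open>Re s = 1/2\<close>.  At heights above 100, \<open>Re (L' / L)\<close> is negative on both vertical edges,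
  so each of them changes the argument by at most \<open>\<pi>\<close>: by the functional equation the values of
  \<open>Re (L' / L)\<close> at two points symmetric about the critical line add up to a negative quantity of
  size \<open>log (q |t|)\<close>, which settles the critical line, and on \<open>Re s = 0\<close> one adds that the
  modulus of the completed function increases to the right of \<open>Re s = 1\<close>.
  On a horizontal edge the change is bounded by the number of zeros of \<open>Re (L' / L)\<close>, hence by
  Jensen's formula and the polynomial growth of \<open>L\<close> it is \<open>O(log (q T))\<close>.  The zeros of bounded
  height are counted by Jensen's formula as well, and those of negative imaginary part come from
  the conjugate character.

  The functional equation is obtained from \<open>\<theta>(x) = \<Sum>\<chi>(n) n e\<^sup>-\<^sup>n\<^sup>x\<close>, which is a rational function of
  \<open>e\<^sup>-\<^sup>x\<close>: expanding it in partial fractions and taking Mellin transforms termwise turns the Gauss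
  sum expansion of \<open>\<chi>\<close> into the reflected Dirichlet series.\<close>

section \<open>Dirichlet characters and Gauss sums\<close>

text \<open>The bound obtained is O(log (qT)), and m \<ge> 2 turns it into the stated one at the
  very end. The discs that give quantitative bounds are centred at real part -1/4. Far to the right
  L' is dominated by its term at n = m, so a lower bound for |L'| at a centre there would depend on
  m. To the left of the strip, Re (L'/L) \<le> -1/4 gives |L'| \<ge> |L|/4, and the functional
  equation bounds |L| below uniformly in q. That sign is usually read off from the sum of Re 1/(s -
  \<rho>) over all zeros. Here Phragmen-Lindelof stands in for this sum: only moduli are compared,
  so no root number enters, and constants depending on q are harmless, because any polynomial bound
  is improved to the bound 1. From height 100 on, the digamma terms have real part at least 19/10,
  which outweighs -log (q/\<pi>); the latter can be positive for small q, but is at most 1.\<close>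

locale dirichlet_char =
  fixes q :: nat and chi :: "int \<Rightarrow> complex"
  assumes q_gt_1: "q > 1" and dchar: "dirichlet_character q chi"
begin

lemma chi_mult: "chi (a * b) = chi a * chi b"
  and chi_add_q: "chi (a + int q) = chi a"
  and chi_nonzero_iff: "chi a \<noteq> 0 \<longleftrightarrow> coprime a (int q)"
  using dchar unfolding dirichlet_character_def by blast+

lemma chi_add_mult_nat: "chi (a + int k * int q) = chi a"
proof (induction k)
  case (Suc k)
  have "chi (a + int (Suc k) * int q) = chi ((a + int k * int q) + int q)"
    by (simp add: algebra_simps)
  then show ?case using Suc by (simp only: chi_add_q)
qed simp

lemma chi_cong:
  assumes "a mod int q = b mod int q"
  shows "chi a = chi b"
proof -
  have *: "chi x = chi (x mod int q)" for x
  proof (cases "x div int q \<ge> 0")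
    case True
    then obtain k where "x div int q = int k" using nonneg_int_cases by blast
    then have "x = x mod int q + int k * int q"
      by (metis div_mult_mod_eq add.commute)
    then show ?thesis using chi_add_mult_nat by metis
  next
    case False
    then obtain k where k: "x div int q = - int k"
      by (metis linorder_linear nonpos_int_cases)
    have "x mod int q = x + int k * int q"
      using div_mult_mod_eq[of x "int q"] k by (simp add: algebra_simps)
    then show ?thesis using chi_add_mult_nat by metis
  qed
  show ?thesis using * assms by metis
qed

lemma chi_1 [simp]: "chi 1 = 1"
  using chi_mult[of 1 1] chi_nonzero_iff[of 1] by simp

lemma chi_0 [simp]: "chi 0 = 0"
  using chi_nonzero_iff[of 0] q_gt_1 by auto

lemma chi_power: "chi (a ^ n) = chi a ^ n"
  by (induction n) (auto simp: chi_mult)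

text \<open>There is one value per residue, hence a common bound \<open>B\<close>, while a value of
  modulus greater than 1 would have unbounded powers \<open>chi (a ^ n)\<close>.\<close>

lemma norm_chi_le: "norm (chi a) \<le> 1"
proof (rule ccontr)
  assume "\<not> norm (chi a) \<le> 1"
  then have gt: "norm (chi a) > 1" by simp
  define B where "B = (\<Sum>x\<in>{0..<int q}. norm (chi x))"
  have le: "norm (chi x) \<le> B" for x
  proof -
    have "chi x = chi (x mod int q)" by (rule chi_cong) simp
    moreover have "norm (chi (x mod int q)) \<le> B"
      unfolding B_def using q_gt_1 by (intro member_le_sum) auto
    ultimately show ?thesis by simp
  qed
  obtain n where "B < norm (chi a) ^ n" using real_arch_pow[OF gt] by blast
  then show False using le[of "a ^ n"] by (simp add: chi_power norm_power)
qed

lemma coprime_inverse: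
  assumes "coprime a (int q)"
  obtains b where "(a * b) mod int q = 1" "coprime b (int q)"
proof -
  obtain u v where uv: "u * a + v * int q = 1"
    using bezout_int[of a "int q"] assms by auto
  have "a * u = 1 - v * int q" using uv by (simp add: algebra_simps)
  then have "(a * u) mod int q = 1"
    using q_gt_1 by (simp add: mod_diff_eq[symmetric] flip: zmod_int)
  moreover have "coprime u (int q)"
  proof (rule coprimeI)
    fix d assume d: "d dvd u" "d dvd int q"
    then have "d dvd u * a + v * int q" by simp
    then show "is_unit d" using uv by simp
  qed
  ultimately show ?thesis using that by blast
qed

lemma norm_chi_coprime:
  assumes "coprime a (int q)"
  shows "norm (chi a) = 1"
proof -
  obtain b where b: "(a * b) mod int q = 1" using coprime_inverse[OF assms] by blast
  have "chi (a * b) = chi 1" by (rule chi_cong) (use b q_gt_1 in \<open>simp add: zmod_int\<close>)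
  then have "norm (chi a) * norm (chi b) = 1" by (simp add: chi_mult flip: norm_mult)
  moreover have "norm (chi a) * norm (chi b) \<le> norm (chi a) * 1"
    using norm_chi_le[of b] by (intro mult_left_mono) auto
  ultimately show ?thesis using norm_chi_le[of a] by linarith
qed

lemma chi_cnj_coprime:
  assumes "coprime a (int q)"
  shows "chi a * cnj (chi a) = 1"
  using norm_chi_coprime[OF assms] complex_norm_square[of "chi a"] by simp

text \<open>Multiplication by a unit permutes the residues; \<open>g\<close> is this permutation on
  the representatives in \<open>{..<q}\<close>.\<close>

lemma sum_reindex_coprime:
  fixes f :: "int \<Rightarrow> complex"
  assumes c: "coprime c (int q)" and per: "\<And>x y. x mod int q = y mod int q \<Longrightarrow> f x = f y"
  shows "(\<Sum>n<q. f (c * int n)) = (\<Sum>n<q. f (int n))"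
proof -
  define g where "g = (\<lambda>n. nat ((c * int n) mod int q))"
  have g: "int (g n) = (c * int n) mod int q" for n unfolding g_def using q_gt_1 by simp
  have inj: "inj_on g {..<q}"
  proof (rule inj_onI)
    fix x y assume xy: "x \<in> {..<q}" "y \<in> {..<q}" "g x = g y"
    then have "(c * int x) mod int q = (c * int y) mod int q" using g by metis
    then have "int q dvd c * int x - c * int y" by (simp add: mod_eq_dvd_iff)
    then have "int q dvd c * (int x - int y)" by (simp add: right_diff_distrib)
    then have "int q dvd int x - int y"
      using c by (simp add: coprime_dvd_mult_right_iff coprime_commute)
    then have "int x mod int q = int y mod int q" by (simp add: mod_eq_dvd_iff)
    then show "x = y" using xy by simp
  qed
  have sub: "g ` {..<q} \<subseteq> {..<q}"
  proof (rule image_subsetI)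
    fix n assume "n \<in> {..<q}"
    have "int (g n) < int q" unfolding g using q_gt_1 by simp
    then show "g n \<in> {..<q}" by simp
  qed
  have img: "g ` {..<q} = {..<q}"
    using endo_inj_surj[OF _ sub inj] by simp
  have "(\<Sum>n<q. f (int n)) = (\<Sum>n\<in>g ` {..<q}. f (int n))" by (simp add: img)
  also have "\<dots> = (\<Sum>n<q. f (int (g n)))" using sum.reindex[OF inj] by simp
  also have "\<dots> = (\<Sum>n<q. f (c * int n))"
    by (intro sum.cong refl per) (simp add: g)
  finally show ?thesis by simp
qed

end

text \<open>Let k be the product of the primes that divide m but not a. Then every prime factor of m
  divides exactly one of a and k * d. This lifts a unit modulo d to a unit modulo a multiple of
  d.\<close>

lemma coprime_shift_exists:
  fixes a d m :: int
  assumes "coprime a d" "m \<noteq> 0"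
  shows "\<exists>k. coprime (a + k * d) m"
proof -
  define S where "S = {p \<in> prime_factors m. \<not> p dvd a}"
  define k where "k = \<Prod>S"
  have S: "finite S" "\<And>p. p \<in> S \<Longrightarrow> prime p" unfolding S_def by auto
  have "\<not> p dvd a + k * d" if p: "prime p" "p dvd m" for p
  proof (cases "p dvd a")
    case True
    have "\<not> p dvd d" using True assms(1) p(1) by (meson coprime_common_divisor not_prime_unit)
    moreover have "\<not> p dvd k"
    proof
      assume "p dvd k"
      then obtain r where "r \<in> S" "p dvd r"
        unfolding k_def using prime_dvd_prod_iff[OF S(1) p(1), of id] by (auto simp: prod.reindex)
      then have "p = r" using S(2) p(1) primes_dvd_imp_eq by blast
      then show False using \<open>r \<in> S\<close> True by (simp add: S_def)
    qed
    ultimately have "\<not> p dvd k * d" using p(1) prime_dvd_mult_iff by blast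
    then show ?thesis using True by (simp add: dvd_add_right_iff)
  next
    case False
    then have "p \<in> S" using p assms(2) by (auto simp: S_def in_prime_factors_iff)
    then have "p dvd k * d" unfolding k_def using S(1) by (simp add: dvd_prod_eqI dvd_mult2)
    then show ?thesis using False by (simp add: dvd_add_left_iff)
  qed
  then have ndvd: "\<not> p dvd a + k * d" if "prime p" "p dvd m" for p using that by blast
  have "coprime (a + k * d) m"
  proof (rule ccontr)
    assume "\<not> coprime (a + k * d) m"
    then have "gcd (a + k * d) m \<noteq> 1" by (simp add: coprime_iff_gcd_eq_1)
    then have "\<not> is_unit (gcd (a + k * d) m)" by simp
    moreover have "gcd (a + k * d) m \<noteq> 0" using assms(2) by simp
    ultimately obtain p where "p dvd gcd (a + k * d) m" "prime p"
      using prime_divisor_exists by blast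
    then show False using ndvd by (metis gcd_dvd1 gcd_dvd2 dvd_trans)
  qed
  then show ?thesis by blast
qed

locale primitive_char = dirichlet_char +
  assumes prim: "\<And>d \<psi>. d dvd q \<Longrightarrow> dirichlet_character d \<psi> \<Longrightarrow>
        (\<forall>a. coprime a (int q) \<longrightarrow> chi a = \<psi> a) \<Longrightarrow> d = q"
begin

text \<open>If \<open>chi\<close> were 1 on all units congruent to 1 modulo d, its value at a unit
  would depend on the residue modulo d only. Then \<open>chi\<close> would be induced by the
  character \<open>\<psi>\<close> modulo d, whose value at a is that of \<open>chi\<close> at a lift
  of a to a unit modulo q, against primitivity.\<close>

lemma kernel_nontrivial:
  assumes d: "d dvd q" "d < q"
  shows "\<exists>c. int d dvd c - 1 \<and> coprime c (int q) \<and> chi c \<noteq> 1"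
proof (rule ccontr)
  assume neg: "\<not> ?thesis"
  have triv: "chi c = 1" if "int d dvd c - 1" "coprime c (int q)" for c
    using neg that by blast
  have d0: "d > 0" using d q_gt_1 by (metis dvd_0_left_iff gr0I not_less_zero)
  have same: "chi a = chi b" if ab: "int d dvd a - b" "coprime a (int q)" "coprime b (int q)" for a b
  proof -
    obtain e where e: "(b * e) mod int q = 1" "coprime e (int q)"
      using coprime_inverse[OF ab(3)] by blast
    have "int q dvd b * e - 1" using e(1) q_gt_1
      by (metis mod_eq_dvd_iff mod_mod_trivial)
    then have dbe: "int d dvd b * e - 1" using d(1) by (meson dvd_trans int_dvd_int_iff)
    have "a * e - 1 = (a - b) * e + (b * e - 1)" by (simp add: algebra_simps)
    then have "int d dvd a * e - 1" using dbe ab(1) by (metis dvd_add dvd_mult2)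
    then have "chi (a * e) = 1" "chi (b * e) = 1"
      using triv dbe ab e by simp_all
    then show ?thesis unfolding chi_mult by (metis mult_cancel_right mult_zero_right zero_neq_one)
  qed
  define lift where "lift = (\<lambda>a. a + (SOME k. coprime (a + k * int d) (int q)) * int d)"
  have lift: "coprime (lift a) (int q)" "int d dvd lift a - a" if "coprime a (int d)" for a
  proof -
    have "\<exists>k. coprime (a + k * int d) (int q)"
      using coprime_shift_exists[OF that, of "int q"] q_gt_1 by simp
    from someI_ex[OF this] show "coprime (lift a) (int q)" unfolding lift_def .
    show "int d dvd lift a - a" unfolding lift_def by simp
  qed
  define \<psi> where "\<psi> = (\<lambda>a. if coprime a (int d) then chi (lift a) else 0)"
  have eq: "\<psi> a = chi b" if "coprime b (int q)" "int d dvd b - a" "coprime a (int d)" for a b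
  proof -
    have "int d dvd (lift a - a) - (b - a)" using lift(2)[OF that(3)] that(2) by (rule dvd_diff)
    then show ?thesis unfolding \<psi>_def using that lift[OF that(3)] by (auto intro!: same)
  qed
  have cop: "coprime a (int d) \<longleftrightarrow> coprime b (int d)" if "int d dvd a - b" for a b
    using that by (metis coprime_mod_left_iff d0 mod_eq_dvd_iff of_nat_0_less_iff less_numeral_extra(3))
  have "dirichlet_character d \<psi>"
    unfolding dirichlet_character_def
  proof (intro conjI allI)
    fix a b
    show "\<psi> (a * b) = \<psi> a * \<psi> b"
    proof (cases "coprime a (int d) \<and> coprime b (int d)")
      case True
      have "lift a * lift b - a * b = (lift a - a) * lift b + a * (lift b - b)"
        by (simp add: algebra_simps)
      then have "int d dvd lift a * lift b - a * b" using lift True by simp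
      then have "\<psi> (a * b) = chi (lift a * lift b)" using lift True by (intro eq) auto
      then show ?thesis using True by (simp add: chi_mult \<psi>_def)
    qed (auto simp: \<psi>_def)
  next
    fix a
    show "\<psi> (a + int d) = \<psi> a"
    proof (cases "coprime a (int d)")
      case True
      show ?thesis
        using lift[OF True] True cop[of "a + int d" a] eq[of "lift a" "a + int d"]
        by (metis \<psi>_def add_diff_cancel_left' diff_diff_eq dvd_diff dvd_refl)
    next
      case False
      then show ?thesis using cop[of "a + int d" a] by (simp add: \<psi>_def)
    qed
  next
    fix a
    show "\<psi> a \<noteq> 0 \<longleftrightarrow> coprime a (int d)" using lift chi_nonzero_iff by (auto simp: \<psi>_def)
  qed (use d0 in simp)
  moreover have "chi a = \<psi> a" if "coprime a (int q)" for a
    using that eq[of a a] d(1) by (metis coprime_divisors diff_self dvd_0_right dvd_refl int_dvd_int_iff)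
  ultimately show False using prim d by blast
qed

section \<open>Additive characters modulo q and the Gauss sum\<close>

definition root_char :: "int \<Rightarrow> complex" where
  "root_char n = cis (2 * pi * of_int n / of_nat q)"

lemma root_char_0 [simp]: "root_char 0 = 1"
  and root_char_add: "root_char (m + n) = root_char m * root_char n"
  by (simp_all add: root_char_def cis_mult add_divide_distrib distrib_left)

lemma root_char_mult_q: "root_char (k * int q) = 1"
proof -
  have "2 * pi * real_of_int (k * int q) / real q = 2 * pi * of_int k" using q_gt_1 by simp
  then show ?thesis unfolding root_char_def using cis_multiple_2pi[of "of_int k"] by simp
qed

lemma root_char_cong:
  assumes "a mod int q = b mod int q"
  shows "root_char a = root_char b"
proof -
  have *: "root_char x = root_char (x mod int q)" for x
    using root_char_add[of "x mod int q" "x div int q * int q"] by (simp add: root_char_mult_q)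
  show ?thesis using *[of a] *[of b] assms by simp
qed

lemma root_char_eq_1_iff: "root_char k = 1 \<longleftrightarrow> int q dvd k"
proof
  assume "root_char k = 1"
  then have "cos (2 * pi * of_int k / of_nat q) = 1"
    unfolding root_char_def by (simp add: complex_eq_iff)
  then obtain j :: int where "2 * pi * of_int k / of_nat q = of_int j * 2 * pi"
    using cos_one_2pi_int by metis
  then have "real_of_int k = real_of_int (j * int q)" using q_gt_1 by (simp add: field_simps)
  then have "k = j * int q" by (simp only: of_int_eq_iff)
  then show "int q dvd k" by simp
next
  assume "int q dvd k"
  then show "root_char k = 1" using root_char_mult_q by (metis dvd_def mult.commute)
qed

lemma root_char_orthogonal:
  "(\<Sum>b<q. root_char (int b * k)) = (if int q dvd k then of_nat q else 0)"
proof (cases "int q dvd k")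
  case True
  then have "root_char (int b * k) = 1" for b by (simp add: root_char_eq_1_iff)
  then show ?thesis using True by simp
next
  case False
  have pow: "root_char (int b * k) = root_char k ^ b" for b
    by (induction b) (simp_all add: root_char_add distrib_right)
  have ne: "root_char k \<noteq> 1" using False root_char_eq_1_iff by simp
  have "root_char k ^ q = 1" using root_char_mult_q[of k] pow[of q] by (simp add: mult.commute)
  then show ?thesis using False ne by (simp add: pow geometric_sum)
qed

definition gauss :: complex where
  "gauss = (\<Sum>n<q. chi (int n) * root_char (int n))"

text \<open>For a unit b this is the substitution n -> bn. Otherwise n -> e(bn/q) has the smaller
  period d = q / gcd(b, q), and multiplying n by some c with c = 1 modulo d and chi c \<noteq> 1
  leaves the sum unchanged but also multiplies it by chi c, so it is 0. Primitivity enters here,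
  through \<open>kernel_nontrivial\<close>.\<close>

lemma gauss_separable:
  "(\<Sum>n<q. chi (int n) * root_char (b * int n)) = cnj (chi b) * gauss"
proof (cases "coprime b (int q)")
  case True
  have "chi (int n) = cnj (chi b) * chi (b * int n)" for n
    using chi_cnj_coprime[OF True] by (simp add: chi_mult algebra_simps)
  then have "(\<Sum>n<q. chi (int n) * root_char (b * int n)) =
      cnj (chi b) * (\<Sum>n<q. chi (b * int n) * root_char (b * int n))"
    by (simp add: sum_distrib_left mult.assoc[symmetric])
  also have "(\<Sum>n<q. chi (b * int n) * root_char (b * int n)) = gauss"
    unfolding gauss_def
    by (rule sum_reindex_coprime[OF True, of "\<lambda>x. chi x * root_char x"])
       (rule arg_cong2[where f = "(*)"], erule chi_cong, erule root_char_cong)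
  finally show ?thesis .
next
  case False
  define g where "g = nat (gcd b (int q))"
  have g: "int g = gcd b (int q)" unfolding g_def by simp
  have g1: "g > 1"
    using False q_gt_1 g by (metis coprime_iff_gcd_eq_1 gcd_eq_0_iff gr0I int_one_le_iff_zero_less
        less_one linorder_neqE_nat nat_int of_nat_0 of_nat_1 of_nat_eq_0_iff less_irrefl not_less_zero)
  have gq: "g dvd q" using g by (metis gcd_dvd2 int_dvd_int_iff)
  define d where "d = q div g"
  have dg: "q = d * g" using gq d_def by simp
  have "d > 0" using dg q_gt_1 by (cases d) auto
  then have "d dvd q" "d < q" using dg g1 by auto
  then obtain c where c: "int d dvd c - 1" "coprime c (int q)" "chi c \<noteq> 1"
    using kernel_nontrivial[of d] by blast
  have "int g dvd b" using g by simp
  with c(1) have "int d * int g dvd (c - 1) * b" by (rule mult_dvd_mono)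
  then have dvd: "int q dvd c * b - b"
    using dg by (simp only: of_nat_mult left_diff_distrib mult_1)
  have "(b * (c * x)) mod int q = (b * x) mod int q" for x
  proof -
    have "b * (c * x) - b * x = (c * b - b) * x" by (simp add: algebra_simps)
    moreover have "int q dvd (c * b - b) * x" using dvd by (rule dvd_mult2)
    ultimately show ?thesis by (simp only: mod_eq_dvd_iff)
  qed
  then have bc: "root_char (b * (c * x)) = root_char (b * x)" for x by (rule root_char_cong)
  have "(\<Sum>n<q. chi (int n) * root_char (b * int n)) =
      (\<Sum>n<q. chi (c * int n) * root_char (b * (c * int n)))"
  proof (rule sum_reindex_coprime[OF c(2), of "\<lambda>x. chi x * root_char (b * x)", symmetric])
    fix x y assume xy: "x mod int q = y mod int q"
    then have "(b * x) mod int q = (b * y) mod int q" by (rule mod_mult_cong[OF refl])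
    then have "root_char (b * x) = root_char (b * y)" by (rule root_char_cong)
    then show "chi x * root_char (b * x) = chi y * root_char (b * y)"
      using chi_cong[OF xy] by simp
  qed
  also have "\<dots> = chi c * (\<Sum>n<q. chi (int n) * root_char (b * int n))"
    by (simp only: bc chi_mult sum_distrib_left mult.assoc)
  finally have "(\<Sum>n<q. chi (int n) * root_char (b * int n)) = 0" using c(3) by (metis mult_cancel_right1)
  moreover have "chi b = 0" using False chi_nonzero_iff by blast
  ultimately show ?thesis by simp
qed

text \<open>Finite Fourier inversion: \<open>gauss_separable\<close> evaluates the transform of
  \<open>chi\<close>, and orthogonality in b inverts it. It exchanges \<open>chi\<close> for roots
  of unity, over which geometric series can be summed.\<close>

lemma chi_fourier:
  "chi n = gauss / of_nat q * (\<Sum>b<q. cnj (chi (int b)) * root_char (- (int b * n)))"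
proof -
  have "(\<Sum>b<q. cnj (chi (int b)) * gauss * root_char (- (int b * n))) =
     (\<Sum>b<q. (\<Sum>m<q. chi (int m) * root_char (int b * int m)) * root_char (- (int b * n)))"
    by (simp add: gauss_separable)
  also have "\<dots> = (\<Sum>b<q. \<Sum>m<q. chi (int m) * root_char (int b * (int m - n)))"
    by (simp add: sum_distrib_right mult.assoc root_char_add[symmetric] right_diff_distrib)
  also have "\<dots> = (\<Sum>m<q. chi (int m) * (\<Sum>b<q. root_char (int b * (int m - n))))"
    by (subst sum.swap) (simp add: sum_distrib_left)
  also have "\<dots> = (\<Sum>m<q. if m = nat (n mod int q) then chi n * of_nat q else 0)"
  proof (intro sum.cong refl)
    fix m assume m: "m \<in> {..<q}"
    have "int q dvd int m - n \<longleftrightarrow> int m = n mod int q"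
      using m by (metis lessThan_iff mod_eq_dvd_iff mod_less of_nat_mod)
    also have "\<dots> \<longleftrightarrow> m = nat (n mod int q)" using q_gt_1 by auto
    finally have iff: "int q dvd int m - n \<longleftrightarrow> m = nat (n mod int q)" .
    have "chi (int m) = chi n" if "int q dvd int m - n"
      using that by (intro chi_cong) (simp add: mod_eq_dvd_iff)
    then show "chi (int m) * (\<Sum>b<q. root_char (int b * (int m - n))) =
       (if m = nat (n mod int q) then chi n * of_nat q else 0)"
      using iff by (simp add: root_char_orthogonal)
  qed
  also have "\<dots> = chi n * of_nat q" using q_gt_1 by (simp add: nat_less_iff)
  finally have "(\<Sum>b<q. cnj (chi (int b)) * gauss * root_char (- (int b * n))) = chi n * of_nat q" .
  then have "gauss * (\<Sum>b<q. cnj (chi (int b)) * root_char (- (int b * n))) = chi n * of_nat q"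
    by (simp add: sum_distrib_left mult_ac)
  then show ?thesis using q_gt_1 by (simp add: field_simps)
qed

text \<open>The frequency b = 0, where \<open>chi 0 = 0\<close>.\<close>

lemma sum_chi_period: "(\<Sum>n<q. chi (int n)) = 0"
  using gauss_separable[of 0] by simp

end

lemma primitive_charI: "q > 1 \<Longrightarrow> primitive_character q chi \<Longrightarrow> primitive_char q chi"
  unfolding primitive_character_def by unfold_locales blast+

lemma primitive_character_cnj:
  assumes "primitive_character q chi"
  shows "primitive_character q (\<lambda>a. cnj (chi a))"
proof -
  have *: "dirichlet_character d (\<lambda>a. cnj (\<psi> a))" if "dirichlet_character d \<psi>" for d \<psi>
    using that unfolding dirichlet_character_def by simp
  show ?thesis
    unfolding primitive_character_def
  proof (intro conjI allI impI)
    show "dirichlet_character q (\<lambda>a. cnj (chi a))"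
      using * assms unfolding primitive_character_def by blast
    fix d \<psi> assume d: "d dvd q" "dirichlet_character d \<psi>"
      "\<forall>a. coprime a (int q) \<longrightarrow> cnj (chi a) = \<psi> a"
    have "\<forall>a. coprime a (int q) \<longrightarrow> chi a = cnj (\<psi> a)" using d(3) by (metis complex_cnj_cnj)
    then show "d = q" using assms d(1) *[OF d(2)] unfolding primitive_character_def by blast
  qed
qed

section \<open>Abel summation of Dirichlet series\<close>

lemma powr_has_field_derivative_of_real:
  assumes "x > 0"
  shows "((\<lambda>z. z powr s) has_field_derivative s * complex_of_real x powr (s - 1)) (at (of_real x) within A)"
  using assms by (intro has_field_derivative_at_within[OF has_field_derivative_powr])
    (simp add: complex_nonpos_Reals_iff)

lemma norm_of_real_powr: "x > 0 \<Longrightarrow> norm (complex_of_real x powr s) = x powr Re s"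
  by (simp add: norm_powr_real_powr)

lemma closed_segment_of_realE:
  assumes "z \<in> closed_segment (complex_of_real x) (of_real y)" "x \<le> y"
  obtains u where "z = of_real u" "x \<le> u" "u \<le> y"
  using assms that by (auto simp: closed_segment_of_real closed_segment_eq_real_ivl)

lemma powr_diff_bound:
  assumes xy: "0 < x" "x \<le> y" and s: "Re s \<ge> 0"
  shows "norm (of_real y powr (-s) - of_real x powr (-s)) \<le> norm s * x powr (- Re s - 1) * (y - x)"
proof -
  have "norm (of_real y powr (-s) - of_real x powr (-s))
      \<le> norm s * x powr (- Re s - 1) * norm (complex_of_real y - of_real x)"
  proof (rule field_differentiable_bound[of "closed_segment (of_real x) (of_real y)"])
    fix z :: complex assume z: "z \<in> closed_segment (of_real x) (of_real y)"
    then obtain u where u: "z = of_real u" "x \<le> u" "u \<le> y"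
      using closed_segment_of_realE xy(2) by blast
    then have u0: "u > 0" using xy by simp
    show "((\<lambda>z. z powr (-s)) has_field_derivative (-s) * z powr (-s - 1))
        (at z within closed_segment (of_real x) (of_real y))"
      unfolding u(1) using powr_has_field_derivative_of_real[OF u0] .
    have "u powr (- Re s - 1) \<le> x powr (- Re s - 1)"
      using u xy s by (intro powr_mono2') auto
    then show "norm ((-s) * z powr (-s - 1)) \<le> norm s * x powr (- Re s - 1)"
      unfolding u(1) norm_mult using norm_of_real_powr[OF u0, of "-s-1"]
      by (simp add: mult_left_mono)
  qed auto
  then show ?thesis using xy by (simp flip: of_real_diff)
qed

text \<open>This is zeta(\<sigma> + 1). The shift by one matches the exponent in
  \<open>powr_diff_bound\<close>, so it is the natural majorant after summation by parts.\<close>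

definition zeta_tail :: "real \<Rightarrow> real" where
  "zeta_tail \<sigma> = (\<Sum>n. real (Suc n) powr (- \<sigma> - 1))"

lemma summable_zeta_tail: "\<sigma> > 0 \<Longrightarrow> summable (\<lambda>n. real (Suc n) powr (- \<sigma> - 1))"
  using summable_Suc_iff[of "\<lambda>n. real n powr (- \<sigma> - 1)"] summable_real_powr_iff[of "- \<sigma> - 1"]
  by simp

lemma zeta_tail_nonneg: "\<sigma> > 0 \<Longrightarrow> zeta_tail \<sigma> \<ge> 0"
  unfolding zeta_tail_def by (intro suminf_nonneg summable_zeta_tail) auto

lemma zeta_tail_antimono: "0 < a \<Longrightarrow> a \<le> b \<Longrightarrow> zeta_tail b \<le> zeta_tail a"
  unfolding zeta_tail_def
  by (intro suminf_le summable_zeta_tail) (auto intro!: powr_mono)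

lemma of_nat_Suc_powr_diff_bound:
  assumes "Re s \<ge> 0"
  shows "norm (of_nat (Suc (Suc n)) powr (-s) - of_nat (Suc n) powr (-s))
     \<le> norm s * real (Suc n) powr (- Re s - 1)"
  using powr_diff_bound[of "real (Suc n)" "real (Suc (Suc n))" s] assms by simp

text \<open>Summation by parts: the differences of n^(-s) gain a factor 1/n, so with bounded partial
  sums the rearranged series converges absolutely and locally uniformly for Re s > 0. The bound,
  linear in B and in |s|, is the source of all growth estimates that are uniform in q.\<close>

lemma abel_series:
  fixes a :: "nat \<Rightarrow> complex"
  assumes B: "\<And>N. norm (\<Sum>n<N. a n) \<le> B"
  defines "g \<equiv> (\<lambda>s. \<Sum>n. (\<Sum>k<Suc n. a k) * (of_nat (Suc n) powr (-s) - of_nat (Suc (Suc n)) powr (-s)))"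
  shows "\<And>s. Re s > 0 \<Longrightarrow> (\<lambda>n. a n * of_nat (Suc n) powr (-s)) sums g s"
    and "\<And>s. Re s > 0 \<Longrightarrow> norm (g s) \<le> B * norm s * zeta_tail (Re s)"
    and "g holomorphic_on {s. Re s > 0}"
proof -
  define A where "A = (\<lambda>N. \<Sum>n<N. a n)"
  define t where "t = (\<lambda>n s. A (Suc n) * (of_nat (Suc n) powr (-s) - of_nat (Suc (Suc n)) powr (-s)) :: complex)"
  have B0: "B \<ge> 0" using B[of 0] by simp
  have g_def': "g = (\<lambda>s. \<Sum>n. t n s)" unfolding g_def t_def A_def by simp
  have t_bound: "norm (t n s) \<le> B * norm s * real (Suc n) powr (- Re s - 1)" if "Re s \<ge> 0" for n s
  proof -
    have "norm (t n s) \<le> B * (norm s * real (Suc n) powr (- Re s - 1))"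
      unfolding t_def norm_mult
      using B[of "Suc n"] of_nat_Suc_powr_diff_bound[OF that, of n] B0
      by (intro mult_mono) (auto simp: A_def norm_minus_commute)
    then show ?thesis by (simp add: mult.assoc)
  qed
  have sm: "summable (\<lambda>n. B * norm s * real (Suc n) powr (- Re s - 1))" if "Re s > 0" for s :: complex
    using summable_zeta_tail[OF that] by (intro summable_mult) auto
  have smt: "summable (\<lambda>n. norm (t n s))" if "Re s > 0" for s
    by (rule summable_comparison_test'[OF sm[OF that], of 0]) (use t_bound[of s] that in auto)
  show "norm (g s) \<le> B * norm s * zeta_tail (Re s)" if "Re s > 0" for s
  proof -
    have "norm (g s) \<le> (\<Sum>n. norm (t n s))" unfolding g_def' by (rule summable_norm[OF smt[OF that]])
    also have "\<dots> \<le> (\<Sum>n. B * norm s * real (Suc n) powr (- Re s - 1))"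
      by (intro suminf_le smt sm that) (use t_bound that in auto)
    also have "\<dots> = B * norm s * zeta_tail (Re s)"
      unfolding zeta_tail_def using summable_zeta_tail[OF that] by (rule suminf_mult)
    finally show ?thesis .
  qed
  show "(\<lambda>n. a n * of_nat (Suc n) powr (-s)) sums g s" if s: "Re s > 0" for s
  proof -
    have part: "(\<Sum>n<N. a n * of_nat (Suc n) powr (-s)) =
        (\<Sum>n<N. t n s) + A N * of_nat (Suc N) powr (-s)" for N
      by (induction N) (simp_all add: A_def t_def algebra_simps)
    have "(\<lambda>N. real (Suc N) powr (- Re s)) \<longlonglongrightarrow> 0"
      using s LIMSEQ_Suc[OF tendsto_neg_powr[of "- Re s" real sequentially]] filterlim_real_sequentially by simp
    then have "(\<lambda>N. B * real (Suc N) powr (- Re s)) \<longlonglongrightarrow> 0" using tendsto_mult_right_zero by blast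
    moreover have "norm (A N * of_nat (Suc N) powr (-s)) \<le> B * real (Suc N) powr (- Re s)" for N
      unfolding norm_mult using B[of N] norm_of_real_powr[of "real (Suc N)" "-s"]
      by (intro mult_mono) (auto simp: A_def B0)
    ultimately have z: "(\<lambda>N. A N * of_nat (Suc N) powr (-s)) \<longlonglongrightarrow> 0"
      using Lim_null_comparison[of "\<lambda>N. A N * of_nat (Suc N) powr (-s)" "\<lambda>N. B * real (Suc N) powr (- Re s)" sequentially]
      by simp
    have "(\<lambda>N. \<Sum>n<N. t n s) \<longlonglongrightarrow> g s"
      unfolding g_def' using summable_LIMSEQ summable_norm_cancel[OF smt[OF s]] by blast
    from tendsto_add[OF this z] show ?thesis unfolding sums_def part by simp
  qed
  show "g holomorphic_on {s. Re s > 0}"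
  proof (rule holomorphic_uniform_sequence[of _ "\<lambda>N s. \<Sum>n<N. t n s"])
    show "open {s::complex. Re s > 0}" by (rule open_halfspace_Re_gt)
    show "(\<lambda>s. \<Sum>n<N. t n s) holomorphic_on {s. Re s > 0}" for N
      unfolding t_def by (intro holomorphic_intros)
    fix x :: complex assume x: "x \<in> {s. Re s > 0}"
    define r where "r = Re x / 2"
    have r: "r > 0" using x r_def by simp
    have Re: "Re y \<ge> r" if "y \<in> cball x r" for y
    proof -
      have "\<bar>Re x - Re y\<bar> \<le> r" using that abs_Re_le_cmod[of "x - y"] by (simp add: dist_norm)
      then show ?thesis unfolding r_def by linarith
    qed
    have nrm: "norm y \<le> norm x + r" if "y \<in> cball x r" for y
      using that norm_triangle_ineq4[of x "x - y"] by (simp add: dist_norm)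
    have "uniform_limit (cball x r) (\<lambda>N s. \<Sum>n<N. t n s) g sequentially"
      unfolding g_def'
    proof (rule Weierstrass_m_test)
      show "summable (\<lambda>n. B * (norm x + r) * real (Suc n) powr (- r - 1))"
        using summable_zeta_tail[OF r] by (intro summable_mult)
      fix n y assume y: "y \<in> cball x r"
      have "norm (t n y) \<le> B * norm y * real (Suc n) powr (- Re y - 1)"
        using Re[OF y] r by (intro t_bound) auto
      also have "\<dots> \<le> B * (norm x + r) * real (Suc n) powr (- r - 1)"
        using Re[OF y] nrm[OF y] B0 r by (intro mult_mono powr_mono mult_nonneg_nonneg) auto
      finally show "norm (t n y) \<le> B * (norm x + r) * real (Suc n) powr (- r - 1)" .
    qed
    then show "\<exists>d>0. cball x d \<subseteq> {s. Re s > 0} \<and>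
        uniform_limit (cball x d) (\<lambda>N s. \<Sum>n<N. t n s) g sequentially"
      using r Re by (intro exI[of _ r]) force
  qed
qed

text \<open>Each n^(-s) is compared with the integral of x^(-s) over [n, n+1]. These integrals are
  the differences of \<open>w\<close> and telescope to 1/(s - 1), while the errors are controlled by
  \<open>powr_diff_bound\<close>.\<close>

lemma zeta_minus_pole_bound:
  assumes s: "Re s > 1"
  shows "\<exists>z. (\<lambda>n. of_nat (Suc n) powr (-s)) sums z \<and> norm (z - 1 / (s - 1)) \<le> norm s * zeta_tail (Re s)"
proof -
  define w where "w = (\<lambda>n. of_nat (Suc n) powr (1 - s) / (s - 1) :: complex)"
  define t where "t = (\<lambda>n. of_nat (Suc n) powr (-s) - (w n - w (Suc n)))"
  have s1: "s \<noteq> 1" using s by auto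
  have bound: "norm (t n) \<le> norm s * real (Suc n) powr (- Re s - 1)" for n
  proof -
    define x where "x = real (Suc n)"
    have x: "x > 0" unfolding x_def by simp
    \<comment> \<open>The increment of \<open>\<phi>\<close> over [x, x+1] is \<open>t n\<close> and
      its derivative at u is x^(-s) - u^(-s), so the mean value inequality bounds the error without
      evaluating an integral.\<close>
    define \<phi> where "\<phi> = (\<lambda>z. z * of_real x powr (-s) + z powr (1 - s) / (s - 1))"
    have "norm (\<phi> (of_real (x + 1)) - \<phi> (of_real x)) \<le>
       norm s * x powr (- Re s - 1) * norm (complex_of_real (x + 1) - of_real x)"
    proof (rule field_differentiable_bound[of "closed_segment (of_real x) (of_real (x + 1))"])
      fix z :: complex assume z: "z \<in> closed_segment (of_real x) (of_real (x + 1))"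
      then obtain u where u: "z = of_real u" "x \<le> u" "u \<le> x + 1"
        using closed_segment_of_realE by (metis less_add_one less_imp_le)
      then have u0: "u > 0" using x by simp
      have "((\<lambda>z. z powr (1-s) / (s - 1)) has_field_derivative ((1-s) * of_real u powr (1-s-1)) / (s - 1))
        (at z within closed_segment (of_real x) (of_real (x+1)))"
        unfolding u(1) by (rule DERIV_cdivide[OF powr_has_field_derivative_of_real[OF u0]])
      moreover have "((1-s) * of_real u powr (1-s-1)) / (s - 1) = - (of_real u powr (-s))"
      proof -
        have "(1 - s) * w / (s - 1) = - w" for w using s1 by (simp add: field_simps)
        moreover have "1 - s - 1 = - s" by simp
        ultimately show ?thesis by metis
      qed
      ultimately have "((\<lambda>z. z powr (1-s) / (s - 1)) has_field_derivative - (of_real u powr (-s)))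
        (at z within closed_segment (of_real x) (of_real (x+1)))" by simp
      moreover have "((\<lambda>z. z * of_real x powr (-s)) has_field_derivative of_real x powr (-s))
        (at z within closed_segment (of_real x) (of_real (x+1)))"
        by (auto intro!: derivative_eq_intros)
      ultimately have "((\<lambda>z. z * of_real x powr (-s) + z powr (1-s) / (s - 1)) has_field_derivative
          (of_real x powr (-s) + - (of_real u powr (-s))))
        (at z within closed_segment (of_real x) (of_real (x+1)))"
        by (intro DERIV_add)
      then show "(\<phi> has_field_derivative (of_real x powr (-s) - z powr (-s)))
        (at z within closed_segment (of_real x) (of_real (x+1)))"
        unfolding \<phi>_def u(1) by simp
      have "norm (of_real u powr (-s) - of_real x powr (-s)) \<le> norm s * x powr (- Re s - 1) * (u - x)"
        using powr_diff_bound[of x u s] x u s by simp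
      also have "\<dots> \<le> norm s * x powr (- Re s - 1) * 1"
        using u by (intro mult_left_mono) auto
      finally show "norm (of_real x powr (-s) - z powr (-s)) \<le> norm s * x powr (- Re s - 1)"
        unfolding u(1) by (simp add: norm_minus_commute)
    qed auto
    moreover have "\<phi> (of_real (x + 1)) - \<phi> (of_real x) = t n"
      unfolding \<phi>_def t_def w_def x_def by (simp add: algebra_simps)
    ultimately show ?thesis unfolding x_def by simp
  qed
  have sm: "summable (\<lambda>n. norm s * real (Suc n) powr (- Re s - 1))"
    using summable_zeta_tail[of "Re s"] s by (intro summable_mult) auto
  have smt: "summable (\<lambda>n. norm (t n))"
    by (rule summable_comparison_test'[OF sm, of 0]) (use bound in auto)
  have "norm (\<Sum>n. t n) \<le> (\<Sum>n. norm (t n))" by (rule summable_norm[OF smt])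
  also have "\<dots> \<le> (\<Sum>n. norm s * real (Suc n) powr (- Re s - 1))"
    by (intro suminf_le smt sm) (use bound in auto)
  also have "\<dots> = norm s * zeta_tail (Re s)"
    unfolding zeta_tail_def by (rule suminf_mult, rule summable_zeta_tail) (use s in simp)
  finally have le: "norm (\<Sum>n. t n) \<le> norm s * zeta_tail (Re s)" .
  have "(\<lambda>N. real (Suc N) powr (1 - Re s)) \<longlonglongrightarrow> 0"
    using s LIMSEQ_Suc[OF tendsto_neg_powr[of "1 - Re s" real sequentially]] filterlim_real_sequentially by simp
  then have "(\<lambda>N. norm (of_nat (Suc N) powr (1 - s) :: complex)) \<longlonglongrightarrow> 0"
    using norm_of_real_powr[of "real (Suc _)" "1 - s"] by simp
  then have "(\<lambda>N. of_nat (Suc N) powr (1 - s) :: complex) \<longlonglongrightarrow> 0" by (rule tendsto_norm_zero_cancel)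
  then have "(\<lambda>N. of_nat (Suc N) powr (1 - s) / (s - 1)) \<longlonglongrightarrow> 0 / (s - 1)"
    by (intro tendsto_divide tendsto_const) (use s1 in auto)
  then have "w \<longlonglongrightarrow> 0" unfolding w_def by simp
  then have "(\<lambda>n. w n - w (Suc n)) sums (w 0 - 0)" by (rule telescope_sums')
  moreover have "t sums (\<Sum>n. t n)" by (rule summable_sums[OF summable_norm_cancel[OF smt]])
  ultimately have "(\<lambda>n. t n + (w n - w (Suc n))) sums ((\<Sum>n. t n) + (w 0 - 0))" by (intro sums_add)
  then have "(\<lambda>n. of_nat (Suc n) powr (-s)) sums ((\<Sum>n. t n) + 1 / (s - 1))"
    unfolding t_def by (simp add: w_def)
  then show ?thesis using le by (intro exI[of _ "(\<Sum>n. t n) + 1 / (s - 1)"]) simp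
qed

text \<open>Whole periods cancel, which leaves fewer than q terms.\<close>

lemma periodic_sum_bound:
  fixes f :: "nat \<Rightarrow> complex"
  assumes per: "\<And>n. f (n + q) = f n" and z: "(\<Sum>n<q. f n) = 0" and q: "q > 0"
    and B: "\<And>n. norm (f n) \<le> B"
  shows "norm (\<Sum>n<N. f n) \<le> real q * B"
proof (induction N rule: less_induct)
  case (less N)
  have B0: "B \<ge> 0" using B[of 0] norm_ge_zero order_trans by blast
  show ?case
  proof (cases "N < q")
    case True
    have "norm (\<Sum>n<N. f n) \<le> (\<Sum>n<N. B)" by (intro sum_norm_le B)
    also have "\<dots> \<le> real q * B" using True B0 by (simp add: mult_right_mono)
    finally show ?thesis .
  next
    case False
    then obtain M where M: "N = q + M" using le_Suc_ex not_less by blast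
    have "(\<Sum>n<q + M. f n) = (\<Sum>n<q. f n) + (\<Sum>n<M. f (n + q))"
      by (induction M) (simp_all add: add.commute)
    then show ?thesis using less[of M] M q z per by simp
  qed
qed

lemma summable_bounded_dirichlet:
  fixes a :: "nat \<Rightarrow> complex"
  assumes "\<And>n. norm (a n) \<le> B" "Re s > 1"
  shows "summable (\<lambda>n. norm (a n * of_nat (Suc n) powr (-s)))"
proof (rule summable_comparison_test'[of "\<lambda>n. B * real (Suc n) powr (- Re s)" 0])
  show "summable (\<lambda>n. B * real (Suc n) powr (- Re s))"
    using summable_zeta_tail[of "Re s - 1"] assms(2) by (intro summable_mult) simp
  have "B \<ge> 0" using assms(1)[of 0] norm_ge_zero order_trans by blast
  then show "norm (norm (a n * of_nat (Suc n) powr (-s))) \<le> B * real (Suc n) powr (- Re s)" for n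
    using assms(1)[of n] norm_of_real_powr[of "real (Suc n)" "-s"]
    by (simp add: norm_mult mult_right_mono)
qed

text \<open>A periodic sequence is its mean plus a sequence with bounded partial sums, so its Dirichlet
  series can be singular on the line of real part 1 only at the pole of zeta.\<close>

lemma periodic_dirichlet_bounded:
  fixes f :: "nat \<Rightarrow> complex"
  assumes per: "\<And>n. f (n + q) = f n" and q: "q > 0" and B: "\<And>n. norm (f n) \<le> B" and t: "t \<noteq> 0"
  shows "\<exists>K. \<forall>\<sigma>. 1 < \<sigma> \<and> \<sigma> \<le> 2 \<longrightarrow>
     norm (\<Sum>n. f n * of_nat (Suc n) powr (- Complex \<sigma> t)) \<le> K"
proof -
  define \<mu> where "\<mu> = (\<Sum>n<q. f n) / of_nat q"
  define h where "h = (\<lambda>n. f n - \<mu>)"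
  have B0: "B \<ge> 0" using B[of 0] norm_ge_zero order_trans by blast
  have "norm (\<Sum>n<q. f n) \<le> (\<Sum>n<q. B)" by (intro sum_norm_le B)
  then have mu: "norm \<mu> \<le> B" unfolding \<mu>_def using q by (simp add: norm_divide field_simps)
  have hB: "norm (h n) \<le> 2 * B" for n
    unfolding h_def using norm_triangle_ineq4[of "f n" \<mu>] B[of n] mu by linarith
  have hz: "(\<Sum>n<q. h n) = 0" unfolding h_def \<mu>_def using q by (simp add: sum_subtractf)
  have part: "norm (\<Sum>n<N. h n) \<le> real q * (2 * B)" for N
    by (rule periodic_sum_bound) (use per q hz hB in \<open>auto simp: h_def\<close>)
  \<comment> \<open>The first summand bounds the mean-free part. The second bounds the mean times
    zeta, where |s - 1| \<ge> |t| controls the pole.\<close>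
  define K where "K = real q * (2 * B) * (2 + \<bar>t\<bar>) * zeta_tail 1 + B * (1 / \<bar>t\<bar> + (2 + \<bar>t\<bar>) * zeta_tail 1)"
  have "norm (\<Sum>n. f n * of_nat (Suc n) powr (- Complex \<sigma> t)) \<le> K" if \<sigma>: "1 < \<sigma>" "\<sigma> \<le> 2" for \<sigma>
  proof -
    define s where "s = Complex \<sigma> t"
    have s: "Re s > 1" "Re s > 0" unfolding s_def using \<sigma> by auto
    obtain g where g: "(\<lambda>n. h n * of_nat (Suc n) powr (-s)) sums g"
      "norm g \<le> real q * (2 * B) * norm s * zeta_tail (Re s)"
      using abel_series(1,2)[of h, OF part s(2)] by blast
    obtain z where z: "(\<lambda>n. of_nat (Suc n) powr (-s)) sums z"
      "norm (z - 1 / (s - 1)) \<le> norm s * zeta_tail (Re s)"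
      using zeta_minus_pole_bound[OF s(1)] by blast
    have "(\<lambda>n. h n * of_nat (Suc n) powr (-s) + \<mu> * of_nat (Suc n) powr (-s)) sums (g + \<mu> * z)"
      by (intro sums_add g sums_mult z)
    then have sum: "(\<Sum>n. f n * of_nat (Suc n) powr (-s)) = g + \<mu> * z"
      unfolding h_def by (simp add: sums_iff algebra_simps)
    have ns: "norm s \<le> 2 + \<bar>t\<bar>" unfolding s_def using \<sigma> cmod_le[of "Complex \<sigma> t"] by simp
    have zt: "zeta_tail (Re s) \<le> zeta_tail 1" "zeta_tail (Re s) \<ge> 0" "zeta_tail 1 \<ge> 0"
      using s by (auto intro!: zeta_tail_antimono zeta_tail_nonneg)
    have p: "norm s * zeta_tail (Re s) \<le> (2 + \<bar>t\<bar>) * zeta_tail 1"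
      using ns zt by (intro mult_mono) auto
    have "real q * (2 * B) * (norm s * zeta_tail (Re s)) \<le> real q * (2 * B) * ((2 + \<bar>t\<bar>) * zeta_tail 1)"
      using p B0 by (intro mult_left_mono) auto
    then have g': "norm g \<le> real q * (2 * B) * (2 + \<bar>t\<bar>) * zeta_tail 1"
      using g(2) by (simp only: mult.assoc)
    have "\<bar>t\<bar> \<le> norm (s - 1)" using abs_Im_le_cmod[of "s - 1"] unfolding s_def by simp
    then have "norm (1 / (s - 1)) \<le> 1 / \<bar>t\<bar>" using t by (simp add: norm_divide frac_le)
    then have "norm z \<le> 1 / \<bar>t\<bar> + (2 + \<bar>t\<bar>) * zeta_tail 1"
      using z(2) p norm_triangle_ineq[of "z - 1 / (s - 1)" "1 / (s - 1)"] by simp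
    then have "norm (\<mu> * z) \<le> B * (1 / \<bar>t\<bar> + (2 + \<bar>t\<bar>) * zeta_tail 1)"
      unfolding norm_mult using mu B0 by (intro mult_mono) auto
    then show ?thesis unfolding K_def using sum g' norm_triangle_ineq[of g "\<mu> * z"] s_def by simp
  qed
  then show ?thesis by blast
qed

section \<open>Euler products and the line of real part 1\<close>

text \<open>Removing the multiples of one more prime from the sum over \<open>rough N\<close> splits off one Euler
  factor.\<close>

definition rough :: "nat \<Rightarrow> nat set" where
  "rough N = {n. n > 0 \<and> (\<forall>p. prime p \<longrightarrow> p \<le> N \<longrightarrow> \<not> p dvd n)}"

text \<open>The factors are the inverses of the usual Euler factors, so no denominators occur and
  the limit is the reciprocal of the series.\<close>

definition euler_part :: "(nat \<Rightarrow> complex) \<Rightarrow> nat \<Rightarrow> complex" where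
  "euler_part u N = (\<Prod>p | prime p \<and> p \<le> N. 1 - u p)"

lemma euler_part_0: "euler_part u 0 = 1"
proof -
  have "{p::nat. prime p \<and> p \<le> 0} = {}" by auto
  then show ?thesis unfolding euler_part_def by (simp only: prod.empty)
qed

lemma euler_part_Suc:
  "euler_part u (Suc N) = (if prime (Suc N) then 1 - u (Suc N) else 1) * euler_part u N"
proof -
  have fin: "finite {p::nat. prime p \<and> p \<le> N}" by (rule finite_subset[of _ "{..N}"]) auto
  show ?thesis
  proof (cases "prime (Suc N)")
    case True
    then have "{p. prime p \<and> p \<le> Suc N} = insert (Suc N) {p. prime p \<and> p \<le> N}"
      by (auto simp: le_Suc_eq)
    then show ?thesis using True fin by (simp add: euler_part_def)
  next
    case False
    then have "{p. prime p \<and> p \<le> Suc N} = {p. prime p \<and> p \<le> N}"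
      by (auto simp: le_Suc_eq)
    then show ?thesis using False by (simp add: euler_part_def)
  qed
qed

lemma infsum_rough_Suc:
  fixes u :: "nat \<Rightarrow> complex"
  assumes mult: "\<And>m n. u (m * n) = u m * u n" and sm: "summable (\<lambda>n. norm (u n))"
  shows "infsum u (rough (Suc N)) = (if prime (Suc N) then 1 - u (Suc N) else 1) * infsum u (rough N)"
proof (cases "prime (Suc N)")
  case True
  define p where "p = Suc N"
  have p: "prime p" using True p_def by simp
  have so: "u summable_on A" for A
    using norm_summable_imp_summable_on[OF sm] summable_on_subset_banach by blast
  have "rough N = rough (Suc N) \<union> (*) p ` rough N"
  proof (intro equalityI subsetI)
    fix n assume n: "n \<in> rough N"
    show "n \<in> rough (Suc N) \<union> (*) p ` rough N"
    proof (cases "p dvd n")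
      case True
      then obtain k where "n = p * k" by blast
      then have "k \<in> rough N" using n by (auto simp: rough_def)
      then show ?thesis using \<open>n = p * k\<close> by blast
    next
      case False
      then show ?thesis using n by (auto simp: rough_def le_Suc_eq p_def)
    qed
  next
    fix n assume "n \<in> rough (Suc N) \<union> (*) p ` rough N"
    then show "n \<in> rough N"
    proof
      assume "n \<in> (*) p ` rough N"
      then obtain k where k: "n = p * k" "k \<in> rough N" by blast
      have "\<not> r dvd n" if r: "prime r" "r \<le> N" for r
      proof
        assume "r dvd n"
        then have "r dvd p \<or> r dvd k" using r k by (simp add: prime_dvd_mult_iff)
        moreover have "\<not> r dvd k" using k r by (auto simp: rough_def)
        ultimately have "r = p" using p r primes_dvd_imp_eq by blast
        then show False using r p_def by simp
      qed
      then show ?thesis using k p by (auto simp: rough_def prime_gt_0_nat)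
    qed (auto simp: rough_def)
  qed
  moreover have "rough (Suc N) \<inter> (*) p ` rough N = {}"
  proof -
    have "n \<notin> rough (Suc N)" if "n \<in> (*) p ` rough N" for n
    proof -
      have "p dvd n" using that by auto
      then show ?thesis using p by (auto simp: rough_def p_def)
    qed
    then show ?thesis by blast
  qed
  ultimately have "infsum u (rough N) = infsum u (rough (Suc N)) + infsum u ((*) p ` rough N)"
    using infsum_Un_disjoint[OF so so] by metis
  also have "infsum u ((*) p ` rough N) = infsum (u \<circ> (*) p) (rough N)"
    using p by (intro infsum_reindex) (auto simp: inj_on_def prime_gt_0_nat)
  also have "\<dots> = u p * infsum u (rough N)"
    using infsum_cmult_right'[of "u p" u "rough N"] by (simp add: o_def mult)
  finally have "infsum u (rough N) = infsum u (rough (Suc N)) + u p * infsum u (rough N)" .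
  then have "infsum u (rough (Suc N)) = infsum u (rough N) - u p * infsum u (rough N)"
    by (rule eq_diff_eq[THEN iffD2, OF sym])
  then show ?thesis using True by (simp add: p_def left_diff_distrib)
next
  case False
  then have "rough (Suc N) = rough N" by (auto simp: rough_def le_Suc_eq)
  then show ?thesis using False by simp
qed

text \<open>Once the primes up to N are removed, the surviving indices are 1 and numbers above N. So
  the product with the series differs from \<open>u 1 = 1\<close> by at most a tail of an absolutely
  convergent series.\<close>

lemma euler_product_tendsto:
  assumes mult: "\<And>m n. u (m * n) = u m * u n" and u1: "u 1 = 1" and u0: "u 0 = 0"
    and sm: "summable (\<lambda>n. norm (u n))"
  shows "(\<lambda>N. euler_part u N * (\<Sum>n. u (Suc n))) \<longlonglongrightarrow> 1"
proof -
  have so: "u summable_on A" for A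
    using norm_summable_imp_summable_on[OF sm] summable_on_subset_banach by blast
  have "(u has_sum suminf u) UNIV"
    by (rule norm_summable_imp_has_sum[OF sm summable_sums[OF summable_norm_cancel[OF sm]]])
  moreover have "suminf u = (\<Sum>n. u (Suc n))"
    using suminf_split_head[OF summable_norm_cancel[OF sm]] u0 by simp
  moreover have "infsum u (rough 0) = infsum u UNIV"
    by (rule infsum_cong_neutral) (auto simp: rough_def u0)
  ultimately have A0: "infsum u (rough 0) = (\<Sum>n. u (Suc n))" using infsumI by metis
  have prod: "infsum u (rough N) = euler_part u N * (\<Sum>n. u (Suc n))" for N
    by (induction N) (simp_all add: A0 euler_part_0 euler_part_Suc infsum_rough_Suc[OF mult sm])
  have "norm (infsum u (rough N) - 1) \<le> (\<Sum>n. norm (u (n + Suc N)))" for N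
  proof -
    have "rough N = insert 1 (rough N \<inter> {Suc N..})"
    proof (intro equalityI subsetI)
      fix n assume n: "n \<in> rough N"
      show "n \<in> insert 1 (rough N \<inter> {Suc N..})"
      proof (cases "n = 1")
        case False
        then obtain p where p: "prime p" "p dvd n" using prime_factor_nat by blast
        have "p > N"
        proof (rule ccontr)
          assume "\<not> p > N"
          then show False using n p by (auto simp: rough_def)
        qed
        moreover have "p \<le> n" using p n by (intro dvd_imp_le) (auto simp: rough_def)
        ultimately show ?thesis using n by simp
      qed simp
    qed (auto simp: rough_def)
    then have "infsum u (rough N) = infsum u (insert 1 (rough N \<inter> {Suc N..} - {1}))"
      by (metis insert_Diff_single)
    also have "\<dots> = u 1 + infsum u (rough N \<inter> {Suc N..} - {1})"
      by (intro infsum_insert so) auto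
    finally have eq: "infsum u (rough N) - 1 = infsum u (rough N \<inter> {Suc N..} - {1})" using u1 by simp
    have nso: "(\<lambda>n. norm (u n)) summable_on A" for A
      using norm_summable_imp_summable_on[of "\<lambda>n. norm (u n)"] sm summable_on_subset_banach by fastforce
    have "norm (infsum u (rough N) - 1) \<le> infsum (\<lambda>n. norm (u n)) (rough N \<inter> {Suc N..} - {1})"
      unfolding eq by (intro norm_infsum_bound nso)
    also have "\<dots> \<le> infsum (\<lambda>n. norm (u n)) {Suc N..}"
      by (intro infsum_mono_neutral nso) auto
    also have "{Suc N..} = (\<lambda>n. n + Suc N) ` UNIV"
    proof -
      have "n \<in> range (\<lambda>n. n + Suc N)" if "Suc N \<le> n" for n
        using that by (intro image_eqI[of _ _ "n - Suc N"]) auto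
      then show ?thesis by auto
    qed
    also have "infsum (\<lambda>n. norm (u n)) \<dots> = infsum ((\<lambda>n. norm (u n)) \<circ> (\<lambda>n. n + Suc N)) UNIV"
      by (intro infsum_reindex) (auto simp: inj_on_def)
    also have "\<dots> = (\<Sum>n. norm (u (n + Suc N)))" (is "_ = suminf ?v")
    proof -
      have sv: "summable ?v" 
        by (rule summable_iff_shift[THEN iffD2, of "\<lambda>n. norm (u n)", OF sm])
      then have "summable (\<lambda>n. norm (?v n))" by simp
      from norm_summable_imp_has_sum[OF this summable_sums[OF sv]]
      have "infsum ?v UNIV = suminf ?v" by (rule infsumI)
      then show ?thesis by (simp only: o_def)
    qed
    finally show ?thesis .
  qed
  note le = this
  have lim: "(\<lambda>N. \<Sum>n. norm (u (n + Suc N))) \<longlonglongrightarrow> 0"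
    by (rule LIMSEQ_Suc[OF suminf_exist_split2[OF sm]])
  have "(\<lambda>N. infsum u (rough N) - 1) \<longlonglongrightarrow> 0"
    by (rule Lim_null_comparison[OF always_eventually lim]) (use le in blast)
  then have "(\<lambda>N. infsum u (rough N)) \<longlonglongrightarrow> 1" by (simp add: LIM_zero_iff)
  then show ?thesis by (simp add: prod)
qed

text \<open>Turns an estimate for each inverse Euler factor into a lower bound for the
  series.\<close>

lemma tendsto_norm_ge_1:
  fixes P A :: "nat \<Rightarrow> complex"
  assumes "(\<lambda>N. P N * a) \<longlonglongrightarrow> 1" "\<And>N. norm (P N) \<le> 1"
  shows "norm a \<ge> 1"
proof -
  have "(\<lambda>N. norm (P N * a)) \<longlonglongrightarrow> 1" using tendsto_norm[OF assms(1)] by simp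
  moreover have "norm (P N * a) \<le> norm a" for N
    unfolding norm_mult using mult_right_mono[OF assms(2), of "norm a"] by simp
  ultimately show ?thesis using LIMSEQ_le_const2 by blast
qed

text \<open>Taking logarithms and expanding -ln |1 - w| reduces the claim to 3 + 4 Re y + Re (y^2)
  \<ge> 0 for the powers y of z. The case z = 0 serves the primes that divide the modulus.\<close>

lemma mertens_inequality:
  fixes x :: real and z :: complex
  assumes x: "0 \<le> x" "x < 1" and z: "norm z = 1 \<or> z = 0"
  shows "norm ((1 - of_real x) ^ 3 * (1 - of_real x * z) ^ 4 * (1 - of_real x * z\<^sup>2)) \<le> 1"
proof -
  have ln_sums: "(\<lambda>n. Re (w ^ n) / real n) sums (- ln (norm (1 - w)))" if "norm w < 1" for w :: complex
  proof -
    have "(\<lambda>n. - ((- (- w)) ^ n) / of_nat n) sums Ln (1 + - w)"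
      by (rule Ln_series') (use that in simp)
    from sums_minus[OF this] have "(\<lambda>n. w ^ n / of_nat n) sums (- Ln (1 - w))" by simp
    from sums_Re[OF this] have "(\<lambda>n. Re (w ^ n / of_nat n)) sums (- Re (Ln (1 - w)))" by simp
    moreover have "1 - w \<noteq> 0" using that by auto
    ultimately show ?thesis by (simp add: Re_divide_of_nat)
  qed
  have nz: "norm z \<le> 1" using z by auto
  have n1: "norm (complex_of_real x) < 1" using x by simp
  have n2: "norm (of_real x * z) < 1" "norm (of_real x * z\<^sup>2) < 1"
    using x nz by (auto simp: norm_mult norm_power intro!: mult_le_one
      le_less_trans[OF mult_left_le[of _ x]] power_le_one)
  have "(\<lambda>n. 3 * (Re (of_real x ^ n) / real n) + 4 * (Re ((of_real x * z) ^ n) / real n) +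
        Re ((of_real x * z\<^sup>2) ^ n) / real n) sums
     (3 * (- ln (norm (1 - complex_of_real x))) + 4 * (- ln (norm (1 - of_real x * z))) +
        (- ln (norm (1 - of_real x * z\<^sup>2))))"
    by (intro sums_add sums_mult ln_sums n1 n2)
  moreover have "0 \<le> 3 * (Re (of_real x ^ n) / real n) + 4 * (Re ((of_real x * z) ^ n) / real n) +
        Re ((of_real x * z\<^sup>2) ^ n) / real n" for n
  proof -
    define y where "y = z ^ n"
    have "0 \<le> 3 + 4 * Re y + Re (y\<^sup>2)"
    proof (cases "norm y = 1")
      case True
      then have "(Re y)\<^sup>2 + (Im y)\<^sup>2 = 1" using cmod_power2[of y] by simp
      \<comment> \<open>For |y| = 1, Re (y^2) = 2 (Re y)^2 - 1 completes the square.\<close>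
      then have "3 + 4 * Re y + Re (y\<^sup>2) = 2 * (1 + Re y)\<^sup>2"
        by (simp add: power2_eq_square algebra_simps)
      then show ?thesis by simp
    next
      case False
      have "norm z \<noteq> 1" using False by (auto simp: y_def norm_power)
      \<comment> \<open>Now z = 0, whose power is 0, or 1 at exponent 0.\<close>
      then have "y = 0 \<or> y = 1" using z unfolding y_def by (cases n) auto
      then show ?thesis by auto
    qed
    then have "0 \<le> x ^ n * (3 + 4 * Re y + Re (y\<^sup>2)) / real n" using x by simp
    also have "x ^ n * (3 + 4 * Re y + Re (y\<^sup>2)) / real n =
       3 * (Re (of_real x ^ n) / real n) + 4 * (Re ((of_real x * z) ^ n) / real n) +
        Re ((of_real x * z\<^sup>2) ^ n) / real n"
    proof -
      have "(of_real x * z) ^ n = of_real (x ^ n) * y" "(of_real x * z\<^sup>2) ^ n = of_real (x ^ n) * y\<^sup>2"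
        by (simp_all add: power_mult_distrib y_def power_mult[symmetric] mult.commute)
      moreover have "Re (complex_of_real x ^ n) = x ^ n" by (simp flip: of_real_power)
      moreover have Re_complex_of_real_mult_left: "Re (of_real a * b) = a * Re b" for a b by simp
      ultimately show ?thesis by (simp only: Re_complex_of_real_mult_left)
          (simp add: add_divide_distrib algebra_simps)
    qed
    finally show ?thesis .
  qed
  ultimately have "0 \<le> 3 * (- ln (norm (1 - complex_of_real x))) + 4 * (- ln (norm (1 - of_real x * z))) +
        (- ln (norm (1 - of_real x * z\<^sup>2)))"
    by (metis (no_types, lifting) sums_le sums_zero)
  moreover have pos: "norm (1 - complex_of_real x) > 0" "norm (1 - of_real x * z) > 0"
      "norm (1 - of_real x * z\<^sup>2) > 0"
    using n1 n2 by (metis eq_iff_diff_eq_0 less_irrefl norm_one zero_less_norm_iff)+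
  ultimately have "ln (norm (1 - complex_of_real x) ^ 3 * norm (1 - of_real x * z) ^ 4 *
      norm (1 - of_real x * z\<^sup>2)) \<le> 0"
    by (simp add: ln_mult ln_realpow)
  then show ?thesis using pos by (simp add: norm_mult norm_power ln_le_zero_iff)
qed

lemma norm_prod_le_1:
  fixes f :: "'b \<Rightarrow> complex"
  assumes "\<And>x. x \<in> A \<Longrightarrow> norm (f x) \<le> 1"
  shows "norm (prod f A) \<le> 1"
  using norm_prod_le[of f A] prod_le_1[of A "\<lambda>x. norm (f x)"] assms by fastforce

text \<open>\<open>suminf\<close> is the limit of the ordered partial sums, so for a primitive
  character the same constant also denotes the series for 0 < Re s \<le> 1, which
  \<open>abel_series\<close> shows to converge.\<close>

definition dseries :: "(nat \<Rightarrow> complex) \<Rightarrow> complex \<Rightarrow> complex" where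
  "dseries c s = (\<Sum>n. c (Suc n) * of_nat (Suc n) powr (-s))"

locale mult_coeffs =
  fixes c :: "nat \<Rightarrow> complex"
  assumes c_mult: "c (m * n) = c m * c n" and c_1: "c 1 = 1" and c_le: "norm (c n) \<le> 1"
begin

lemma summable_term:
  assumes "Re s > 1"
  shows "summable (\<lambda>n. norm (c n * of_nat n powr (-s)))"
  using summable_bounded_dirichlet[of "\<lambda>n. c (Suc n)" 1 s] c_le assms
  by (subst summable_Suc_iff[symmetric]) simp

lemma dseries_sums: "Re s > 1 \<Longrightarrow> (\<lambda>n. c (Suc n) * of_nat (Suc n) powr (-s)) sums dseries c s"
  unfolding dseries_def
  by (rule summable_sums[OF summable_norm_cancel[OF
        summable_bounded_dirichlet[of "\<lambda>n. c (Suc n)" 1 s]]]) (use c_le in auto)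

lemma dseries_euler:
  assumes "Re s > 1"
  shows "(\<lambda>N. euler_part (\<lambda>n. c n * of_nat n powr (-s)) N * dseries c s) \<longlonglongrightarrow> 1"
  unfolding dseries_def
proof (rule euler_product_tendsto)
  show "c (m * n) * of_nat (m * n) powr (-s) = c m * of_nat m powr (-s) * (c n * of_nat n powr (-s))" for m n
    using powr_times_real[of "of_nat m" "of_nat n" "-s"] by (simp add: c_mult mult_ac)
qed (use c_1 summable_term[OF assms] in auto)

end

interpretation one: mult_coeffs "\<lambda>_. 1" by unfold_locales auto

lemma euler_part_mult: "euler_part u N * euler_part v N = (\<Prod>p | prime p \<and> p \<le> N. (1 - u p) * (1 - v p))"
  by (simp add: euler_part_def prod.distrib)

context mult_coeffs begin

text \<open>The inverse Euler factor at s, paired with that of zeta at Re s, has modulus at most (1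
  + x)(1 - x) \<le> 1, where x = p^(-Re s). Thus the series is at least 1/zeta(Re s) in
  modulus.\<close>

lemma dseries_lower_bound:
  assumes s: "Re s > 1"
  shows "norm (dseries c s) * norm (dseries (\<lambda>_. 1) (of_real (Re s))) \<ge> 1"
proof -
  define P where "P = euler_part (\<lambda>n. c n * of_nat n powr (-s))"
  define P1 where "P1 = euler_part (\<lambda>n. 1 * of_nat n powr (- of_real (Re s)))"
  have "(\<lambda>N. (P N * dseries c s) * (P1 N * dseries (\<lambda>_. 1) (of_real (Re s)))) \<longlonglongrightarrow> 1 * 1"
    unfolding P_def P1_def by (intro tendsto_mult dseries_euler one.dseries_euler) (use s in auto)
  then have "(\<lambda>N. (P N * P1 N) * (dseries c s * dseries (\<lambda>_. 1) (of_real (Re s)))) \<longlonglongrightarrow> 1"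
    by (simp add: mult_ac)
  moreover have "norm (P N * P1 N) \<le> 1" for N
    unfolding P_def P1_def euler_part_mult
  proof (rule norm_prod_le_1)
    fix p :: nat assume "p \<in> {p. prime p \<and> p \<le> N}"
    then have p: "p > 1" using prime_gt_1_nat by blast
    define x where "x = real p powr (- Re s)"
    have x: "0 \<le> x" "x \<le> 1" unfolding x_def using p s by (auto intro!: powr_le_one_le simp: powr_minus inverse_le_1_iff ge_one_powr_ge_zero)
    have e: "of_nat p powr (- of_real (Re s)) = complex_of_real x"
      unfolding x_def using powr_of_real[of "real p" "- Re s"] by simp
    have "norm (c p * of_nat p powr (-s)) \<le> 1 * x"
      unfolding norm_mult x_def using c_le norm_of_real_powr[of "real p" "-s"] p by (intro mult_mono) auto
    then have "norm (1 - c p * of_nat p powr (-s)) \<le> 1 + x"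
      using norm_triangle_ineq4[of 1 "c p * of_nat p powr (-s)"] by simp
    moreover have "norm (1 - complex_of_real x) = 1 - x" using x
      by (metis abs_of_nonneg diff_ge_0_iff_ge norm_of_real of_real_1 of_real_diff)
    ultimately have "norm ((1 - c p * of_nat p powr (-s)) * (1 - 1 * of_nat p powr (- of_real (Re s)))) \<le> (1 + x) * (1 - x)"
      unfolding norm_mult mult_1 e using x by (intro mult_mono) auto
    also have "\<dots> \<le> 1" by (simp add: algebra_simps)
    finally show "norm ((1 - c p * of_nat p powr (-s)) * (1 - 1 * of_nat p powr (- of_real (Re s)))) \<le> 1" .
  qed
  ultimately have "norm (dseries c s * dseries (\<lambda>_. 1) (of_real (Re s))) \<ge> 1"
    by (rule tendsto_norm_ge_1)
  then show ?thesis by (simp only: norm_mult)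
qed

end

text \<open>Zeta is decreasing on the real axis, so its value at \<open>c0\<close> serves the whole
  half-plane. This keeps the denominator of the quotient of completed functions away from 0.\<close>

lemma (in mult_coeffs) dseries_away_from_0:
  assumes c: "c0 > 1"
  shows "\<exists>\<delta>>0. \<forall>s. Re s \<ge> c0 \<longrightarrow> norm (dseries c s) \<ge> \<delta>"
proof -
  define Z where "Z = (\<Sum>n. real (Suc n) powr (- c0))"
  have sm: "summable (\<lambda>n. real (Suc n) powr (- c0))"
    using summable_zeta_tail[of "c0 - 1"] c by simp
  have Zle: "norm (dseries (\<lambda>_. 1) (of_real \<sigma>)) \<le> Z" if "\<sigma> \<ge> c0" for \<sigma>
  proof -
    have sm1: "summable (\<lambda>n. norm (1 * of_nat (Suc n) powr (- complex_of_real \<sigma>)))"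
      by (rule summable_bounded_dirichlet) (use that c in auto)
    have le: "norm (1 * of_nat (Suc n) powr (- complex_of_real \<sigma>)) \<le> real (Suc n) powr (- c0)" for n
      using norm_of_real_powr[of "real (Suc n)" "- of_real \<sigma>"] that by (simp add: powr_mono)
    have "norm (dseries (\<lambda>_. 1) (of_real \<sigma>)) \<le> (\<Sum>n. norm (1 * of_nat (Suc n) powr (- complex_of_real \<sigma>)))"
      unfolding dseries_def by (rule summable_norm[OF sm1])
    also have "\<dots> \<le> Z" unfolding Z_def by (intro suminf_le sm1 sm le)
    finally show ?thesis .
  qed
  have Z: "Z > 0" unfolding Z_def by (intro suminf_pos sm) auto
  have "norm (dseries c s) \<ge> 1 / Z" if "Re s \<ge> c0" for s
  proof -
    have "1 \<le> norm (dseries c s) * norm (dseries (\<lambda>_. 1) (of_real (Re s)))"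
      by (rule dseries_lower_bound) (use that c in simp)
    also have "\<dots> \<le> norm (dseries c s) * Z" using Zle[OF that] by (intro mult_left_mono) auto
    finally show ?thesis using Z by (simp add: field_simps)
  qed
  then show ?thesis using Z by (intro exI[of _ "1 / Z"]) auto
qed

text \<open>\<open>mertens_inequality\<close> at every prime p, with x = p^(-\<sigma>) and z = c(p)
  p^(-it).\<close>

lemma (in mult_coeffs) three_four_one:
  assumes \<sigma>: "\<sigma> > 1" and c_norm: "\<And>n. norm (c n) = 1 \<or> c n = 0"
  shows "norm (dseries (\<lambda>_. 1) (of_real \<sigma>)) ^ 3 * norm (dseries c (Complex \<sigma> t)) ^ 4 *
     norm (dseries (\<lambda>n. (c n)\<^sup>2) (Complex \<sigma> (2 * t))) \<ge> 1"
proof -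
  interpret sq: mult_coeffs "\<lambda>n. (c n)\<^sup>2"
    by unfold_locales (use c_mult c_1 c_le in \<open>auto simp: power_mult_distrib norm_power power_le_one\<close>)
  define P1 where "P1 = euler_part (\<lambda>n. 1 * of_nat n powr (- of_real \<sigma>))"
  define P2 where "P2 = euler_part (\<lambda>n. c n * of_nat n powr (- Complex \<sigma> t))"
  define P3 where "P3 = euler_part (\<lambda>n. (c n)\<^sup>2 * of_nat n powr (- Complex \<sigma> (2 * t)))"
  define Z A B where "Z = dseries (\<lambda>_. 1) (of_real \<sigma>)" and "A = dseries c (Complex \<sigma> t)"
    and "B = dseries (\<lambda>n. (c n)\<^sup>2) (Complex \<sigma> (2 * t))"
  have "(\<lambda>N. (P1 N * Z) ^ 3 * (P2 N * A) ^ 4 * (P3 N * B)) \<longlonglongrightarrow> 1 ^ 3 * 1 ^ 4 * 1"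
    unfolding P1_def P2_def P3_def Z_def A_def B_def
    by (intro tendsto_mult tendsto_power dseries_euler one.dseries_euler sq.dseries_euler) (use \<sigma> in auto)
  then have "(\<lambda>N. (P1 N ^ 3 * P2 N ^ 4 * P3 N) * (Z ^ 3 * A ^ 4 * B)) \<longlonglongrightarrow> 1"
    by (simp add: power_mult_distrib mult_ac)
  moreover have "norm (P1 N ^ 3 * P2 N ^ 4 * P3 N) \<le> 1" for N
    unfolding P1_def P2_def P3_def euler_part_def prod_power_distrib prod.distrib[symmetric]
  proof (rule norm_prod_le_1)
    fix p :: nat assume "p \<in> {p. prime p \<and> p \<le> N}"
    then have p: "p > 1" using prime_gt_1_nat by blast
    define x where "x = real p powr (- \<sigma>)"
    have x: "0 \<le> x" "x < 1" unfolding x_def using p \<sigma> powr_less_mono[of "-\<sigma>" 0 "real p"] by auto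
    define w where "w = of_nat p powr (Complex 0 (-t))"
    have e1: "of_nat p powr (- of_real \<sigma>) = complex_of_real x"
      unfolding x_def using powr_of_real[of "real p" "- \<sigma>"] by simp
    have "- Complex \<sigma> t = - of_real \<sigma> + Complex 0 (-t)" by (simp add: complex_eq_iff)
    then have e2: "of_nat p powr (- Complex \<sigma> t) = complex_of_real x * w"
      by (simp only: powr_add e1 w_def)
    have "- Complex \<sigma> (2 * t) = - of_real \<sigma> + (Complex 0 (-t) + Complex 0 (-t))" by (simp add: complex_eq_iff)
    then have e3: "of_nat p powr (- Complex \<sigma> (2 * t)) = complex_of_real x * w\<^sup>2"
      by (simp only: powr_add e1 w_def power2_eq_square)
    have nw: "norm w = 1" unfolding w_def using norm_of_real_powr[of "real p" "Complex 0 (-t)"] p by simp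
    have "norm (c p * w) = 1 \<or> c p * w = 0" using c_norm[of p] nw by (auto simp: norm_mult)
    from mertens_inequality[OF x this]
    show "norm ((1 - 1 * of_nat p powr (- of_real \<sigma>)) ^ 3 * (1 - c p * of_nat p powr (- Complex \<sigma> t)) ^ 4 *
       (1 - (c p)\<^sup>2 * of_nat p powr (- Complex \<sigma> (2 * t)))) \<le> 1"
      unfolding e1 e2 e3 by (simp add: power_mult_distrib mult_ac)
  qed
  ultimately have "norm (Z ^ 3 * A ^ 4 * B) \<ge> 1" by (rule tendsto_norm_ge_1)
  then show ?thesis unfolding Z_def A_def B_def by (simp add: norm_mult norm_power)
qed

text \<open>If the continuation \<open>f\<close> vanished at \<open>1 + it\<close>, the left-hand side of the three-four-one
  inequality would be of order \<open>(\<sigma> - 1)\<^sup>-\<^sup>3\<^sup>+\<^sup>4\<close>.\<close>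

lemma (in mult_coeffs) nonzero_on_line_1:
  assumes c_norm: "\<And>n. norm (c n) = 1 \<or> c n = 0"
    and per: "\<And>n. c (n + q) = c n" and q: "q > 0" and t: "t \<noteq> 0"
    and f: "f holomorphic_on UNIV" "\<And>s. Re s > 1 \<Longrightarrow> f s = dseries c s"
  shows "f (Complex 1 t) \<noteq> 0"
proof
  assume z: "f (Complex 1 t) = 0"
  have "f field_differentiable (at (Complex 1 t))"
    using f(1) by (simp add: holomorphic_on_def)
  then obtain D where D: "(f has_field_derivative D) (at (Complex 1 t))"
    using field_differentiable_def by blast
  have "((\<lambda>z. (f z - f (Complex 1 t)) / (z - Complex 1 t)) \<longlongrightarrow> D) (at (Complex 1 t))"
    using D by (simp add: has_field_derivative_iff)
  then have "\<forall>\<^sub>F z in at (Complex 1 t). norm (f z / (z - Complex 1 t)) < norm D + 1"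
    using order_tendstoD(2)[OF tendsto_norm] z by fastforce
  then obtain d where d: "d > 0" "\<And>z. z \<noteq> Complex 1 t \<Longrightarrow> dist z (Complex 1 t) < d \<Longrightarrow>
      norm (f z / (z - Complex 1 t)) < norm D + 1"
    unfolding eventually_at by auto
  have fb: "norm (dseries c (Complex \<sigma> t)) \<le> (norm D + 1) * (\<sigma> - 1)" if "1 < \<sigma>" "\<sigma> < 1 + d" for \<sigma>
  proof -
    have e: "Complex \<sigma> t - Complex 1 t = of_real (\<sigma> - 1)" by (simp add: complex_eq_iff)
    have "norm (f (Complex \<sigma> t) / of_real (\<sigma> - 1)) < norm D + 1"
      using d(2)[of "Complex \<sigma> t"] that e by (auto simp: dist_norm simp flip: of_real_diff)
    then have "norm (f (Complex \<sigma> t)) / (\<sigma> - 1) < norm D + 1"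
      using that by (simp add: norm_divide del: of_real_diff)
    then show ?thesis using that f(2)[of "Complex \<sigma> t"] by (simp add: field_simps)
  qed
  \<comment> \<open>The squared coefficients are periodic too, so their series stays bounded near 1
    + 2it; t \<noteq> 0 keeps this point away from the pole of zeta.\<close>
  obtain K where K: "\<And>\<sigma>. 1 < \<sigma> \<Longrightarrow> \<sigma> \<le> 2 \<Longrightarrow> norm (dseries (\<lambda>n. (c n)\<^sup>2) (Complex \<sigma> (2 * t))) \<le> K"
    using periodic_dirichlet_bounded[of "\<lambda>n. (c (Suc n))\<^sup>2" q 1 "2 * t"] per[of "Suc _"] q t c_le
    unfolding dseries_def by (auto simp: norm_power power_le_one)
  define M where "M = 1 + 2 * zeta_tail 1"
  have M0: "M \<ge> 1" unfolding M_def using zeta_tail_nonneg[of 1] by simp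
  have Z: "norm (dseries (\<lambda>_. 1) (of_real \<sigma>)) * (\<sigma> - 1) \<le> M" if \<sigma>: "1 < \<sigma>" "\<sigma> \<le> 2" for \<sigma>
  proof -
    obtain z where z: "(\<lambda>n. of_nat (Suc n) powr (- complex_of_real \<sigma>)) sums z"
      "norm (z - 1 / (of_real \<sigma> - 1)) \<le> norm (complex_of_real \<sigma>) * zeta_tail \<sigma>"
      using zeta_minus_pole_bound[of "of_real \<sigma>"] \<sigma> by auto
    have zz: "dseries (\<lambda>_. 1) (of_real \<sigma>) = z" unfolding dseries_def using z(1) by (simp add: sums_iff)
    have "norm (1 / (complex_of_real \<sigma> - 1)) = 1 / (\<sigma> - 1)"
    proof -
      have "complex_of_real \<sigma> - 1 = of_real (\<sigma> - 1)" by simp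
      then show ?thesis using \<sigma> by (simp only: norm_divide norm_of_real norm_one)
    qed
    moreover have "norm (complex_of_real \<sigma>) * zeta_tail \<sigma> \<le> 2 * zeta_tail 1"
      using \<sigma> zeta_tail_antimono[of 1 \<sigma>] zeta_tail_nonneg[of \<sigma>] by (intro mult_mono) auto
    ultimately have "norm z \<le> 1 / (\<sigma> - 1) + 2 * zeta_tail 1"
      using z(2) norm_triangle_ineq[of "z - 1 / (of_real \<sigma> - 1)" "1 / (of_real \<sigma> - 1)"] by simp
    then have "norm z * (\<sigma> - 1) \<le> (1 / (\<sigma> - 1) + 2 * zeta_tail 1) * (\<sigma> - 1)"
      using \<sigma> by (intro mult_right_mono) auto
    also have "\<dots> = 1 + 2 * zeta_tail 1 * (\<sigma> - 1)" using \<sigma> by (simp add: field_simps)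
    also have "\<dots> \<le> M" unfolding M_def using \<sigma> zeta_tail_nonneg[of 1] mult_left_le[of "\<sigma> - 1" "2 * zeta_tail 1"] by simp
    finally show ?thesis using zz by simp
  qed
  define R where "R = M ^ 3 * (norm D + 1) ^ 4 * (\<bar>K\<bar> + 1)"
  have R0: "R > 0" unfolding R_def using M0 by (intro mult_pos_pos zero_less_power add_nonneg_pos) auto
  \<comment> \<open>Small enough for the difference quotient bound (h < d), for \<sigma> \<le> 2,
    and for R h \<le> 1/2, which contradicts the lower bound 1.\<close>
  define h where "h = min (d / 2) (min 1 (1 / (2 * R)))"
  have h: "h > 0" "h < d" "h \<le> 1" "h \<le> 1 / (2 * R)" unfolding h_def using d(1) R0 by auto
  define \<sigma> where "\<sigma> = 1 + h"
  define X Y W where "X = norm (dseries (\<lambda>_. 1) (of_real \<sigma>))" and "Y = norm (dseries c (Complex \<sigma> t))"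
    and "W = norm (dseries (\<lambda>n. (c n)\<^sup>2) (Complex \<sigma> (2 * t)))"
  have "1 \<le> X ^ 3 * Y ^ 4 * W"
    unfolding X_def Y_def W_def by (rule three_four_one) (use h c_norm in \<open>auto simp: \<sigma>_def\<close>)
  also have "\<dots> \<le> X ^ 3 * ((norm D + 1) * h) ^ 4 * (\<bar>K\<bar> + 1)"
    using fb[of \<sigma>] K[of \<sigma>] h unfolding X_def Y_def W_def \<sigma>_def
    by (intro mult_mono power_mono mult_nonneg_nonneg zero_le_power) auto
  also have "\<dots> = (X * h) ^ 3 * (norm D + 1) ^ 4 * (\<bar>K\<bar> + 1) * h"
    by (simp add: power_mult_distrib eval_nat_numeral algebra_simps)
  also have "\<dots> \<le> R * h"
    unfolding R_def using Z[of \<sigma>] h unfolding X_def \<sigma>_def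
    by (intro mult_right_mono power_mono) auto
  also have "\<dots> \<le> R * (1 / (2 * R))" using h R0 by (intro mult_left_mono) auto
  also have "\<dots> < 1" using R0 by simp
  finally show False by simp
qed

section \<open>Mellin transforms of the kernels\<close>

lemma absolutely_integrable_scale:
  fixes f :: "real \<Rightarrow> 'a::euclidean_space"
  assumes f: "f absolutely_integrable_on {0<..}" and c: "c > 0"
  shows "(\<lambda>x. f (c * x)) absolutely_integrable_on {0<..}"
    and "integral {0<..} (\<lambda>x. f (c * x)) = (1 / c) *\<^sub>R integral {0<..} f"
proof -
  have img: "(\<lambda>x. c * x) ` {0<..} = {0<..}"
  proof (intro equalityI subsetI)
    fix y assume "y \<in> {0::real<..}"
    then show "y \<in> (\<lambda>x. c * x) ` {0<..}" using c by (intro image_eqI[of _ _ "y / c"]) auto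
  qed (use c in auto)
  have *: "(\<lambda>x. \<bar>c\<bar> *\<^sub>R f (c * x)) absolutely_integrable_on {0<..} \<and>
      integral {0<..} (\<lambda>x. \<bar>c\<bar> *\<^sub>R f (c * x)) = integral {0<..} f"
  proof (rule has_absolute_integral_change_of_variables_real[THEN iffD2])
    show "((\<lambda>x. c * x) has_field_derivative c) (at x within {0<..})" for x
      by (auto intro!: derivative_eq_intros)
    show "inj_on (\<lambda>x. c * x) {0<..}" using c by (auto simp: inj_on_def)
  qed (use f img in auto)
  then have "(\<lambda>x. (1 / c) *\<^sub>R (\<bar>c\<bar> *\<^sub>R f (c * x))) absolutely_integrable_on {0<..}"
    using absolutely_integrable_scaleR_left by blast
  then show "(\<lambda>x. f (c * x)) absolutely_integrable_on {0<..}" using c by simp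
  have "integral {0<..} (\<lambda>x. (1 / c) *\<^sub>R (\<bar>c\<bar> *\<^sub>R f (c * x))) = (1 / c) *\<^sub>R integral {0<..} f"
    using * by (simp only: integral_cmul)
  then show "integral {0<..} (\<lambda>x. f (c * x)) = (1 / c) *\<^sub>R integral {0<..} f" using c by simp
qed

text \<open>Replacing x by l x in the integral gives the factor l^(-s-1), and summability of the L1
  norms permits integration term by term. It is used twice: with scales n and the exponential for
  the series of \<theta>, and with scales 1/\<open>c_freq\<close> and the rational kernel for its
  partial fractions.\<close>

lemma mellin_sum:
  fixes v :: "real \<Rightarrow> complex" and a :: "nat \<Rightarrow> complex" and l :: "nat \<Rightarrow> real"
  assumes v: "(\<lambda>x. of_real x powr s * v x) absolutely_integrable_on {0<..}"
    and l: "\<And>n. l n > 0" and sm: "summable (\<lambda>n. norm (a n) * l n powr (- Re s - 1))"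
    and pt: "\<And>x. x > 0 \<Longrightarrow> summable (\<lambda>n. norm (a n * v (l n * x)))"
  shows "(\<lambda>n. a n * of_real (l n) powr (-s - 1) * integral {0<..} (\<lambda>x. of_real x powr s * v x))
     sums integral {0<..} (\<lambda>x. of_real x powr s * (\<Sum>n. a n * v (l n * x)))"
proof -
  define F where "F = (\<lambda>x. complex_of_real x powr s * v x)"
  have Fs: "of_real x powr s * (a n * v (l n * x)) = a n * of_real (l n) powr (-s) * F (l n * x)"
    if "x > 0" for x n
  proof -
    have "complex_of_real (l n * x) powr s = of_real (l n) powr s * of_real x powr s"
      using that l[of n] by (simp add: powr_times_real)
    moreover have "complex_of_real (l n) powr (-s) * of_real (l n) powr s = 1"
      using l[of n] by (simp flip: powr_add)
    ultimately show ?thesis unfolding F_def by (simp add: mult_ac)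
  qed
  define k where "k = (\<lambda>n. a n * complex_of_real (l n) powr (-s))"
  have FI: "F absolutely_integrable_on {0<..}" using v F_def by simp
  have nFI: "(\<lambda>x. norm (F x)) absolutely_integrable_on {0<..}"
    by (rule absolutely_integrable_norm[OF FI, unfolded o_def])
  define g where "g = (\<lambda>n x. indicator {0<..} x *\<^sub>R (k n * F (l n * x)))"
  have ga: "(\<lambda>x. k n * F (l n * x)) absolutely_integrable_on {0<..}" for n
    using absolutely_integrable_scale(1)[OF FI l] by (rule set_integrable_mult_right)
  have gi: "integrable lebesgue (g n)" for n
    using ga[of n] unfolding g_def set_integrable_def .
  have gL: "integral\<^sup>L lebesgue (g n) = a n * of_real (l n) powr (-s - 1) * integral {0<..} F" for n
  proof -
    have "integral\<^sup>L lebesgue (g n) = integral {0<..} (\<lambda>x. k n * F (l n * x))"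
      using set_lebesgue_integral_eq_integral(2)[OF ga[of n]] unfolding g_def set_lebesgue_integral_def .
    also have "\<dots> = k n * ((1 / l n) *\<^sub>R integral {0<..} F)"
      using absolutely_integrable_scale[OF FI l[of n]] by simp
    also have "\<dots> = a n * (of_real (l n) powr (-s) / of_real (l n)) * integral {0<..} F"
      by (simp add: k_def scaleR_conv_of_real)
    also have "of_real (l n) powr (-s) / of_real (l n) = complex_of_real (l n) powr (-s - 1)"
      using l[of n] by (simp add: powr_diff)
    finally show ?thesis .
  qed
  have gN: "(LINT x|lebesgue. norm (g n x)) = norm (a n) * l n powr (- Re s - 1) * integral {0<..} (\<lambda>x. norm (F x))" for n
  proof -
    have "(\<lambda>x. norm (k n) * norm (F (l n * x))) absolutely_integrable_on {0<..}"
      using absolutely_integrable_scale(1)[OF nFI l] by (rule set_integrable_mult_right)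
    from set_lebesgue_integral_eq_integral(2)[OF this]
    have "(LINT x|lebesgue. norm (g n x)) = integral {0<..} (\<lambda>x. norm (k n) * norm (F (l n * x)))"
      unfolding g_def set_lebesgue_integral_def by (simp add: norm_mult)
    also have "\<dots> = norm (k n) * ((1 / l n) *\<^sub>R integral {0<..} (\<lambda>x. norm (F x)))"
      using absolutely_integrable_scale[OF nFI l[of n]] by simp
    also have "norm (k n) * ((1 / l n) *\<^sub>R integral {0<..} (\<lambda>x. norm (F x))) =
       norm (a n) * (l n powr (- Re s) / l n) * integral {0<..} (\<lambda>x. norm (F x))"
      using norm_of_real_powr[OF l, of n "-s"] by (simp add: k_def norm_mult)
    also have "l n powr (- Re s) / l n = l n powr (- Re s - 1)" using l[of n] by (simp add: powr_diff)
    finally show ?thesis .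
  qed
  have "(\<lambda>n. integral\<^sup>L lebesgue (g n)) sums (LINT x|lebesgue. (\<Sum>n. g n x))"
  proof (rule sums_integral[OF gi])
    show "AE x in lebesgue. summable (\<lambda>n. norm (g n x))"
    proof (rule AE_I2)
      fix x :: real
      show "summable (\<lambda>n. norm (g n x))"
      proof (cases "x > 0")
        case True
        have "summable (\<lambda>n. norm (of_real x powr s :: complex) * norm (a n * v (l n * x)))"
          by (rule summable_mult[OF pt[OF True]])
        then have "summable (\<lambda>n. norm (of_real x powr s * (a n * v (l n * x))))" by (simp add: norm_mult)
        then show ?thesis using True unfolding Fs[OF True] by (simp add: g_def k_def)
      qed (simp add: g_def)
    qed
    show "summable (\<lambda>n. LINT x|lebesgue. norm (g n x))"
      unfolding gN by (rule summable_mult2[OF sm])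
  qed
  moreover have "(LINT x|lebesgue. (\<Sum>n. g n x)) = integral {0<..} (\<lambda>x. of_real x powr s * (\<Sum>n. a n * v (l n * x)))"
  proof -
    have "integrable lebesgue (\<lambda>x. \<Sum>n. g n x)"
    proof (rule integrable_suminf[OF gi])
      show "AE x in lebesgue. summable (\<lambda>n. norm (g n x))"
      proof (rule AE_I2)
        fix x :: real
        show "summable (\<lambda>n. norm (g n x))"
        proof (cases "x > 0")
          case True
          have "summable (\<lambda>n. norm (of_real x powr s :: complex) * norm (a n * v (l n * x)))"
            by (rule summable_mult[OF pt[OF True]])
          then have "summable (\<lambda>n. norm (of_real x powr s * (a n * v (l n * x))))" by (simp add: norm_mult)
          then show ?thesis using True unfolding Fs[OF True] by (simp add: g_def k_def)
        qed (simp add: g_def)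
      qed
      show "summable (\<lambda>n. LINT x|lebesgue. norm (g n x))"
        unfolding gN by (rule summable_mult2[OF sm])
    qed
    moreover have eq: "(\<Sum>n. g n x) = indicator {0<..} x *\<^sub>R (of_real x powr s * (\<Sum>n. a n * v (l n * x)))" for x
    proof (cases "x > 0")
      case True
      have "summable (\<lambda>n. a n * v (l n * x))" by (rule summable_norm_cancel[OF pt[OF True]])
      then have "(\<Sum>n. of_real x powr s * (a n * v (l n * x))) = of_real x powr s * (\<Sum>n. a n * v (l n * x))"
        by (rule suminf_mult)
      then show ?thesis using True by (simp add: g_def Fs[OF True] k_def)
    qed (simp add: g_def)
    ultimately have "(\<lambda>x. of_real x powr s * (\<Sum>n. a n * v (l n * x))) absolutely_integrable_on {0<..}"
      unfolding set_integrable_def by (simp only: eq)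
    from set_lebesgue_integral_eq_integral(2)[OF this] show ?thesis
      unfolding set_lebesgue_integral_def by (simp only: eq)
  qed
  ultimately show ?thesis by (simp only: gL F_def)
qed

text \<open>The substitution t = x^2 / (1 + x^2) maps the half-line onto (0, 1) and turns the Beta
  integrand into twice the present one.\<close>

lemma beta_half_line:
  fixes a b :: real
  assumes a: "a > 0" and b: "b > 0"
  shows "(\<lambda>x. x powr (2 * a - 1) * (1 + x\<^sup>2) powr (- (a + b))) absolutely_integrable_on {0<..}"
    and "integral {0<..} (\<lambda>x. x powr (2 * a - 1) * (1 + x\<^sup>2) powr (- (a + b))) = Beta a b / 2"
proof -
  define B where "B = (\<lambda>t::real. t powr (a - 1) * (1 - t) powr (b - 1))"
  define g where "g = (\<lambda>x::real. x\<^sup>2 / (1 + x\<^sup>2))"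
  define g' where "g' = (\<lambda>x::real. 2 * x / (1 + x\<^sup>2)\<^sup>2)"
  have pos: "1 + x\<^sup>2 > 0" for x :: real by (rule add_pos_nonneg) auto
  have "(B has_integral Beta a b) {0..1}" unfolding B_def by (rule has_integral_Beta_real[OF a b])
  then have hB: "(B has_integral Beta a b) {0<..<1}" by (simp add: has_integral_Icc_iff_Ioo)
  have Babs: "B absolutely_integrable_on {0<..<1}"
    by (rule nonnegative_absolutely_integrable_1) (use hB in \<open>auto simp: B_def has_integral_integrable\<close>)
  have img: "g ` {0<..} = {0<..<1}"
  proof (intro equalityI subsetI)
    fix y assume y: "y \<in> {0::real<..<1}"
    define x where "x = sqrt (y / (1 - y))"
    have x2: "x\<^sup>2 = y / (1 - y)" and x0: "x > 0" unfolding x_def using y by auto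
    have "1 + x\<^sup>2 = 1 / (1 - y)" using y by (simp add: x2 field_simps)
    then have "g x = y" using y by (simp add: g_def x2)
    then show "y \<in> g ` {0<..}" using x0 by auto
  qed (use pos in \<open>auto simp: g_def divide_simps\<close>)
  have *: "(\<lambda>x. \<bar>g' x\<bar> *\<^sub>R B (g x)) absolutely_integrable_on {0<..} \<and>
     integral {0<..} (\<lambda>x. \<bar>g' x\<bar> *\<^sub>R B (g x)) = Beta a b"
  proof (rule has_absolute_integral_change_of_variables_real[of "{0<..}" g g' B, THEN iffD2])
    show "(g has_field_derivative g' x) (at x within {0<..})" for x
      unfolding g_def g'_def using pos[of x]
      by (auto intro!: derivative_eq_intros simp: power2_eq_square divide_simps) (simp add: algebra_simps)
    show "inj_on g {0<..}"
    proof (rule inj_onI)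
      fix x y assume xy: "x \<in> {0<..}" "y \<in> {0<..}" "g x = g y"
      then have "x\<^sup>2 * (1 + y\<^sup>2) = y\<^sup>2 * (1 + x\<^sup>2)" unfolding g_def using pos[of x] pos[of y]
        by (simp add: divide_simps split: if_splits)
      then have "x\<^sup>2 = y\<^sup>2" by (simp add: algebra_simps)
      then show "x = y" using xy by (simp add: power2_eq_iff_nonneg)
    qed
    show "B absolutely_integrable_on g ` {0<..} \<and> integral (g ` {0<..}) B = Beta a b"
      using Babs hB img by (simp add: integral_unique)
  qed auto
  have eq: "\<bar>g' x\<bar> *\<^sub>R B (g x) = 2 * (x powr (2 * a - 1) * (1 + x\<^sup>2) powr (- (a + b)))" if "x \<in> {0<..}" for x
  proof -
    have x: "x > 0" using that by simp
    define w where "w = 1 + x\<^sup>2"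
    have w: "w > 0" unfolding w_def by (rule pos)
    have "1 - g x = 1 / w" unfolding g_def w_def using pos[of x] by (simp add: field_simps)
    moreover have "g x = x powr 2 / w" unfolding g_def w_def using x by simp
    moreover have "(x powr 2 / w) powr (a - 1) = x powr (2 * (a - 1)) * w powr (-(a-1))"
    proof -
      have "(x powr 2 / w) powr (a - 1) = (x powr 2) powr (a - 1) / w powr (a - 1)"
        using w by (intro powr_divide)
      then show ?thesis by (simp only: powr_powr powr_minus divide_inverse)
    qed
    moreover have "(1 / w) powr (b - 1) = w powr (-(b-1))"
    proof -
      have "(1 / w) powr (b - 1) = 1 powr (b - 1) / w powr (b - 1)"
        using w by (intro powr_divide)
      then show ?thesis by (simp only: powr_one_eq_one powr_minus divide_inverse mult_1)
    qed
    ultimately have "B (g x) = x powr (2 * (a - 1)) * w powr (-(a-1)) * w powr (-(b-1))"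
      unfolding B_def by (simp only:)
    moreover have "\<bar>g' x\<bar> = 2 * x powr 1 * w powr (-2)"
      unfolding g'_def w_def[symmetric] using x w by (simp add: powr_minus_divide)
    ultimately have "\<bar>g' x\<bar> *\<^sub>R B (g x) = 2 * (x powr 1 * x powr (2 * (a - 1))) * (w powr (-2) * w powr (-(a-1)) * w powr (-(b-1)))"
      by simp
    also have "x powr 1 * x powr (2 * (a - 1)) = x powr (2 * a - 1)"
      unfolding powr_add[symmetric] by (simp add: algebra_simps)
    also have "w powr (-2) * w powr (-(a-1)) * w powr (-(b-1)) = w powr (- (a + b))"
      unfolding powr_add[symmetric] by (rule arg_cong[of _ _ "\<lambda>t. w powr t"]) simp
    finally show ?thesis unfolding w_def by simp
  qed
  have 1: "(\<lambda>x. 2 * (x powr (2 * a - 1) * (1 + x\<^sup>2) powr (- (a + b)))) absolutely_integrable_on {0<..}"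
    by (rule iffD1[OF set_integrable_cong[OF refl refl eq] conjunct1[OF *]])
  have 2: "integral {0<..} (\<lambda>x. 2 * (x powr (2 * a - 1) * (1 + x\<^sup>2) powr (- (a + b)))) = Beta a b"
    by (rule trans[OF sym[OF integral_cong[OF eq]] conjunct2[OF *]])
  show "(\<lambda>x. x powr (2 * a - 1) * (1 + x\<^sup>2) powr (- (a + b))) absolutely_integrable_on {0<..}"
    using set_integrable_mult_right[OF 1, of "1/2"] by simp
  show "integral {0<..} (\<lambda>x. x powr (2 * a - 1) * (1 + x\<^sup>2) powr (- (a + b))) = Beta a b / 2"
    using 2 by simp
qed

text \<open>Differentiating rGamma z * rGamma (1 - z) = sin (\<pi> z) / \<pi> gives the cotangent
  formula for Digamma, and differentiating that gives the claim. The two trigamma values are the two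
  halves of the sum of 1/(z + n)^2 over all integers.\<close>

lemma Polygamma_1_reflection:
  fixes z :: complex
  assumes "z \<notin> \<int>"
  shows "Polygamma 1 z + Polygamma 1 (1 - z) = (of_real pi / sin (of_real pi * z))\<^sup>2"
proof -
  have nz: "z \<notin> \<int>\<^sub>\<le>\<^sub>0" "1 - z \<notin> \<int>\<^sub>\<le>\<^sub>0" if "z \<notin> \<int>" for z :: complex
  proof -
    show "z \<notin> \<int>\<^sub>\<le>\<^sub>0" using that nonpos_Ints_Int by blast
    show "1 - z \<notin> \<int>\<^sub>\<le>\<^sub>0"
    proof
      assume "1 - z \<in> \<int>\<^sub>\<le>\<^sub>0"
      then have "1 - (1 - z) \<in> \<int>" by (intro Ints_diff Ints_1 nonpos_Ints_Int)
      then show False using that by simp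
    qed
  qed
  have sin0: "sin (of_real pi * z) \<noteq> 0" if "z \<notin> \<int>" for z :: complex
  proof
    assume "sin (of_real pi * z) = 0"
    then obtain n :: int where "of_real pi * z = of_real (of_int n * pi)"
      unfolding sin_eq_0 by blast
    then have "z = of_int n" by simp
    then show False using that by simp
  qed
  have D: "Digamma (1 - z) - Digamma z = of_real pi * cos (of_real pi * z) / sin (of_real pi * z)"
    if z: "z \<notin> \<int>" for z :: complex
  proof -
    have "((\<lambda>z. rGamma z * rGamma (1 - z)) has_field_derivative
       (- rGamma z * Digamma z) * rGamma (1 - z) + (- rGamma (1 - z) * Digamma (1 - z)) * (-1) * rGamma z) (at z)"
      by (rule derivative_eq_intros has_field_derivative_rGamma_no_nonpos_int nz z refl
        DERIV_chain2[OF has_field_derivative_rGamma_no_nonpos_int] | simp add: nz[OF z])+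
    moreover have "(- rGamma z * Digamma z) * rGamma (1 - z) + (- rGamma (1 - z) * Digamma (1 - z)) * (-1) * rGamma z
        = rGamma z * rGamma (1 - z) * (Digamma (1 - z) - Digamma z)"
      by (simp add: algebra_simps)
    ultimately have "((\<lambda>z. sin (of_real pi * z) / of_real pi) has_field_derivative
       rGamma z * rGamma (1 - z) * (Digamma (1 - z) - Digamma z)) (at z)"
      by (simp only: rGamma_reflection_complex)
    moreover have "((\<lambda>z. sin (of_real pi * z) / of_real pi) has_field_derivative cos (of_real pi * z)) (at z)"
      by (auto intro!: derivative_eq_intros)
    ultimately have "rGamma z * rGamma (1 - z) * (Digamma (1 - z) - Digamma z) = cos (of_real pi * z)"
      by (metis DERIV_unique)
    then show ?thesis using sin0[OF z] by (simp add: rGamma_reflection_complex field_simps)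
  qed
  have op: "open (- \<int> :: complex set)" using closed_Ints by (simp add: open_Compl)
  have "((\<lambda>z. Digamma (1 - z) - Digamma z) has_field_derivative - Polygamma 1 (1 - z) - Polygamma 1 z) (at z)"
    by (auto intro!: derivative_eq_intros simp: nz[OF assms])
  moreover have "((\<lambda>z. of_real pi * cos (of_real pi * z) / sin (of_real pi * z)) has_field_derivative
      - (of_real pi / sin (of_real pi * z))\<^sup>2) (at z)"
  proof -
    define S C where "S = sin (of_real pi * z)" and "C = cos (of_real pi * z)"
    have "((\<lambda>z. of_real pi * cos (of_real pi * z) / sin (of_real pi * z)) has_field_derivative
      (of_real pi * (- S * of_real pi) * S - of_real pi * C * (C * of_real pi)) / (S * S)) (at z)"
      unfolding S_def C_def using sin0[OF assms] by (auto intro!: derivative_eq_intros)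
    moreover have "(of_real pi * (- S * of_real pi) * S - of_real pi * C * (C * of_real pi)) / (S * S) =
        - (of_real pi)\<^sup>2 * (S\<^sup>2 + C\<^sup>2) / S\<^sup>2"
      by (simp add: power2_eq_square algebra_simps)
    moreover have "S\<^sup>2 + C\<^sup>2 = 1" unfolding S_def C_def by (rule sin_cos_squared_add)
    ultimately show ?thesis by (simp add: S_def power_divide)
  qed
  then have "((\<lambda>z. Digamma (1 - z) - Digamma z) has_field_derivative - (of_real pi / sin (of_real pi * z))\<^sup>2) (at z)"
    by (rule has_field_derivative_transform_within_open[OF _ op]) (use assms D in auto)
  ultimately have "- Polygamma 1 (1 - z) - Polygamma 1 z = - (of_real pi / sin (of_real pi * z))\<^sup>2"
    by (rule DERIV_unique)
  then show ?thesis by (simp add: algebra_simps)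
qed

text \<open>Both halves of the partial fraction expansion of \<open>1 / (2 sinh (y / 2))\<^sup>2\<close>.\<close>

lemma exp_partial_fractions:
  assumes y: "Re y > 0"
  shows "\<exists>A B. (\<lambda>j. 1 / (y + 2 * of_real pi * \<i> * of_nat j)\<^sup>2) sums A \<and>
     (\<lambda>j. 1 / (y - 2 * of_real pi * \<i> * of_nat (Suc j))\<^sup>2) sums B \<and>
     A + B = exp (-y) / (1 - exp (-y))\<^sup>2"
proof -
  define w where "w = 2 * of_real pi * \<i>"
  have w0: "w \<noteq> 0" unfolding w_def by simp
  have w2: "w\<^sup>2 = - 4 * (of_real pi)\<^sup>2" unfolding w_def by (simp add: power_mult_distrib)
  \<comment> \<open>Division by 2 \<pi> i moves the poles to the integers, and Re y > 0 keeps z off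
    the real axis.\<close>
  define z where "z = y / w"
  have zw: "w * z = y" using w0 by (simp add: z_def)
  have z: "z \<notin> \<int>"
  proof
    assume "z \<in> \<int>"
    then obtain k where "z = of_int k" by (auto elim: Ints_cases)
    then have "y = w * of_int k" using zw by simp
    then have "Re y = 0" by (simp add: w_def)
    then show False using y by simp
  qed
  then have z0: "z \<noteq> 0" "1 - z \<noteq> 0" by auto
  have S: "(\<lambda>k. inverse ((u + of_nat k)\<^sup>2)) sums Polygamma 1 u" if "u \<noteq> 0" for u :: complex
  proof -
    have "summable (\<lambda>k. inverse ((u + of_nat k)\<^sup>2))" by (rule Polygamma_converges'[OF that]) simp
    then show ?thesis by (simp add: Polygamma_def sums_iff numeral_2_eq_2)
  qed
  have A: "(\<lambda>j. 1 / w\<^sup>2 * inverse ((z + of_nat j)\<^sup>2)) sums (1 / w\<^sup>2 * Polygamma 1 z)"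
    and B: "(\<lambda>j. 1 / w\<^sup>2 * inverse ((1 - z + of_nat j)\<^sup>2)) sums (1 / w\<^sup>2 * Polygamma 1 (1 - z))"
    by (intro sums_mult S z0)+
  have A': "1 / w\<^sup>2 * inverse ((z + of_nat j)\<^sup>2) = 1 / (y + 2 * of_real pi * \<i> * of_nat j)\<^sup>2" for j
  proof -
    have "y + 2 * of_real pi * \<i> * of_nat j = w * (z + of_nat j)"
      by (simp add: distrib_left zw) (simp add: w_def)
    then show ?thesis by (simp only: power_mult_distrib) (simp add: divide_inverse)
  qed
  have B': "1 / w\<^sup>2 * inverse ((1 - z + of_nat j)\<^sup>2) = 1 / (y - 2 * of_real pi * \<i> * of_nat (Suc j))\<^sup>2" for j
  proof -
    have "y - 2 * of_real pi * \<i> * of_nat (Suc j) = w * (- (1 - z + of_nat j))"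
      by (simp add: distrib_left right_diff_distrib zw) (simp add: w_def)
    then show ?thesis by (simp only: power_mult_distrib power2_minus) (simp add: divide_inverse)
  qed
  \<comment> \<open>Since i \<pi> z = y / 2, the sine is (u - 1/u) / (2i); the minus signs of w^2
    and of the squared sine cancel.\<close>
  define u where "u = exp (y / 2)"
  have u0: "u \<noteq> 0" unfolding u_def by simp
  have "sin (of_real pi * z) = (u - inverse u) / (2 * \<i>)"
  proof -
    have "\<i> * (of_real pi * z) = y / 2" using zw by (simp add: w_def field_simps)
    then have e: "exp (\<i> * (of_real pi * z)) = u" by (simp only: u_def)
    have "exp (- (\<i> * (of_real pi * z))) = inverse u" by (simp only: exp_minus e)
    then show ?thesis unfolding sin_exp_eq by (simp only: e)
  qed
  then have "(sin (of_real pi * z))\<^sup>2 = - ((u - inverse u)\<^sup>2) / 4" by (simp add: power_divide power_mult_distrib)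
  then have "1 / w\<^sup>2 * (of_real pi / sin (of_real pi * z))\<^sup>2 = 1 / (u - inverse u)\<^sup>2"
    using w2 by (simp add: power_divide field_simps)
  also have "\<dots> = exp (-y) / (1 - exp (-y))\<^sup>2"
  proof -
    have "exp y = u\<^sup>2" unfolding u_def by (simp add: power2_eq_square flip: exp_add)
    then have "exp (-y) = inverse (u\<^sup>2)" by (simp add: exp_minus)
    moreover have "inverse (u\<^sup>2) / (1 - inverse (u\<^sup>2))\<^sup>2 = 1 / (u * (1 - inverse (u\<^sup>2)))\<^sup>2"
      using u0 by (simp add: power_mult_distrib divide_inverse)
    moreover have "u * (1 - inverse (u\<^sup>2)) = u - inverse u"
      using u0 by (simp add: field_simps power2_eq_square)
    ultimately show ?thesis by simp
  qed
  finally have "1 / w\<^sup>2 * Polygamma 1 z + 1 / w\<^sup>2 * Polygamma 1 (1 - z) = exp (-y) / (1 - exp (-y))\<^sup>2"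
    by (simp only: Polygamma_1_reflection[OF z] flip: distrib_left)
  then show ?thesis using A B unfolding A' B' by blast
qed

section \<open>Mellin transforms of bounded functions with exponential decay\<close>

lemma powr_exp_bound_integrable:
  fixes \<sigma> :: real
  assumes "\<sigma> > -1"
  shows "(\<lambda>x. x powr \<sigma> * exp (- x)) integrable_on {0<..}"
proof -
  have "((\<lambda>t. t powr (\<sigma> + 1 - 1) / exp t) has_integral Gamma (\<sigma> + 1)) {0..}"
    by (rule Gamma_integral_real) (use assms in simp)
  then have "((\<lambda>t. t powr \<sigma> * exp (-t)) has_integral Gamma (\<sigma> + 1)) {0..}"
    by (simp add: exp_minus divide_inverse)
  then have "((\<lambda>t. if t \<in> {0<..} then t powr \<sigma> * exp (-t) else 0) has_integral Gamma (\<sigma> + 1)) {0..}"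
    by (rule has_integral_spike[of "{0}", rotated 2]) auto
  then have "((\<lambda>t. t powr \<sigma> * exp (-t)) has_integral Gamma (\<sigma> + 1)) {0<..}"
    by (subst (asm) has_integral_restrict) auto
  then show ?thesis by blast
qed

lemma mellin_abs_integrable:
  fixes h :: "real \<Rightarrow> complex"
  assumes h: "continuous_on {0<..} h" "\<And>x. x > 0 \<Longrightarrow> norm (h x) \<le> C * exp (- x)" and s: "Re s > -1"
  shows "(\<lambda>x. of_real x powr s * h x) absolutely_integrable_on {0<..}"
proof (rule measurable_bounded_by_integrable_imp_absolutely_integrable)
  show "(\<lambda>x. of_real x powr s * h x) \<in> borel_measurable (lebesgue_on {0<..})"
    by (intro continuous_imp_measurable_on_sets_lebesgue continuous_intros h) (auto simp: complex_nonpos_Reals_iff)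
  show "(\<lambda>x. C * (x powr Re s * exp (- x))) integrable_on {0<..}"
    using integrable_on_mult_right[OF powr_exp_bound_integrable[OF s], of C] by simp
  show "norm (of_real x powr s * h x) \<le> C * (x powr Re s * exp (- x))" if "x \<in> {0<..}" for x
    using mult_left_mono[OF h(2)[of x], of "x powr Re s"] norm_of_real_powr[of x s] that
    by (simp add: norm_mult mult_ac)
qed auto

text \<open>The integrals over the compact intervals \<open>I n\<close> are holomorphic by
  differentiation under the integral sign, and they converge locally uniformly because their errors
  have a common integrable majorant.\<close>

lemma mellin_holomorphic:
  fixes h :: "real \<Rightarrow> complex"
  assumes h: "continuous_on {0<..} h" "\<And>x. x > 0 \<Longrightarrow> norm (h x) \<le> C * exp (- x)"
  shows "(\<lambda>s. integral {0<..} (\<lambda>x. of_real x powr s * h x)) holomorphic_on {s. Re s > -1}"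
proof (rule holomorphic_uniform_sequence[of _ "\<lambda>n s. integral {1 / Suc n..Suc n} (\<lambda>x. of_real x powr s * h x)"])
  let ?S = "{s. Re s > -1}"
  define I where "I = (\<lambda>n. {1 / real (Suc n)..real (Suc n)})"
  have Isub: "I n \<subseteq> {0<..}" for n unfolding I_def by (auto intro: less_le_trans[of 0 "1 / real (Suc n)"])
  have "0 \<le> C * exp (- 1)" using order_trans[OF norm_ge_zero h(2)[of 1]] by simp
  then have C0: "C \<ge> 0" by (simp add: zero_le_mult_iff)
  show "open ?S" by (rule open_halfspace_Re_gt)
  show "(\<lambda>s. integral {1 / Suc n..Suc n} (\<lambda>x. of_real x powr s * h x)) holomorphic_on ?S" for n
  proof -
    have hc: "continuous_on (I n) h" using h(1) Isub continuous_on_subset by blast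
    have "(\<lambda>s. integral (cbox (1 / Suc n) (Suc n)) (\<lambda>x. exp (s * of_real (ln x)) * h x)) holomorphic_on ?S"
    proof (rule leibniz_rule_holomorphic[where fx = "\<lambda>s x. of_real (ln x) * exp (s * of_real (ln x)) * h x"])
      show "((\<lambda>s. exp (s * of_real (ln x)) * h x) has_field_derivative of_real (ln x) * exp (s * of_real (ln x)) * h x) (at s within ?S)" for s x
        by (auto intro!: derivative_eq_intros)
      show "(\<lambda>x. exp (s * of_real (ln x)) * h x) integrable_on cbox (1 / Suc n) (Suc n)" for s
      proof -
        have "continuous_on (I n) (\<lambda>x. exp (s * of_real (ln x)) * h x)"
          using Isub[of n] by (auto intro!: continuous_intros hc)
        then show ?thesis unfolding I_def cbox_interval by (rule integrable_continuous_real)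
      qed
      show "convex ?S" by (rule convex_halfspace_Re_gt)
      have "continuous_on (?S \<times> I n) (\<lambda>z. of_real (ln (snd z)) * exp (fst z * of_real (ln (snd z))) * h (snd z))"
        using Isub[of n] by (intro continuous_intros continuous_on_compose2[OF hc]) auto
      then show "continuous_on (?S \<times> cbox (1 / Suc n) (Suc n)) (\<lambda>(s, x). of_real (ln x) * exp (s * of_real (ln x)) * h x)"
        unfolding cbox_interval I_def by (simp add: case_prod_unfold)
    qed
    moreover have "exp (s * of_real (ln x)) * h x = of_real x powr s * h x" if "x \<in> I n" for s x
      using Isub[of n] that by (auto simp: powr_def Ln_of_real)
    then have "integral (I n) (\<lambda>x. exp (s * of_real (ln x)) * h x) = integral (I n) (\<lambda>x. of_real x powr s * h x)" for s
      by (intro integral_cong)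
    ultimately show ?thesis unfolding cbox_interval I_def by (simp only:)
  qed
  fix x :: complex assume x: "x \<in> ?S"
  define d where "d = (Re x + 1) / 2"
  have d: "d > 0" using x d_def by simp
  have Re: "\<bar>Re y - Re x\<bar> \<le> d" if "y \<in> cball x d" for y
    using that abs_Re_le_cmod[of "x - y"] by (simp add: dist_norm abs_minus_commute)
  have Re1: "Re y > -1" if "y \<in> cball x d" for y proof -
    have "Re x - Re y \<le> (Re x + 1) / 2" using Re[OF that] unfolding d_def by linarith
    then show ?thesis using x by (simp add: field_simps)
  qed
  \<comment> \<open>For real parts within d of Re x, t^y is at most the sum of the powers with the
    two extreme exponents, one for t \<le> 1 and one for t \<ge> 1. Both exponents exceed -1 because
    d is half the distance of Re x from -1.\<close>
  define D where "D = (\<lambda>t. C * (t powr (Re x - d) * exp (- t) + t powr (Re x + d) * exp (- t)))"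
  have "Re x - d > -1" "Re x + d > -1" using x unfolding d_def by (simp_all add: field_simps)
  then have D_int: "D integrable_on {0<..}"
    unfolding D_def by (intro integrable_on_mult_right integrable_add powr_exp_bound_integrable)
  have D0: "D t \<ge> 0" for t unfolding D_def using C0 by simp
  have bound: "norm (of_real t powr y * h t) \<le> D t" if "y \<in> cball x d" "t > 0" for y t
  proof -
    have "t powr Re y \<le> t powr (Re x - d) + t powr (Re x + d)"
    proof (cases "t \<ge> 1")
      case True
      then have "t powr Re y \<le> t powr (Re x + d)" using Re[OF that(1)] by (intro powr_mono) auto
      then show ?thesis by (simp add: add_increasing)
    next
      case False
      then have "t powr Re y \<le> t powr (Re x - d)" using Re[OF that(1)] that by (intro powr_mono') auto
      then show ?thesis by (simp add: add_increasing2)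
    qed
    then have "t powr Re y * (C * exp (-t)) \<le> (t powr (Re x - d) + t powr (Re x + d)) * (C * exp (-t))"
      using C0 by (intro mult_right_mono) auto
    moreover have "norm (of_real t powr y * h t) \<le> t powr Re y * (C * exp (-t))"
      using mult_left_mono[OF h(2)[OF that(2)], of "t powr Re y"] norm_of_real_powr[OF that(2), of y] by (simp add: norm_mult)
    ultimately show ?thesis unfolding D_def by (simp add: algebra_simps)
  qed
  define e where "e = (\<lambda>n. integral {0<..} D - integral (I n) D)"
  have DI: "(\<lambda>t. if t \<in> I n then D t else 0) integrable_on {0<..}" for n
  proof -
    have "continuous_on (I n) D" unfolding D_def using Isub[of n] by (auto intro!: continuous_intros)
    then have "D integrable_on I n" unfolding I_def by (rule integrable_continuous_real)
    then have "D integrable_on (I n \<inter> {0<..})" using Isub[of n] by (simp add: Int_absorb2)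
    then show ?thesis using integrable_restrict_Int[of "I n" D "{0<..}"] by simp
  qed
  have DIi: "integral {0<..} (\<lambda>t. if t \<in> I n then D t else 0) = integral (I n) D" for n
    using integral_restrict_Int[of "{0<..}" "I n" D] Isub[of n] by (simp add: Int_absorb2)
  have "(\<lambda>n. integral {0<..} (\<lambda>t. if t \<in> I n then D t else 0)) \<longlonglongrightarrow> integral {0<..} D"
  proof (rule dominated_convergence(2)[OF DI D_int])
    show "norm (if t \<in> I n then D t else 0) \<le> D t" for n t using D0[of t] by simp
    show "(\<lambda>n. if t \<in> I n then D t else 0) \<longlonglongrightarrow> D t" if t: "t \<in> {0<..}" for t
    proof (rule tendsto_eventually)
      obtain N where N: "t \<le> real N" "1 / t \<le> real N" using real_arch_simple[of "max t (1 / t)"] by auto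
      have "t \<in> I n" if "n \<ge> N" for n
      proof -
        have "1 / t \<le> real (Suc n)" "t \<le> real (Suc n)" using N that by linarith+
        then show ?thesis using t unfolding I_def by (auto simp: field_simps)
      qed
      then show "\<forall>\<^sub>F n in sequentially. (if t \<in> I n then D t else 0) = D t"
        unfolding eventually_sequentially by auto
    qed
  qed
  then have "(\<lambda>n. integral {0<..} D - integral (I n) D) \<longlonglongrightarrow> integral {0<..} D - integral {0<..} D"
    unfolding DIi by (intro tendsto_diff tendsto_const)
  then have e_lim: "e \<longlonglongrightarrow> 0" unfolding e_def by simp
  have err: "norm (integral (I n) (\<lambda>t. of_real t powr y * h t) - integral {0<..} (\<lambda>t. of_real t powr y * h t)) \<le> e n"
    if y: "y \<in> cball x d" for n y
  proof -
    define f where "f = (\<lambda>t. of_real t powr y * h t)"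
    have f: "f integrable_on {0<..}"
      unfolding f_def using mellin_abs_integrable[OF h Re1[OF y]] set_lebesgue_integral_eq_integral(1) by blast
    have "continuous_on (I n) f" unfolding f_def using Isub[of n] h(1)
      by (intro continuous_intros continuous_on_subset[OF h(1)]) (auto simp: complex_nonpos_Reals_iff)
    then have "f integrable_on I n" unfolding I_def by (rule integrable_continuous_real)
    then have "f integrable_on (I n \<inter> {0<..})" using Isub[of n] by (simp add: Int_absorb2)
    then have fI: "(\<lambda>t. if t \<in> I n then f t else 0) integrable_on {0<..}"
      using integrable_restrict_Int[of "I n" f "{0<..}"] by simp
    have fIi: "integral {0<..} (\<lambda>t. if t \<in> I n then f t else 0) = integral (I n) f"
      using integral_restrict_Int[of "{0<..}" "I n" f] Isub[of n] by (simp add: Int_absorb2)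
    have "integral {0<..} f - integral (I n) f = integral {0<..} (\<lambda>t. f t - (if t \<in> I n then f t else 0))"
      using integral_diff[OF f fI] fIi by simp
    also have "norm \<dots> \<le> integral {0<..} (\<lambda>t. D t - (if t \<in> I n then D t else 0))"
      by (rule integral_norm_bound_integral[OF integrable_diff[OF f fI] integrable_diff[OF D_int DI]])
         (use bound[OF y] in \<open>auto simp: f_def\<close>)
    also have "\<dots> = e n" using integral_diff[OF D_int DI] DIi by (simp add: e_def)
    finally show ?thesis unfolding f_def by (simp add: norm_minus_commute)
  qed
  have "uniform_limit (cball x d) (\<lambda>n s. integral (I n) (\<lambda>t. of_real t powr s * h t))
     (\<lambda>s. integral {0<..} (\<lambda>t. of_real t powr s * h t)) sequentially"
  proof (rule uniform_limitI)
    fix r :: real assume "r > 0"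
    then have "\<forall>\<^sub>F n in sequentially. e n < r" using order_tendstoD(2)[OF e_lim] by blast
    then show "\<forall>\<^sub>F n in sequentially. \<forall>s\<in>cball x d.
       dist (integral (I n) (\<lambda>t. of_real t powr s * h t)) (integral {0<..} (\<lambda>t. of_real t powr s * h t)) < r"
      by (rule eventually_mono) (unfold dist_norm, blast intro: le_less_trans[OF err])
  qed
  then show "\<exists>d>0. cball x d \<subseteq> ?S \<and> uniform_limit (cball x d)
      (\<lambda>n s. integral {1 / Suc n..Suc n} (\<lambda>x. of_real x powr s * h x))
      (\<lambda>s. integral {0<..} (\<lambda>x. of_real x powr s * h x)) sequentially"
    using d Re1 unfolding I_def by (intro exI[of _ d]) auto
qed

lemma inverse_squares_sum:
  fixes x :: real
  shows "1 / (of_real x + \<i>)\<^sup>2 + 1 / (of_real x - \<i>)\<^sup>2 = complex_of_real (2 * (1 + x\<^sup>2) powr (-1) - 4 * (1 + x\<^sup>2) powr (-2))"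
    and "1 / (of_real x + \<i>)\<^sup>2 - 1 / (of_real x - \<i>)\<^sup>2 = - 4 * \<i> * complex_of_real (x * (1 + x\<^sup>2) powr (-2))"
proof -
  define w where "w = 1 + x\<^sup>2"
  have w: "w > 0" unfolding w_def by (rule add_pos_nonneg) auto
  have p: "(of_real x + \<i>) * (of_real x - \<i>) = complex_of_real w"
    by (simp add: w_def algebra_simps power2_eq_square)
  have nz: "of_real x + \<i> \<noteq> 0" "of_real x - \<i> \<noteq> 0" by (auto simp: complex_eq_iff)
  have i: "1 / (of_real x + \<i>) = (of_real x - \<i>) / complex_of_real w"
     "1 / (of_real x - \<i>) = (of_real x + \<i>) / complex_of_real w"
    unfolding p[symmetric] using nz by simp_all
  have i2: "1 / (of_real x + \<i>)\<^sup>2 = (of_real x - \<i>)\<^sup>2 / (complex_of_real w)\<^sup>2"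
     "1 / (of_real x - \<i>)\<^sup>2 = (of_real x + \<i>)\<^sup>2 / (complex_of_real w)\<^sup>2"
    using i by (metis power_divide power_one)+
  have wp: "w powr (-1) = w / w\<^sup>2" "w powr (-2) = 1 / w\<^sup>2"
    using w by (simp_all add: powr_minus_divide power2_eq_square)
  have "1 / (of_real x + \<i>)\<^sup>2 + 1 / (of_real x - \<i>)\<^sup>2 = (2 * of_real w - 4) / (complex_of_real w)\<^sup>2"
    unfolding i2 add_divide_distrib[symmetric] by (simp add: w_def power2_eq_square algebra_simps)
  also have "\<dots> = complex_of_real (2 * w powr (-1) - 4 * w powr (-2))"
    unfolding wp by (simp add: diff_divide_distrib)
  finally show "1 / (of_real x + \<i>)\<^sup>2 + 1 / (of_real x - \<i>)\<^sup>2 = complex_of_real (2 * (1 + x\<^sup>2) powr (-1) - 4 * (1 + x\<^sup>2) powr (-2))"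
    unfolding w_def .
  have "1 / (of_real x + \<i>)\<^sup>2 - 1 / (of_real x - \<i>)\<^sup>2 = (- 4 * \<i> * of_real x) / (complex_of_real w)\<^sup>2"
    unfolding i2 diff_divide_distrib[symmetric] by (simp add: power2_eq_square algebra_simps)
  also have "\<dots> = - 4 * \<i> * complex_of_real (x * w powr (-2))"
    unfolding wp by simp
  finally show "1 / (of_real x + \<i>)\<^sup>2 - 1 / (of_real x - \<i>)\<^sup>2 = - 4 * \<i> * complex_of_real (x * (1 + x\<^sup>2) powr (-2))"
    unfolding w_def .
qed

lemma has_integral_of_real_complex:
  fixes f :: "real \<Rightarrow> real"
  assumes "f absolutely_integrable_on S"
  shows "(\<lambda>x. complex_of_real (f x)) absolutely_integrable_on S"
    and "integral S (\<lambda>x. complex_of_real (f x)) = complex_of_real (integral S f)"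
proof -
  show "(\<lambda>x. complex_of_real (f x)) absolutely_integrable_on S"
    using absolutely_integrable_linear[OF assms bounded_linear_of_real] by (simp add: o_def)
  show "integral S (\<lambda>x. complex_of_real (f x)) = complex_of_real (integral S f)"
    using integral_linear[OF set_lebesgue_integral_eq_integral(1)[OF assms] bounded_linear_of_real] by (simp add: o_def)
qed

text \<open>The two fractions combine to 2 / (1 + x^2) - 4 / (1 + x^2)^2, which gives two Beta
  integrals; the recursion of Gamma merges them into one product.\<close>

lemma kernel_mellin_even:
  fixes s :: real
  assumes s: "-1 < s" "s < 1"
  defines "f \<equiv> \<lambda>x. complex_of_real x powr of_real s * (1 / (of_real x + \<i>)\<^sup>2 + 1 / (of_real x - \<i>)\<^sup>2)"
  shows "f absolutely_integrable_on {0<..}"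
    and "integral {0<..} f = of_real (s * Gamma ((s + 1) / 2) * Gamma ((1 - s) / 2))"
proof -
  define a b where "a = (s + 1) / 2" and "b = (1 - s) / 2"
  have ab: "a > 0" "b > 0" "b + 1 > 0" unfolding a_def b_def using s by (auto intro: add_pos_pos)
  define p1 where "p1 = (\<lambda>x::real. x powr (2 * a - 1) * (1 + x\<^sup>2) powr (- (a + b)))"
  define p2 where "p2 = (\<lambda>x::real. x powr (2 * a - 1) * (1 + x\<^sup>2) powr (- (a + (b + 1))))"
  note p1 = beta_half_line[OF ab(1,2), folded p1_def] and p2 = beta_half_line[OF ab(1,3), folded p2_def]
  define g where "g = (\<lambda>x. 2 * p1 x - 4 * p2 x)"
  have gi: "g absolutely_integrable_on {0<..}"
    unfolding g_def by (intro set_integral_diff(1) set_integrable_mult_right p1 p2)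
  have e: "2 * a - 1 = s" "a + b = 1" "a + (b + 1) = 2" by (simp_all add: a_def b_def field_simps)
  have fg: "f x = of_real (g x)" if "x \<in> {0<..}" for x
  proof -
    have "complex_of_real x powr of_real s = of_real (x powr s)" using that powr_of_real[of x s] by simp
    then have "f x = complex_of_real (x powr s * (2 * (1 + x\<^sup>2) powr (-1) - 4 * (1 + x\<^sup>2) powr (-2)))"
      unfolding f_def inverse_squares_sum(1) by (simp only: of_real_mult)
    then show ?thesis unfolding g_def p1_def p2_def e by (simp add: algebra_simps)
  qed
  show "f absolutely_integrable_on {0<..}"
    by (rule iffD2[OF set_integrable_cong[OF refl refl fg] has_integral_of_real_complex(1)[OF gi]])
  have "integral {0<..} g = 2 * integral {0<..} p1 - 4 * integral {0<..} p2"
    unfolding g_def using set_lebesgue_integral_eq_integral(1)[OF p1(1)] set_lebesgue_integral_eq_integral(1)[OF p2(1)]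
    by (subst integral_diff) (auto intro: integrable_on_mult_right)
  also have "\<dots> = Beta a b - 2 * Beta a (b + 1)" using p1(2) p2(2) by simp
  also have "\<dots> = Gamma a * Gamma b - 2 * (Gamma a * (b * Gamma b))"
  proof -
    have "Gamma (2::real) = 1" using Gamma_fact[of 1, where 'a = real] by simp
    moreover have "b \<notin> \<int>\<^sub>\<le>\<^sub>0" using ab(2) nonpos_Ints_nonpos[of b] by auto
    then have "Gamma (b + 1) = b * Gamma b" by (rule Gamma_plus1)
    ultimately show ?thesis unfolding Beta_def e by simp
  qed
  \<comment> \<open>Here 1 - 2 b = s.\<close>
  also have "\<dots> = s * Gamma a * Gamma b" unfolding b_def by (simp add: field_simps)
  finally have "integral {0<..} g = s * Gamma a * Gamma b" .
  moreover have "integral {0<..} f = of_real (integral {0<..} g)"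
    by (rule trans[OF integral_cong[OF fg] has_integral_of_real_complex(2)[OF gi]])
  ultimately show "integral {0<..} f = of_real (s * Gamma ((s + 1) / 2) * Gamma ((1 - s) / 2))"
    by (simp only: a_def b_def)
qed

lemma kernel_mellin_odd:
  fixes s :: real
  assumes s: "-1 < s" "s < 1"
  defines "f \<equiv> \<lambda>x. complex_of_real x powr of_real s * (1 / (of_real x + \<i>)\<^sup>2 - 1 / (of_real x - \<i>)\<^sup>2)"
  shows "f absolutely_integrable_on {0<..}"
    and "integral {0<..} f = - 2 * \<i> * of_real (Gamma (s / 2 + 1) * Gamma (1 - s / 2))"
proof -
  define a b where "a = s / 2 + 1" and "b = 1 - s / 2"
  have ab: "a > 0" "b > 0" unfolding a_def b_def using s by auto
  define p1 where "p1 = (\<lambda>x::real. x powr (2 * a - 1) * (1 + x\<^sup>2) powr (- (a + b)))"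
  note p1 = beta_half_line[OF ab, folded p1_def]
  have e: "2 * a - 1 = s + 1" "a + b = 2" by (simp_all add: a_def b_def field_simps)
  have fg: "f x = - 4 * \<i> * of_real (p1 x)" if "x \<in> {0<..}" for x
  proof -
    have 1: "complex_of_real x powr of_real s = of_real (x powr s)" using that powr_of_real[of x s] by simp
    have 2: "x powr (s + 1) = x powr s * x" using that by (simp add: powr_add)
    show ?thesis unfolding f_def inverse_squares_sum(2) p1_def e 1 2 by simp
  qed
  have ci: "(\<lambda>x. - 4 * \<i> * of_real (p1 x)) absolutely_integrable_on {0<..}"
    by (intro set_integrable_mult_right has_integral_of_real_complex(1) p1)
  show "f absolutely_integrable_on {0<..}"
    by (rule iffD2[OF set_integrable_cong[OF refl refl fg] ci])
  have "integral {0<..} f = integral {0<..} (\<lambda>x. - 4 * \<i> * of_real (p1 x))"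
    by (rule integral_cong[OF fg])
  also have "\<dots> = - 4 * \<i> * integral {0<..} (\<lambda>x. complex_of_real (p1 x))"
    by (rule integral_mult_right)
  also have "\<dots> = - 4 * \<i> * of_real (Beta a b / 2)"
    unfolding has_integral_of_real_complex(2)[OF p1(1)] p1(2) ..
  also have "Beta a b = Gamma a * Gamma b"
  proof -
    have "Gamma (2::real) = 1" using Gamma_fact[of 1, where 'a = real] by simp
    then show ?thesis unfolding Beta_def e by simp
  qed
  finally show "integral {0<..} f = - 2 * \<i> * of_real (Gamma (s / 2 + 1) * Gamma (1 - s / 2))"
    by (simp add: a_def b_def)
qed

section \<open>The theta series of a primitive character\<close>

context dirichlet_char begin

sublocale coef: mult_coeffs "\<lambda>n. chi (int n)"
  by unfold_locales (use chi_mult norm_chi_le in auto)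

sublocale cnj_coef: mult_coeffs "\<lambda>n. cnj (chi (int n))"
  by unfold_locales (use chi_mult norm_chi_le in auto)

lemma chi_minus_1: "chi (-1) = 1 \<or> chi (-1) = -1"
proof -
  have "chi (-1) * chi (-1) = 1" using chi_mult[of "-1" "-1"] by simp
  then show ?thesis by (metis square_eq_1_iff)
qed

lemma chi_minus: "chi (- a) = chi (-1) * chi a"
  using chi_mult[of "-1" a] by simp

text \<open>The weight n makes the Mellin transform equal to Gamma (s + 1) L(s), which is then
  holomorphic for Re s > -1 and so overlaps the region Re s < 0 where the reflected series converges
  absolutely. It also makes the poles double, so that the partial fractions converge absolutely. One
  series serves both parities; they separate only in \<open>kernel\<close>.\<close>

definition theta :: "real \<Rightarrow> complex" where
  "theta x = (\<Sum>n. of_nat (Suc n) * chi (int (Suc n)) * exp (- complex_of_real (real (Suc n) * x)))"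

lemma summable_theta:
  assumes "x > 0"
  shows "(\<lambda>n. real (Suc n) * exp (- (real (Suc n) * x))) sums (exp (-x) / (1 - exp (-x))\<^sup>2)"
    and "summable (\<lambda>n. norm (of_nat (Suc n) * chi (int (Suc n)) * exp (- complex_of_real (real (Suc n) * x))))"
    and "norm (theta x) \<le> exp (-x) / (1 - exp (-x))\<^sup>2"
proof -
  have "(\<lambda>n. of_nat (Suc n) * exp (-x) ^ n) sums (1 / (1 - exp (-x))\<^sup>2)"
    by (rule geometric_deriv_sums) (use assms in simp)
  from sums_mult[OF this, of "exp (-x)"]
  have "(\<lambda>n. real (Suc n) * exp (-x) ^ Suc n) sums (exp (-x) / (1 - exp (-x))\<^sup>2)"
    by (simp add: mult_ac)
  moreover have "exp (-x) ^ Suc n = exp (- (real (Suc n) * x))" for n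
    using exp_of_nat_mult[of "Suc n" "-x"] by simp
  ultimately show *: "(\<lambda>n. real (Suc n) * exp (- (real (Suc n) * x))) sums (exp (-x) / (1 - exp (-x))\<^sup>2)"
    by simp
  have le: "norm (of_nat (Suc n) * chi (int (Suc n)) * exp (- complex_of_real (real (Suc n) * x)))
      \<le> real (Suc n) * exp (- (real (Suc n) * x))" for n
  proof -
    have "norm (of_nat (Suc n) * chi (int (Suc n)) * exp (- complex_of_real (real (Suc n) * x))) =
        real (Suc n) * norm (chi (int (Suc n))) * exp (- (real (Suc n) * x))"
      by (simp only: norm_mult norm_of_nat norm_exp_eq_Re) simp
    also have "\<dots> \<le> real (Suc n) * 1 * exp (- (real (Suc n) * x))"
      using norm_chi_le by (intro mult_right_mono mult_left_mono) auto
    finally show ?thesis by simp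
  qed
  show sm: "summable (\<lambda>n. norm (of_nat (Suc n) * chi (int (Suc n)) * exp (- complex_of_real (real (Suc n) * x))))"
    by (rule summable_comparison_test'[OF sums_summable[OF *], of 0]) (use le in \<open>simp only: real_norm_def abs_norm_cancel\<close>)
  have "norm (theta x) \<le> (\<Sum>n. norm (of_nat (Suc n) * chi (int (Suc n)) * exp (- complex_of_real (real (Suc n) * x))))"
    unfolding theta_def by (rule summable_norm[OF sm])
  also have "\<dots> \<le> (\<Sum>n. real (Suc n) * exp (- (real (Suc n) * x)))"
    by (intro suminf_le le sm sums_summable[OF *])
  also have "\<dots> = exp (-x) / (1 - exp (-x))\<^sup>2" using * by (simp only: sums_iff)
  finally show "norm (theta x) \<le> exp (-x) / (1 - exp (-x))\<^sup>2" .
qed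

lemma mellin_theta:
  assumes s: "Re s > 1"
  shows "integral {0<..} (\<lambda>x. of_real x powr s * theta x) = Gamma (s + 1) * dseries (\<lambda>n. chi (int n)) s"
proof -
  define v where "v = (\<lambda>x::real. exp (- complex_of_real x))"
  have v_eq: "of_real t powr s * v t = complex_of_real t powr (s + 1 - 1) / of_real (exp t)" for t :: real
    by (simp add: v_def exp_minus exp_of_real divide_inverse)
  have vi: "(\<lambda>x. of_real x powr s * v x) absolutely_integrable_on {0<..}"
    unfolding v_eq by (rule absolutely_integrable_Gamma_integral') (use s in simp)
  have vG: "integral {0<..} (\<lambda>x. of_real x powr s * v x) = Gamma (s + 1)"
    unfolding v_eq by (rule integral_unique[OF Gamma_integral_complex']) (use s in simp)
  have "(\<lambda>n. (of_nat (Suc n) * chi (int (Suc n))) * of_real (real (Suc n)) powr (-s - 1) * integral {0<..} (\<lambda>x. of_real x powr s * v x))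
     sums integral {0<..} (\<lambda>x. of_real x powr s * (\<Sum>n. (of_nat (Suc n) * chi (int (Suc n))) * v (real (Suc n) * x)))"
  proof (rule mellin_sum[OF vi])
    show "summable (\<lambda>n. norm (of_nat (Suc n) * chi (int (Suc n))) * real (Suc n) powr (- Re s - 1))"
    proof (rule summable_comparison_test'[of "\<lambda>n. real (Suc n) powr (- Re s)" 0])
      show "summable (\<lambda>n. real (Suc n) powr (- Re s))"
        using summable_zeta_tail[of "Re s - 1"] s by simp
      fix n :: nat
      have e: "real (Suc n) powr (- Re s) = real (Suc n) * real (Suc n) powr (- Re s - 1)"
        by (simp add: powr_diff)
      have "norm (of_nat (Suc n) * chi (int (Suc n))) \<le> real (Suc n) * 1"
        unfolding norm_mult norm_of_nat using norm_chi_le by (intro mult_left_mono) auto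
      then have "norm (of_nat (Suc n) * chi (int (Suc n))) * real (Suc n) powr (- Re s - 1) \<le> real (Suc n) powr (- Re s)"
        unfolding e by (intro mult_right_mono) auto
      then show "norm (norm (of_nat (Suc n) * chi (int (Suc n))) * real (Suc n) powr (- Re s - 1)) \<le> real (Suc n) powr (- Re s)"
        by (simp only: real_norm_def abs_mult abs_norm_cancel) simp
    qed
    show "summable (\<lambda>n. norm (of_nat (Suc n) * chi (int (Suc n)) * v (real (Suc n) * x)))" if "x > 0" for x
      unfolding v_def by (rule summable_theta(2)[OF that])
  qed auto
  moreover have "(\<lambda>n. Gamma (s + 1) * (chi (int (Suc n)) * of_nat (Suc n) powr (-s))) sums (Gamma (s + 1) * dseries (\<lambda>n. chi (int n)) s)"
    by (intro sums_mult coef.dseries_sums s)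
  moreover have "(of_nat (Suc n) * chi (int (Suc n))) * of_real (real (Suc n)) powr (-s - 1) * integral {0<..} (\<lambda>x. of_real x powr s * v x)
     = Gamma (s + 1) * (chi (int (Suc n)) * of_nat (Suc n) powr (-s))" for n
  proof -
    have "complex_of_real (real (Suc n)) powr (-s - 1) = of_nat (Suc n) powr (-s) / of_nat (Suc n)"
      by (simp add: powr_diff)
    then show ?thesis unfolding vG by (simp del: of_nat_Suc)
  qed
  ultimately show ?thesis
    unfolding theta_def v_def by (simp only: sums_iff)
qed

end

context primitive_char begin

text \<open>The partial fractions of \<open>theta\<close> have their poles at \<plusminus> 2 \<pi> i
  n / q. The index is shifted, n = k + 1; n = 0 contributes nothing because
  \<open>chi 0 = 0\<close>.\<close>

definition c_freq :: "nat \<Rightarrow> real" where "c_freq k = 2 * pi * real (Suc k) / real q"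

lemma c_freq_pos: "c_freq k > 0"
  unfolding c_freq_def using q_gt_1 by simp

text \<open>The frequencies n and -n taken together by means of chi(-n) = chi(-1) chi(n), and
  rescaled so that the poles lie at i and -i.\<close>

definition kernel :: "real \<Rightarrow> complex" where
  "kernel x = 1 / (of_real x + \<i>)\<^sup>2 + chi (-1) / (of_real x - \<i>)\<^sup>2"

lemma norm_kernel_le: "norm (kernel x) \<le> 2"
proof -
  have n: "norm (of_real x + \<i>) \<ge> 1" "norm (of_real x - \<i>) \<ge> 1"
    using abs_Im_le_cmod[of "of_real x + \<i>"] abs_Im_le_cmod[of "of_real x - \<i>"] by simp_all
  have "norm (1 / (of_real x + \<i>)\<^sup>2) \<le> 1" "norm (chi (-1) / (of_real x - \<i>)\<^sup>2) \<le> 1"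
    using norm_chi_le[of "-1"] one_le_power[OF n(1), of 2] one_le_power[OF n(2), of 2]
    by (auto simp: norm_divide norm_power divide_le_eq intro: order_trans)
  then show ?thesis unfolding kernel_def by (intro norm_triangle_le) simp
qed

text \<open>Inserting \<open>chi_fourier\<close> into the series leaves sums of n w^n = w / (1 -
  w)^2, with w a root of unity times exp (-x). This rational form gives continuity and is the one to
  be expanded in partial fractions.\<close>

definition theta_closed :: "real \<Rightarrow> complex" where
  "theta_closed x = gauss / of_nat q * (\<Sum>b<q. cnj (chi (int b)) *
      (exp (- complex_of_real x) * root_char (- int b) / (1 - exp (- complex_of_real x) * root_char (- int b))\<^sup>2))"

lemma norm_root_char [simp]: "norm (root_char n) = 1"
  by (simp add: root_char_def)

lemma theta_eq_closed:
  assumes x: "x > 0"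
  shows "theta x = theta_closed x"
proof -
  define w where "w = (\<lambda>b::nat. exp (- complex_of_real x) * root_char (- int b))"
  have nw: "norm (w b) < 1" for b unfolding w_def norm_mult using x by simp
  have S: "(\<lambda>n. of_nat (Suc n) * w b ^ Suc n) sums (w b / (1 - w b)\<^sup>2)" for b
    using sums_mult[OF geometric_deriv_sums[OF nw], of "w b" b] by (simp add: mult_ac)
  have "(\<lambda>n. gauss / of_nat q * (\<Sum>b<q. cnj (chi (int b)) * (of_nat (Suc n) * w b ^ Suc n)))
     sums (gauss / of_nat q * (\<Sum>b<q. cnj (chi (int b)) * (w b / (1 - w b)\<^sup>2)))"
    by (intro sums_mult sums_sum S)
  moreover have "gauss / of_nat q * (\<Sum>b<q. cnj (chi (int b)) * (of_nat (Suc n) * w b ^ Suc n)) =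
     of_nat (Suc n) * chi (int (Suc n)) * exp (- complex_of_real (real (Suc n) * x))" for n
  proof -
    have rc: "root_char (- int b) ^ m = root_char (- (int b * int m))" for b m
      by (induction m) (simp_all add: algebra_simps flip: root_char_add)
    have ex: "exp (- complex_of_real x) ^ m = exp (- complex_of_real (real m * x))" for m
      using exp_of_nat_mult[of m "- complex_of_real x"] by simp
    have "cnj (chi (int b)) * (of_nat (Suc n) * w b ^ Suc n) =
       of_nat (Suc n) * exp (- complex_of_real (real (Suc n) * x)) *
        (cnj (chi (int b)) * root_char (- (int b * int (Suc n))))" for b
      unfolding w_def power_mult_distrib rc ex by (simp only: mult_ac)
    then have "gauss / of_nat q * (\<Sum>b<q. cnj (chi (int b)) * (of_nat (Suc n) * w b ^ Suc n)) =
       gauss / of_nat q * (of_nat (Suc n) * exp (- complex_of_real (real (Suc n) * x)) *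
        (\<Sum>b<q. cnj (chi (int b)) * root_char (- (int b * int (Suc n)))))"
      by (simp only: sum_distrib_left)
    also have "\<dots> = of_nat (Suc n) * exp (- complex_of_real (real (Suc n) * x)) * chi (int (Suc n))"
      unfolding chi_fourier[of "int (Suc n)"] by (simp only: mult_ac)
    finally show ?thesis by (simp only: mult_ac)
  qed
  ultimately show ?thesis unfolding theta_def theta_closed_def w_def by (simp only: sums_iff)
qed

lemma continuous_theta_closed: "continuous_on {0<..} theta_closed"
proof -
  have "1 - exp (- complex_of_real x) * root_char n \<noteq> 0" if "x > 0" for x n
  proof
    assume "1 - exp (- complex_of_real x) * root_char n = 0"
    then have "norm (exp (- complex_of_real x) * root_char n) = 1" by simp
    then show False using that by (simp add: norm_mult)
  qed
  then show ?thesis unfolding theta_closed_def by (intro continuous_intros) auto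
qed

text \<open>With y b = x + i c b, the b-th term of \<open>theta_closed\<close> is exp (-y) / (1 -
  exp (-y))^2. In its partial fractions, the first half runs through the frequencies jq + b and the
  second through (j + 1) q - b, so summing over residues b assembles all frequencies in blocks of
  length q.\<close>

lemma theta_kernel_sums:
  assumes x: "x > 0"
  shows "(\<lambda>k. gauss / of_nat q * cnj (chi (int (Suc k))) *
      (1 / (of_real x + \<i> * of_real (c_freq k))\<^sup>2 + chi (-1) / (of_real x - \<i> * of_real (c_freq k))\<^sup>2)) sums theta x"
proof -
  define c where "c = (\<lambda>k::nat. 2 * pi * real k / real q)"
  define w where "w = (\<lambda>b::nat. exp (- complex_of_real x) * root_char (- int b))"
  define g1 where "g1 = (\<lambda>k. cnj (chi (int k)) / (of_real x + \<i> * of_real (c k))\<^sup>2)"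
  define g2 where "g2 = (\<lambda>k. cnj (chi (int k)) * chi (-1) / (of_real x - \<i> * of_real (c k))\<^sup>2)"
  have q0: "real q \<noteq> 0" using q_gt_1 by simp
  define y where "y = (\<lambda>b::nat. complex_of_real x + \<i> * of_real (c b))"
  have ey: "exp (- y b) = w b" for b
    unfolding y_def w_def root_char_def minus_add_distrib exp_add c_def by (simp add: cis_conv_exp)
  have "\<forall>b. \<exists>A B. (\<lambda>j. 1 / (y b + 2 * of_real pi * \<i> * of_nat j)\<^sup>2) sums A \<and>
     (\<lambda>j. 1 / (y b - 2 * of_real pi * \<i> * of_nat (Suc j))\<^sup>2) sums B \<and>
     A + B = exp (- y b) / (1 - exp (- y b))\<^sup>2"
    by (intro allI exp_partial_fractions) (use x in \<open>simp add: y_def\<close>)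
  then obtain A B where AB: "\<And>b. (\<lambda>j. 1 / (y b + 2 * of_real pi * \<i> * of_nat j)\<^sup>2) sums A b"
     "\<And>b. (\<lambda>j. 1 / (y b - 2 * of_real pi * \<i> * of_nat (Suc j))\<^sup>2) sums B b"
     "\<And>b. A b + B b = exp (- y b) / (1 - exp (- y b))\<^sup>2"
    by metis
  have c_add: "c (j * q + b) = c b + 2 * pi * real j" for j b
    unfolding c_def using q0 by (simp add: field_simps)
  have chi_add: "chi (int (j * q + b)) = chi (int b)" for j b
    by (rule chi_cong) simp
  have "(\<lambda>j. \<Sum>b<q. cnj (chi (int b)) * (1 / (y b + 2 * of_real pi * \<i> * of_nat j)\<^sup>2)) sums (\<Sum>b<q. cnj (chi (int b)) * A b)"
    by (intro sums_sum sums_mult AB)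
  moreover have "(\<Sum>b<q. cnj (chi (int b)) * (1 / (y b + 2 * of_real pi * \<i> * of_nat j)\<^sup>2)) = sum g1 {j * q..<j * q + q}" for j
  proof -
    have "sum g1 {j * q..<j * q + q} = (\<Sum>b<q. g1 (j * q + b))"
      using sum.shift_bounds_nat_ivl[of g1 0 "j * q" q] by (simp add: atLeast0LessThan add.commute)
    also have "\<dots> = (\<Sum>b<q. cnj (chi (int b)) * (1 / (y b + 2 * of_real pi * \<i> * of_nat j)\<^sup>2))"
      unfolding g1_def chi_add c_add y_def by (simp add: algebra_simps)
    finally show ?thesis by simp
  qed
  ultimately have G1: "(\<lambda>j. sum g1 {j * q..<j * q + q}) sums (\<Sum>b<q. cnj (chi (int b)) * A b)" by simp
  have "(\<lambda>j. \<Sum>b<q. cnj (chi (int b)) * (1 / (y b - 2 * of_real pi * \<i> * of_nat (Suc j))\<^sup>2)) sums (\<Sum>b<q. cnj (chi (int b)) * B b)"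
    by (intro sums_sum sums_mult AB)
  moreover have "(\<Sum>b<q. cnj (chi (int b)) * (1 / (y b - 2 * of_real pi * \<i> * of_nat (Suc j))\<^sup>2))
      = sum (\<lambda>k. g2 (Suc k)) {j * q..<j * q + q}" for j
  proof -
    have "sum (\<lambda>k. g2 (Suc k)) {j * q..<j * q + q} = (\<Sum>i<q. g2 (Suc (j * q + i)))"
      using sum.shift_bounds_nat_ivl[of "\<lambda>k. g2 (Suc k)" 0 "j * q" q] by (simp add: atLeast0LessThan add.commute)
    \<comment> \<open>Reversing the order inside a block turns the index into (j + 1) q - b, which
      is congruent to -b; the factor \<open>chi (-1)\<close> in \<open>g2\<close> then restores
      \<open>chi b\<close>.\<close>
    also have "\<dots> = (\<Sum>b<q. g2 (Suc (j * q + (q - Suc b))))"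
      by (rule sum.nat_diff_reindex[symmetric])
    also have "\<dots> = (\<Sum>b<q. cnj (chi (int b)) * (1 / (y b - 2 * of_real pi * \<i> * of_nat (Suc j))\<^sup>2))"
    proof (intro sum.cong refl)
      fix b assume "b \<in> {..<q}"
      then have b: "Suc (j * q + (q - Suc b)) = Suc j * q - b" "b \<le> Suc j * q" by auto
      have "int (Suc j * q - b) = int (Suc j) * int q + - int b" using b(2) by (simp only: of_nat_diff of_nat_mult)
      then have "chi (int (Suc j * q - b)) = chi (- int b)" by (intro chi_cong) (simp only: mod_mult_self3)
      then have "chi (int (Suc j * q - b)) = chi (-1) * chi (int b)" using chi_minus[of "int b"] by simp
      moreover have "cnj (chi (-1)) * chi (-1) = 1" using chi_minus_1 by auto
      ultimately have num: "cnj (chi (int (Suc j * q - b))) * chi (-1) = cnj (chi (int b))"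
        by (simp add: mult_ac)
      have "real (Suc j * q - b) = real (Suc j) * real q - real b" using b(2) by (simp only: of_nat_diff of_nat_mult)
      then have "c (Suc j * q - b) = 2 * pi * real (Suc j) - c b"
        unfolding c_def using q0 by (simp only:) (simp add: field_simps)
      then have "of_real x - \<i> * of_real (c (Suc j * q - b)) = y b - 2 * of_real pi * \<i> * of_nat (Suc j)"
        unfolding y_def by (simp only: of_real_diff of_real_mult of_real_of_nat_eq) (simp add: algebra_simps)
      then show "g2 (Suc (j * q + (q - Suc b))) = cnj (chi (int b)) * (1 / (y b - 2 * of_real pi * \<i> * of_nat (Suc j))\<^sup>2)"
        unfolding g2_def b(1) num by simp
    qed
    finally show ?thesis by simp
  qed
  ultimately have G2: "(\<lambda>j. sum (\<lambda>k. g2 (Suc k)) {j * q..<j * q + q}) sums (\<Sum>b<q. cnj (chi (int b)) * B b)" by simp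
  \<comment> \<open>A majorant of order k^(-2). It makes both series summable, so that the block
    sums can be ungrouped.\<close>
  have inv: "1 / norm (of_real x + \<i> * of_real (c (Suc k)))^2 \<le> (real q)\<^sup>2 * real (Suc k) powr (-1 - 1)"
     "1 / norm (of_real x - \<i> * of_real (c (Suc k)))^2 \<le> (real q)\<^sup>2 * real (Suc k) powr (-1 - 1)" for k
  proof -
    have cp: "c (Suc k) > 0" unfolding c_def using q_gt_1 by simp
    have le: "1 / r\<^sup>2 \<le> (real q)\<^sup>2 * real (Suc k) powr (-1 - 1)" if "r \<ge> c (Suc k)" for r
    proof -
      have "real (Suc k) / real q * 1 \<le> real (Suc k) / real q * (2 * pi)"
        using pi_gt3 by (intro mult_left_mono) auto
      then have "real (Suc k) / real q \<le> c (Suc k)" unfolding c_def by (simp add: mult_ac)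
      then have "(real (Suc k) / real q)\<^sup>2 \<le> r\<^sup>2" using that by (intro power_mono) auto
      then have "1 / r\<^sup>2 \<le> 1 / (real (Suc k) / real q)\<^sup>2" using q_gt_1 by (intro divide_left_mono mult_pos_pos) (auto intro: less_le_trans[OF _ \<open>(real (Suc k) / real q)\<^sup>2 \<le> r\<^sup>2\<close>])
      also have "\<dots> = (real q)\<^sup>2 * real (Suc k) powr (-1 - 1)"
        by (simp add: power_divide powr_minus_divide)
      finally show ?thesis .
    qed
    show "1 / norm (of_real x + \<i> * of_real (c (Suc k)))^2 \<le> (real q)\<^sup>2 * real (Suc k) powr (-1 - 1)"
      using abs_Im_le_cmod[of "of_real x + \<i> * of_real (c (Suc k))"] cp by (intro le) simp
    show "1 / norm (of_real x - \<i> * of_real (c (Suc k)))^2 \<le> (real q)\<^sup>2 * real (Suc k) powr (-1 - 1)"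
      using abs_Im_le_cmod[of "of_real x - \<i> * of_real (c (Suc k))"] cp by (intro le) simp
  qed
  have sm: "summable (\<lambda>k. (real q)\<^sup>2 * real (Suc k) powr (-1 - 1))"
    by (intro summable_mult summable_zeta_tail) simp
  have s1: "summable (\<lambda>k. g1 (Suc k))"
  proof (rule summable_comparison_test'[OF sm, of 0])
    fix k
    have "norm (g1 (Suc k)) \<le> 1 / norm (of_real x + \<i> * of_real (c (Suc k)))^2"
      unfolding g1_def norm_divide norm_power using norm_chi_le by (intro divide_right_mono) auto
    then show "norm (g1 (Suc k)) \<le> (real q)\<^sup>2 * real (Suc k) powr (-1 - 1)" using inv(1) by (rule order_trans)
  qed
  have s2: "summable (\<lambda>k. g2 (Suc k))"
  proof (rule summable_comparison_test'[OF sm, of 0])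
    fix k
    have "norm (cnj (chi (int (Suc k))) * chi (-1)) \<le> 1"
      unfolding norm_mult using norm_chi_le by (intro mult_le_one) auto
    then have "norm (g2 (Suc k)) \<le> 1 / norm (of_real x - \<i> * of_real (c (Suc k)))^2"
      unfolding g2_def norm_divide norm_power by (intro divide_right_mono) auto
    then show "norm (g2 (Suc k)) \<le> (real q)\<^sup>2 * real (Suc k) powr (-1 - 1)" using inv(2) by (rule order_trans)
  qed
  have "summable g1" using s1 by (subst (asm) summable_Suc_iff)
  then have "suminf g1 = (\<Sum>b<q. cnj (chi (int b)) * A b)"
    using sums_unique2[OF sums_group[OF summable_sums, of g1 q] G1] q_gt_1 by simp
  moreover have "g1 0 = 0" unfolding g1_def by simp
  ultimately have 1: "(\<lambda>k. g1 (Suc k)) sums (\<Sum>b<q. cnj (chi (int b)) * A b)"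
    using summable_sums[OF \<open>summable g1\<close>] sums_Suc_iff[of g1] by simp
  have 2: "(\<lambda>k. g2 (Suc k)) sums (\<Sum>b<q. cnj (chi (int b)) * B b)"
    using sums_unique2[OF sums_group[OF summable_sums[OF s2], of q] G2] q_gt_1 summable_sums[OF s2] by simp
  have "(\<lambda>k. gauss / of_nat q * (g1 (Suc k) + g2 (Suc k))) sums
     (gauss / of_nat q * ((\<Sum>b<q. cnj (chi (int b)) * A b) + (\<Sum>b<q. cnj (chi (int b)) * B b)))"
    by (intro sums_mult sums_add 1 2)
  moreover have "gauss / of_nat q * ((\<Sum>b<q. cnj (chi (int b)) * A b) + (\<Sum>b<q. cnj (chi (int b)) * B b)) = theta x"
    unfolding theta_eq_closed[OF x] theta_closed_def
    by (simp only: sum.distrib[symmetric] distrib_left[symmetric] AB(3) ey w_def)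
  moreover have "gauss / of_nat q * (g1 (Suc k) + g2 (Suc k)) = gauss / of_nat q * cnj (chi (int (Suc k))) *
      (1 / (of_real x + \<i> * of_real (c_freq k))\<^sup>2 + chi (-1) / (of_real x - \<i> * of_real (c_freq k))\<^sup>2)" for k
    unfolding g1_def g2_def c_def c_freq_def by (simp only: distrib_left times_divide_eq_right mult_1_right mult.assoc)
  ultimately show ?thesis by (simp only:)
qed

end

section \<open>The functional equation\<close>

text \<open>Allows the Mellin integrals to be evaluated for real s only.\<close>

lemma identity_on_real_interval:
  assumes "f holomorphic_on S" "g holomorphic_on S" "open S" "connected S"
    and ab: "a < b" "\<And>x. a < x \<Longrightarrow> x < b \<Longrightarrow> of_real x \<in> S"
    and eq: "\<And>x. a < x \<Longrightarrow> x < b \<Longrightarrow> f (of_real x) = g (of_real x)"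
    and w: "w \<in> S"
  shows "f w = g w"
proof -
  define m where "m = (a + b) / 2"
  have m: "a < m" "m < b" unfolding m_def using ab by (auto simp: field_simps)
  have lim: "complex_of_real m islimpt of_real ` {a<..<b}"
    unfolding islimpt_approachable
  proof (intro allI impI)
    fix e :: real assume e: "e > 0"
    define x where "x = m + min (e / 2) ((b - m) / 2)"
    have "m < x" "x < b" "x - m < e" unfolding x_def using e m by (auto simp: min_def field_simps)
    then show "\<exists>x'\<in>complex_of_real ` {a<..<b}. x' \<noteq> of_real m \<and> dist x' (of_real m) < e"
      using m by (intro bexI[of _ "of_real x"]) (auto simp: dist_of_real dist_real_def)
  qed
  have "f w - g w = 0"
  proof (rule analytic_continuation[of "\<lambda>z. f z - g z" S "of_real ` {a<..<b}" "of_real m"])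
    show "(\<lambda>z. f z - g z) holomorphic_on S" using assms by (intro holomorphic_on_diff)
  qed (use assms m lim in auto)
  then show ?thesis by simp
qed

lemma nonpos_Ints_Re_le: "z \<in> \<int>\<^sub>\<le>\<^sub>0 \<Longrightarrow> Re (z :: complex) \<le> 0"
  by (elim nonpos_Ints_cases) simp

lemma one_minus_holomorphic: "(\<lambda>s. 1 - s) holomorphic_on (A :: complex set)"
  by (intro holomorphic_intros)

context dirichlet_char begin

lemma dseries_cnj: "cnj (dseries (\<lambda>n. chi (int n)) (cnj s)) = dseries (\<lambda>n. cnj (chi (int n))) s"
  if "Re s > 1"
proof -
  have *: "(\<lambda>n. cnj (chi (int (Suc n)) * of_nat (Suc n) powr (- cnj s))) sums cnj (dseries (\<lambda>n. chi (int n)) (cnj s))"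
    unfolding sums_cnj using that by (intro coef.dseries_sums) simp
  have e: "cnj (chi (int (Suc n)) * of_nat (Suc n) powr (- cnj s)) = cnj (chi (int (Suc n))) * of_nat (Suc n) powr (-s)" for n
    by (simp add: cnj_powr del: of_nat_Suc)
  show ?thesis using * unfolding e by (simp only: sums_iff dseries_def)
qed

end

context primitive_char begin

lemma sum_chi_bound: "norm (\<Sum>n<N. chi (int (Suc n))) \<le> real q"
proof -
  have "norm (\<Sum>n<N. chi (int (Suc n))) \<le> real q * 1"
  proof (rule periodic_sum_bound)
    show "chi (int (Suc (n + q))) = chi (int (Suc n))" for n
      using chi_add_q[of "int (Suc n)"] by (simp add: add_ac)
    have "(\<Sum>n<Suc q. chi (int n)) = chi (int 0) + (\<Sum>n<q. chi (int (Suc n)))" by (rule sum.lessThan_Suc_shift)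
    moreover have "chi (int q) = 0" using chi_cong[of "int q" 0] by simp
    ultimately show "(\<Sum>n<q. chi (int (Suc n))) = 0" using sum_chi_period by simp
  qed (use q_gt_1 norm_chi_le in auto)
  then show ?thesis by simp
qed

lemma sum_cnj_chi_bound: "norm (\<Sum>n<N. cnj (chi (int (Suc n)))) \<le> real q"
  using sum_chi_bound[of N] by (metis cnj_sum complex_mod_cnj)

lemmas abel_chi = abel_series[of "\<lambda>n. chi (int (Suc n))", OF sum_chi_bound]
lemmas abel_cnj_chi = abel_series[of "\<lambda>n. cnj (chi (int (Suc n)))", OF sum_cnj_chi_bound]

lemma dseries_chi_holomorphic: "dseries (\<lambda>n. chi (int n)) holomorphic_on {s. Re s > 0}"
  by (rule holomorphic_transform[OF abel_chi(3)]) (use abel_chi(1) in \<open>auto simp: dseries_def sums_iff\<close>)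

lemma dseries_cnj_chi_holomorphic: "dseries (\<lambda>n. cnj (chi (int n))) holomorphic_on {s. Re s > 0}"
  by (rule holomorphic_transform[OF abel_cnj_chi(3)]) (use abel_cnj_chi(1) in \<open>auto simp: dseries_def sums_iff\<close>)

lemma norm_dseries_chi_le: "Re s > 0 \<Longrightarrow> norm (dseries (\<lambda>n. chi (int n)) s) \<le> real q * norm s * zeta_tail (Re s)"
  using abel_chi(1,2)[of s] by (auto simp: dseries_def sums_iff)

lemma kernel_scale:
  assumes "c > 0"
  shows "1 / (of_real x + \<i> * of_real c)\<^sup>2 + chi (-1) / (of_real x - \<i> * of_real c)\<^sup>2 =
     kernel (1 / c * x) / (of_real c)\<^sup>2"
proof -
  have "of_real x + \<i> * of_real c = of_real c * (of_real (1 / c * x) + \<i>)"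
    "of_real x - \<i> * of_real c = of_real c * (of_real (1 / c * x) - \<i>)"
    using assms by (simp_all add: field_simps)
  then show ?thesis unfolding kernel_def
    by (simp only: power_mult_distrib add_divide_distrib divide_divide_eq_left mult.commute)
qed

definition acoef :: "nat \<Rightarrow> complex" where
  "acoef k = gauss / of_nat q * cnj (chi (int (Suc k))) / (of_real (c_freq k))\<^sup>2"

lemma theta_sums: "x > 0 \<Longrightarrow> (\<lambda>k. acoef k * kernel (1 / c_freq k * x)) sums theta x"
  using theta_kernel_sums[of x] unfolding kernel_scale[OF c_freq_pos] acoef_def by simp

lemma c_freq_powr: "c_freq k powr t = (2 * pi / real q) powr t * real (Suc k) powr t"
  unfolding c_freq_def using q_gt_1 by (simp add: powr_divide powr_mult)

lemma norm_acoef_le: "norm (acoef k) \<le> norm gauss / real q * c_freq k powr (-2)"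
proof -
  have "norm (acoef k) = norm gauss / real q * norm (chi (int (Suc k))) * c_freq k powr (-2)"
    unfolding acoef_def using c_freq_pos[of k] by (simp add: norm_mult norm_divide norm_power powr_minus_divide)
  also have "\<dots> \<le> norm gauss / real q * 1 * c_freq k powr (-2)"
    using norm_chi_le by (intro mult_right_mono mult_left_mono) auto
  finally show ?thesis by simp
qed

lemma summable_acoef:
  assumes "t < 1"
  shows "summable (\<lambda>k. norm (acoef k) * c_freq k powr t)"
proof (rule summable_comparison_test'[of "\<lambda>k. norm gauss / real q * (2 * pi / real q) powr (t - 2) * real (Suc k) powr (- (1 - t) - 1)" 0])
  show "summable (\<lambda>k. norm gauss / real q * (2 * pi / real q) powr (t - 2) * real (Suc k) powr (- (1 - t) - 1))"
    by (intro summable_mult summable_zeta_tail) (use assms in simp)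
  fix k
  have "norm (acoef k) * c_freq k powr t \<le> norm gauss / real q * c_freq k powr (-2) * c_freq k powr t"
    using norm_acoef_le by (intro mult_right_mono) auto
  also have "\<dots> = norm gauss / real q * c_freq k powr (t - 2)"
    unfolding mult.assoc powr_add[symmetric] by simp
  also have "\<dots> = norm gauss / real q * (2 * pi / real q) powr (t - 2) * real (Suc k) powr (- (1 - t) - 1)"
    unfolding c_freq_powr mult.assoc by (simp add: algebra_simps)
  finally show "norm (norm (acoef k) * c_freq k powr t) \<le> norm gauss / real q * (2 * pi / real q) powr (t - 2) * real (Suc k) powr (- (1 - t) - 1)"
    by simp
qed

lemma summable_acoef_kernel: "summable (\<lambda>k. norm (acoef k * kernel (1 / c_freq k * x)))"
proof (rule summable_comparison_test'[of "\<lambda>k. norm (acoef k) * 2" 0])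
  have "summable (\<lambda>k. norm (acoef k) * c_freq k powr 0)" by (rule summable_acoef) simp
  then have "summable (\<lambda>k. norm (acoef k))" using c_freq_pos by (simp add: less_imp_neq[symmetric])
  then show "summable (\<lambda>k. norm (acoef k) * 2)" by (rule summable_mult2)
  show "norm (norm (acoef k * kernel (1 / c_freq k * x))) \<le> norm (acoef k) * 2" for k
    using norm_kernel_le by (simp add: norm_mult mult_left_mono)
qed

text \<open>Two representations share the work: the partial fractions are bounded uniformly in x,
  hence near 0, and the defining series decays exponentially for x \<ge> 1.\<close>

lemma theta_bound: "\<exists>C. \<forall>x>0. norm (theta x) \<le> C * exp (- x)"
proof -
  have sm: "summable (\<lambda>k. norm (acoef k))"
    using summable_acoef[of 0] c_freq_pos by (simp add: less_imp_neq[symmetric])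
  define C1 where "C1 = (\<Sum>k. norm (acoef k) * 2)"
  define C2 where "C2 = 1 / (1 - exp (-1::real))\<^sup>2"
  have C1: "norm (theta x) \<le> C1" if "x > 0" for x
  proof -
    have "norm (theta x) = norm (\<Sum>k. acoef k * kernel (1 / c_freq k * x))"
      using theta_sums[OF that] by (simp add: sums_iff)
    also have "\<dots> \<le> (\<Sum>k. norm (acoef k * kernel (1 / c_freq k * x)))"
      by (rule summable_norm[OF summable_acoef_kernel])
    also have "\<dots> \<le> C1" unfolding C1_def
      by (intro suminf_le summable_acoef_kernel summable_mult2 sm)
         (use norm_kernel_le in \<open>simp add: norm_mult mult_left_mono\<close>)
    finally show ?thesis .
  qed
  have C10: "C1 \<ge> 0" using order_trans[OF norm_ge_zero C1[of 1]] by simp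
  have C20: "C2 \<ge> 0" unfolding C2_def by simp
  have "norm (theta x) \<le> (C1 * exp 1 + C2) * exp (-x)" if x: "x > 0" for x
  proof (cases "x \<le> 1")
    case True
    then have "C1 * 1 \<le> C1 * (exp 1 * exp (-x))" using C10 by (intro mult_left_mono) (simp_all flip: exp_add)
    then show ?thesis using C1[OF x] mult_nonneg_nonneg[OF C20, of "exp (-x)"] by (simp add: algebra_simps)
  next
    case False
    have "(1 - exp (-1::real))\<^sup>2 \<le> (1 - exp (-x))\<^sup>2" using False by (intro power_mono) auto
    then have "exp (-x) / (1 - exp (-x))\<^sup>2 \<le> exp (-x) / (1 - exp (-1))\<^sup>2"
      by (intro divide_left_mono mult_pos_pos) (use x in auto)
    then have "norm (theta x) \<le> C2 * exp (-x)" using summable_theta(3)[OF x] unfolding C2_def by simp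
    then show ?thesis using mult_nonneg_nonneg[OF C10, of "exp 1 * exp (-x)"] by (simp add: algebra_simps)
  qed
  then show ?thesis by blast
qed

lemma continuous_theta: "continuous_on {0<..} theta"
  using continuous_theta_closed theta_eq_closed continuous_on_cong[of "{0<..}" "{0<..}" theta theta_closed] by simp

definition theta_mellin :: "complex \<Rightarrow> complex" where
  "theta_mellin s = integral {0<..} (\<lambda>x. of_real x powr s * theta x)"

lemma theta_mellin_holomorphic: "theta_mellin holomorphic_on {s. Re s > -1}"
proof -
  obtain C where "\<And>x. x > 0 \<Longrightarrow> norm (theta x) \<le> C * exp (- x)" using theta_bound by blast
  from mellin_holomorphic[OF continuous_theta this] show ?thesis unfolding theta_mellin_def .
qed

definition parity :: real where "parity = (if chi (-1) = 1 then 0 else 1)"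

text \<open>The Gauss sum together with the constant from the Mellin transform of
  \<open>kernel\<close>. Its modulus is sqrt(\<pi>/q) and not 1, because \<open>fe_factor\<close>
  uses the exponent s - 1 where a normalised form would have s - 1/2.\<close>

definition root_number :: complex where
  "root_number = gauss / of_nat q * (if chi (-1) = 1 then of_real (sqrt pi) else - \<i> * of_real (sqrt pi))"

text \<open>The denominator is written with \<open>rGamma\<close>, which is entire, so the only
  restriction comes from the numerator and the factor is holomorphic on all of Re s < 1.\<close>

definition fe_factor :: "complex \<Rightarrow> complex" where
  "fe_factor s = root_number * of_real (pi / real q) powr (s - 1) *
     Gamma ((1 - s + of_real parity) / 2) * rGamma ((s + of_real parity) / 2)"

text \<open>Legendre duplication, at s/2 in the even case and at (s + 1)/2 in the odd case, absorbs
  the power of 2 in (2 \<pi> / q)^(s-1). It leaves the factor Gamma (s + 1), which the direct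
  evaluation \<open>mellin_theta\<close> carries as well.\<close>

lemma kernel_mellin:
  assumes s: "-1 < s" "s < 0"
  shows "(\<lambda>x. complex_of_real x powr of_real s * kernel x) absolutely_integrable_on {0<..}" (is ?A)
    and "gauss / of_nat q * of_real ((2 * pi / real q) powr (s - 1)) * integral {0<..} (\<lambda>x. complex_of_real x powr of_real s * kernel x)
      = Gamma (of_real s + 1) * fe_factor (of_real s)" (is ?B)
proof -
  define z where "z = complex_of_real s"
  have nonint: "complex_of_real x \<notin> \<int>\<^sub>\<le>\<^sub>0" if "x \<notin> \<int>" for x
  proof
    assume "complex_of_real x \<in> \<int>\<^sub>\<le>\<^sub>0"
    then obtain n where "complex_of_real x = of_int n" by (elim nonpos_Ints_cases)
    then have "x = of_int n" by (metis of_real_eq_iff of_real_of_int_eq)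
    then show False using that by simp
  qed
  have pos: "complex_of_real x \<notin> \<int>\<^sub>\<le>\<^sub>0" if "x > 0" for x
    using that nonpos_Ints_Re_le[of "complex_of_real x"] by auto
  have dup: "Gamma u * Gamma (u + 1/2) = of_real (2 powr (1 - 2 * Re u)) * of_real (sqrt pi) * Gamma (2 * u)"
    if "u \<notin> \<int>\<^sub>\<le>\<^sub>0" "u + 1/2 \<notin> \<int>\<^sub>\<le>\<^sub>0" "Im u = 0" for u :: complex
  proof -
    have "(1 - 2 * u) * of_real (ln 2) = of_real ((1 - 2 * Re u) * ln 2)"
      using that(3) by (simp add: complex_eq_iff)
    then have "exp ((1 - 2 * u) * of_real (ln 2)) = of_real (2 powr (1 - 2 * Re u))"
      by (simp only: exp_of_real) (simp add: powr_def)
    then show ?thesis using Gamma_legendre_duplication[OF that(1,2)] by simp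
  qed
  have pq: "(2 * pi / real q) powr (s - 1) = 2 powr (s - 1) * (pi / real q) powr (s - 1)"
    using powr_mult[of 2 "pi / real q" "s - 1"] q_gt_1 by simp
  have pc: "of_real (pi / real q) powr (z - 1) = complex_of_real ((pi / real q) powr (s - 1))"
  proof -
    have "z - 1 = of_real (s - 1)" unfolding z_def by simp
    then show ?thesis using powr_of_real[of "pi / real q" "s - 1"] q_gt_1 by (simp only:) simp
  qed
  have s2: "s / 2 \<notin> \<int>"
  proof
    assume "s / 2 \<in> \<int>"
    then obtain n where "s / 2 = of_int n" by (auto elim: Ints_cases)
    then have "-1 < real_of_int n" "real_of_int n < 0" using s by auto
    then have "n \<le> -1" by simp
    then have "real_of_int n \<le> -1" by linarith
    then show False using \<open>-1 < real_of_int n\<close> by simp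
  qed
  have "?A \<and> ?B"
  proof (cases "chi (-1) = 1")
    case True
    have k: "kernel = (\<lambda>x. 1 / (of_real x + \<i>)\<^sup>2 + 1 / (of_real x - \<i>)\<^sup>2)" unfolding kernel_def True ..
    note m = kernel_mellin_even[of s, folded k]
    have s': "s < 1" using s by simp
    have V: "integral {0<..} (\<lambda>x. complex_of_real x powr of_real s * kernel x) = z * Gamma ((z + 1) / 2) * Gamma ((1 - z) / 2)"
      unfolding k kernel_mellin_even(2)[OF s(1) s'] z_def by (simp add: Gamma_complex_of_real[symmetric])
    have n1: "z / 2 \<notin> \<int>\<^sub>\<le>\<^sub>0" using nonint[OF s2] by (simp add: z_def)
    have n2: "z / 2 + 1 / 2 \<notin> \<int>\<^sub>\<le>\<^sub>0" using pos[of "s / 2 + 1 / 2"] s by (simp add: z_def)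
    have n3: "z \<notin> \<int>\<^sub>\<le>\<^sub>0"
      unfolding z_def by (rule nonint) (use s in \<open>auto elim!: Ints_cases\<close>)
    have G0: "Gamma (z / 2) \<noteq> 0" using n1 by (simp add: Gamma_eq_zero_iff)
    have "Gamma (z / 2) * Gamma (z / 2 + 1 / 2) = of_real (2 powr (1 - 2 * Re (z / 2))) * of_real (sqrt pi) * Gamma (2 * (z / 2))"
      by (rule dup[OF n1 n2]) (simp add: z_def)
    then have d: "Gamma (z / 2) * Gamma ((z + 1) / 2) = of_real (2 powr (1 - s)) * of_real (sqrt pi) * Gamma z"
      by (simp add: z_def add_divide_distrib)
    have p2: "complex_of_real (2 powr (s - 1)) * of_real (2 powr (1 - s)) = 1"
      unfolding of_real_mult[symmetric] powr_add[symmetric] by simp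
    have "z * of_real (2 powr (s - 1)) * Gamma ((z + 1) / 2) * Gamma (z / 2) =
        z * of_real (2 powr (s - 1)) * (Gamma (z / 2) * Gamma ((z + 1) / 2))" by (simp only: mult_ac)
    also have "\<dots> = (of_real (2 powr (s - 1)) * of_real (2 powr (1 - s))) * (z * Gamma z * of_real (sqrt pi))"
      unfolding d by (simp only: mult_ac)
    finally have "z * of_real (2 powr (s - 1)) * Gamma ((z + 1) / 2) * Gamma (z / 2) = z * Gamma z * of_real (sqrt pi)"
      unfolding p2 by simp
    then have key: "z * of_real (2 powr (s - 1)) * Gamma ((z + 1) / 2) = Gamma (z + 1) * of_real (sqrt pi) * rGamma (z / 2)"
      using G0 Gamma_plus1[OF n3] by (simp add: rGamma_inverse_Gamma field_simps)
    have "gauss / of_nat q * of_real ((2 * pi / real q) powr (s - 1)) * integral {0<..} (\<lambda>x. complex_of_real x powr of_real s * kernel x)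
       = gauss / of_nat q * of_real ((pi / real q) powr (s - 1)) * (z * of_real (2 powr (s - 1)) * Gamma ((z + 1) / 2)) * Gamma ((1 - z) / 2)"
      unfolding V pq of_real_mult by (simp only: mult_ac)
    also have "\<dots> = Gamma (z + 1) * fe_factor z"
      unfolding key fe_factor_def pc parity_def root_number_def using True by (simp add: mult_ac)
    finally have ?B unfolding z_def .
    moreover have ?A unfolding k by (rule kernel_mellin_even(1)[OF s(1) s'])
    ultimately show ?thesis by blast
  next
    case False
    then have c: "chi (-1) = -1" using chi_minus_1 by blast
    have k: "kernel = (\<lambda>x. 1 / (of_real x + \<i>)\<^sup>2 - 1 / (of_real x - \<i>)\<^sup>2)" unfolding kernel_def c by (simp add: fun_eq_iff)
    have s': "s < 1" using s by simp
    have V: "integral {0<..} (\<lambda>x. complex_of_real x powr of_real s * kernel x) = - 2 * \<i> * (Gamma (z / 2 + 1) * Gamma (1 - z / 2))"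
      unfolding k kernel_mellin_odd(2)[OF s(1) s'] z_def by (simp add: Gamma_complex_of_real[symmetric])
    have n1: "(z + 1) / 2 \<notin> \<int>\<^sub>\<le>\<^sub>0" using pos[of "(s + 1) / 2"] s by (simp add: z_def)
    have n2: "(z + 1) / 2 + 1 / 2 \<notin> \<int>\<^sub>\<le>\<^sub>0" 
    proof -
      have "(s + 1) / 2 + 1 / 2 > 0" using s by (simp add: field_simps)
      then show ?thesis using pos[of "(s + 1) / 2 + 1 / 2"] by (simp add: z_def)
    qed
    have G0: "Gamma ((z + 1) / 2) \<noteq> 0" using n1 by (simp add: Gamma_eq_zero_iff)
    have "Gamma ((z + 1) / 2) * Gamma ((z + 1) / 2 + 1 / 2) =
       of_real (2 powr (1 - 2 * Re ((z + 1) / 2))) * of_real (sqrt pi) * Gamma (2 * ((z + 1) / 2))"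
      by (rule dup[OF n1 n2]) (simp add: z_def)
    moreover have "(z + 1) / 2 + 1 / 2 = z / 2 + 1" "2 * ((z + 1) / 2) = z + 1" "1 - 2 * Re ((z + 1) / 2) = - s"
      by (simp_all add: z_def field_simps)
    ultimately have d: "Gamma ((z + 1) / 2) * Gamma (z / 2 + 1) = of_real (2 powr (- s)) * of_real (sqrt pi) * Gamma (z + 1)"
      by (simp only:)
    have p2: "2 * complex_of_real (2 powr (s - 1)) * of_real (2 powr (- s)) = 1"
    proof -
      have "2 * (2 powr (s - 1)) * 2 powr (- s) = (1::real)" by (simp add: powr_diff powr_minus)
      then show ?thesis by (metis of_real_1 of_real_mult of_real_numeral)
    qed
    have "2 * of_real (2 powr (s - 1)) * Gamma (z / 2 + 1) * Gamma ((z + 1) / 2) =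
        2 * of_real (2 powr (s - 1)) * (Gamma ((z + 1) / 2) * Gamma (z / 2 + 1))" by (simp only: mult_ac)
    also have "\<dots> = (2 * of_real (2 powr (s - 1)) * of_real (2 powr (- s))) * (Gamma (z + 1) * of_real (sqrt pi))"
      unfolding d by (simp only: mult_ac)
    finally have "2 * of_real (2 powr (s - 1)) * Gamma (z / 2 + 1) * Gamma ((z + 1) / 2) = Gamma (z + 1) * of_real (sqrt pi)"
      unfolding p2 by simp
    then have key: "2 * of_real (2 powr (s - 1)) * Gamma (z / 2 + 1) = Gamma (z + 1) * of_real (sqrt pi) * rGamma ((z + 1) / 2)"
      using G0 by (simp add: rGamma_inverse_Gamma field_simps)
    have arg: "1 - z / 2 = (1 - z + 1) / 2" by (simp add: field_simps)
    have "gauss / of_nat q * of_real ((2 * pi / real q) powr (s - 1)) * integral {0<..} (\<lambda>x. complex_of_real x powr of_real s * kernel x)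
       = gauss / of_nat q * of_real ((pi / real q) powr (s - 1)) * (- \<i>) * (2 * of_real (2 powr (s - 1)) * Gamma (z / 2 + 1)) * Gamma ((1 - z + 1) / 2)"
      unfolding V pq of_real_mult arg by simp
    also have "\<dots> = Gamma (z + 1) * fe_factor z"
      unfolding key fe_factor_def pc parity_def root_number_def using False by (simp add: mult_ac)
    finally have ?B unfolding z_def .
    moreover have ?A unfolding k by (rule kernel_mellin_odd(1)[OF s(1) s'])
    ultimately show ?thesis by blast
  qed
  then show ?A ?B by blast+
qed

text \<open>The term with pole scale c contributes c^(s+1) / c^2 = c^(s-1), that is n^(-(1-s)) up to
  a common factor. For s < 0 the resulting series converges absolutely.\<close>

lemma theta_mellin_negative:
  assumes s: "-1 < s" "s < 0"
  shows "theta_mellin (of_real s) = Gamma (of_real s + 1) * fe_factor (of_real s) *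
     dseries (\<lambda>n. cnj (chi (int n))) (1 - of_real s)"
proof -
  define V where "V = integral {0<..} (\<lambda>x. complex_of_real x powr of_real s * kernel x)"
  have l: "1 / c_freq k > 0" for k using c_freq_pos by simp
  have lp: "(1 / c_freq k) powr t = c_freq k powr (- t)" for k t
    using c_freq_pos[of k] by (simp add: powr_divide powr_minus_divide)
  have "(\<lambda>k. acoef k * of_real (1 / c_freq k) powr (- of_real s - 1) * V) sums
     integral {0<..} (\<lambda>x. of_real x powr of_real s * (\<Sum>k. acoef k * kernel (1 / c_freq k * x)))"
    unfolding V_def
  proof (rule mellin_sum[OF kernel_mellin(1)[OF s] l])
    show "summable (\<lambda>k. norm (acoef k) * (1 / c_freq k) powr (- Re (of_real s) - 1))"
      unfolding lp using summable_acoef[of "1 + s"] s by (simp add: algebra_simps)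
    show "summable (\<lambda>k. norm (acoef k * kernel (1 / c_freq k * x)))" for x by (rule summable_acoef_kernel)
  qed
  moreover have "integral {0<..} (\<lambda>x. of_real x powr of_real s * (\<Sum>k. acoef k * kernel (1 / c_freq k * x))) = theta_mellin (of_real s)"
    unfolding theta_mellin_def by (rule integral_cong) (use theta_sums in \<open>simp add: sums_iff\<close>)
  moreover have "acoef k * of_real (1 / c_freq k) powr (- of_real s - 1) * V =
     gauss / of_nat q * of_real ((2 * pi / real q) powr (s - 1)) * V * (cnj (chi (int (Suc k))) * of_nat (Suc k) powr (- (1 - of_real s)))" for k
  proof -
    have "- complex_of_real s - 1 = of_real (- s - 1)" by simp
    moreover have "(1 / c_freq k) powr (- s - 1) = c_freq k powr (s + 1)"
      unfolding lp by (rule arg_cong[of _ _ "\<lambda>t. c_freq k powr t"]) simp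
    ultimately have 1: "complex_of_real (1 / c_freq k) powr (- of_real s - 1) = of_real (c_freq k powr (s + 1))"
      using powr_of_real[of "1 / c_freq k" "- s - 1"] l[of k] by (simp only:)
    have "c_freq k powr (s + 1) / (c_freq k)\<^sup>2 = c_freq k powr (s - 1)"
      using c_freq_pos[of k] powr_diff[of "c_freq k" "s + 1" 2] by simp
    then have 2: "complex_of_real (c_freq k powr (s + 1)) / (of_real (c_freq k))\<^sup>2 = of_real ((2 * pi / real q) powr (s - 1)) * of_real (real (Suc k) powr (s - 1))"
      unfolding c_freq_powr by (metis of_real_divide of_real_mult of_real_power)
    have "- (1 - complex_of_real s) = of_real (s - 1)" by simp
    then have 3: "of_nat (Suc k) powr (- (1 - complex_of_real s)) = complex_of_real (real (Suc k) powr (s - 1))"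
      using powr_of_real[of "real (Suc k)" "s - 1"] by (simp only:) simp
    have "acoef k * of_real (1 / c_freq k) powr (- of_real s - 1) * V =
       gauss / of_nat q * cnj (chi (int (Suc k))) * (complex_of_real (c_freq k powr (s + 1)) / (of_real (c_freq k))\<^sup>2) * V"
      unfolding acoef_def 1 by simp
    then show ?thesis unfolding 2 3 by (simp only: mult_ac)
  qed
  moreover have "(\<lambda>k. gauss / of_nat q * of_real ((2 * pi / real q) powr (s - 1)) * V * (cnj (chi (int (Suc k))) * of_nat (Suc k) powr (- (1 - of_real s))))
     sums (gauss / of_nat q * of_real ((2 * pi / real q) powr (s - 1)) * V * dseries (\<lambda>n. cnj (chi (int n))) (1 - of_real s))"
    by (intro sums_mult cnj_coef.dseries_sums) (use s in simp)
  ultimately have "theta_mellin (of_real s) = gauss / of_nat q * of_real ((2 * pi / real q) powr (s - 1)) * V * dseries (\<lambda>n. cnj (chi (int n))) (1 - of_real s)"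
    by (simp only: sums_iff)
  then show ?thesis unfolding V_def kernel_mellin(2)[OF s] .
qed

lemma parity_cases: "parity = 0 \<or> parity = 1"
  by (simp add: parity_def)

section \<open>Continuation of L and the functional equation\<close>

lemma fe_factor_holomorphic: "fe_factor holomorphic_on {s. Re s < 1}"
proof -
  have "(1 - s + of_real parity) / 2 \<notin> \<int>\<^sub>\<le>\<^sub>0" if "Re s < 1" for s
  proof
    assume "(1 - s + of_real parity) / 2 \<in> \<int>\<^sub>\<le>\<^sub>0"
    then have "Re ((1 - s + of_real parity) / 2) \<le> 0" by (rule nonpos_Ints_Re_le)
    then show False using that parity_cases by auto
  qed
  then show ?thesis unfolding fe_factor_def using q_gt_1
    by (intro holomorphic_intros) (auto simp: complex_nonpos_Reals_iff)
qed

text \<open>Two formulas for L on overlapping half-planes, Re s > -1 from the Mellin transform and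
  Re s < 1 from the reflected series; \<open>cont\<close> glues them.\<close>

definition cont1 :: "complex \<Rightarrow> complex" where "cont1 s = rGamma (s + 1) * theta_mellin s"
definition cont2 :: "complex \<Rightarrow> complex" where "cont2 s = fe_factor s * dseries (\<lambda>n. cnj (chi (int n))) (1 - s)"

lemma cont1_holomorphic: "cont1 holomorphic_on {s. Re s > -1}"
  unfolding cont1_def by (intro holomorphic_intros theta_mellin_holomorphic)

lemma cont2_holomorphic: "cont2 holomorphic_on {s. Re s < 1}"
proof -
  have "(\<lambda>s. dseries (\<lambda>n. cnj (chi (int n))) (1 - s)) holomorphic_on {s. Re s < 1}"
    using holomorphic_on_compose_gen[OF one_minus_holomorphic dseries_cnj_chi_holomorphic, of "{s. Re s < 1}"]
    unfolding o_def by fastforce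
  then show ?thesis unfolding cont2_def by (intro holomorphic_on_mult fe_factor_holomorphic)
qed

lemma strip_open_connected:
  "open {s::complex. a < Re s \<and> Re s < b}" "connected {s::complex. a < Re s \<and> Re s < b}"
proof -
  have e: "{s::complex. a < Re s \<and> Re s < b} = {s. Re s > a} \<inter> {s. Re s < b}" by auto
  show "open {s::complex. a < Re s \<and> Re s < b}"
    unfolding e by (intro open_Int open_halfspace_Re_gt open_halfspace_Re_lt)
  show "connected {s::complex. a < Re s \<and> Re s < b}"
    unfolding e by (intro convex_connected convex_Int convex_halfspace_Re_gt convex_halfspace_Re_lt)
qed

lemma cont1_eq_cont2:
  assumes "-1 < Re s" "Re s < 1"
  shows "cont1 s = cont2 s"
proof (rule identity_on_real_interval[of cont1 "{s. -1 < Re s \<and> Re s < 1}" cont2 "-1" 0 s])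
  show "cont1 holomorphic_on {s. -1 < Re s \<and> Re s < 1}"
    by (rule holomorphic_on_subset[OF cont1_holomorphic]) auto
  show "cont2 holomorphic_on {s. -1 < Re s \<and> Re s < 1}"
    by (rule holomorphic_on_subset[OF cont2_holomorphic]) auto
  fix x :: real assume x: "-1 < x" "x < 0"
  have "complex_of_real x + 1 \<notin> \<int>\<^sub>\<le>\<^sub>0"
  proof
    assume "complex_of_real x + 1 \<in> \<int>\<^sub>\<le>\<^sub>0"
    then have "Re (complex_of_real x + 1) \<le> 0" by (rule nonpos_Ints_Re_le)
    then show False using x by simp
  qed
  then have "rGamma (complex_of_real x + 1) * Gamma (of_real x + 1) = 1"
    by (simp add: rGamma_inverse_Gamma Gamma_eq_zero_iff)
  then show "cont1 (of_real x) = cont2 (of_real x)"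
    unfolding cont1_def cont2_def theta_mellin_negative[OF x] by (simp add: mult.assoc[symmetric])
qed (use assms strip_open_connected[of "-1" 1] in auto)

definition cont :: "complex \<Rightarrow> complex" where
  "cont s = (if Re s > -1 then cont1 s else cont2 s)"

lemma cont_eq2: "Re s < 1 \<Longrightarrow> cont s = cont2 s"
  using cont1_eq_cont2 unfolding cont_def by auto

lemma cont_holomorphic: "cont holomorphic_on UNIV"
proof -
  have "cont holomorphic_on {s. Re s > -1} \<union> {s. Re s < 1}"
  proof (rule holomorphic_on_Un)
    show "cont holomorphic_on {s. Re s > -1}"
      by (rule holomorphic_transform[OF cont1_holomorphic]) (simp add: cont_def)
    show "cont holomorphic_on {s. Re s < 1}"
      by (rule holomorphic_transform[OF cont2_holomorphic]) (simp add: cont_eq2)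
  qed (auto intro: open_halfspace_Re_gt open_halfspace_Re_lt)
  moreover have "{s::complex. Re s > -1} \<union> {s. Re s < 1} = UNIV" by auto
  ultimately show ?thesis by simp
qed

lemma cont_eq_dseries1:
  assumes "Re s > 1"
  shows "cont s = dseries (\<lambda>n. chi (int n)) s"
proof -
  have "s + 1 \<notin> \<int>\<^sub>\<le>\<^sub>0"
  proof
    assume "s + 1 \<in> \<int>\<^sub>\<le>\<^sub>0"
    then have "Re (s + 1) \<le> 0" by (rule nonpos_Ints_Re_le)
    then show False using assms by simp
  qed
  then have "rGamma (s + 1) * Gamma (s + 1) = 1"
    by (simp add: rGamma_inverse_Gamma Gamma_eq_zero_iff)
  then show ?thesis
    unfolding cont_def cont1_def theta_mellin_def mellin_theta[OF assms] using assms by (simp add: mult.assoc[symmetric])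
qed

lemma L_eq_cont: "dirichlet_L chi = cont"
proof -
  have "entire_continuation_of_L_series chi cont"
    unfolding entire_continuation_of_L_series_def
  proof (intro conjI allI impI cont_holomorphic)
    fix s :: complex assume s: "Re s > 1"
    have "(\<lambda>n. chi (int (Suc n)) * of_nat (Suc n) powr (-s)) sums cont s"
      unfolding cont_eq_dseries1[OF s] by (rule coef.dseries_sums[OF s])
    then show "(\<lambda>n. chi (int (Suc n)) / of_nat (Suc n) powr s) sums cont s"
      by (simp only: powr_minus divide_inverse)
  qed
  then show ?thesis unfolding dirichlet_L_def
    using entire_continuation_of_L_series_unique by (intro the_equality) blast+
qed

lemma L_holomorphic: "dirichlet_L chi holomorphic_on A"
  using cont_holomorphic unfolding L_eq_cont by (rule holomorphic_on_subset) simp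

lemma L_eq_dseries:
  assumes "Re s > 0"
  shows "dirichlet_L chi s = dseries (\<lambda>n. chi (int n)) s"
proof (rule identity_on_real_interval[of "dirichlet_L chi" "{s. Re s > 0}" "dseries (\<lambda>n. chi (int n))" 1 2 s])
  show "dirichlet_L chi (of_real x) = dseries (\<lambda>n. chi (int n)) (of_real x)" if "1 < x" for x
    unfolding L_eq_cont by (rule cont_eq_dseries1) (use that in simp)
qed (use assms L_holomorphic dseries_chi_holomorphic in
    \<open>auto intro: open_halfspace_Re_gt convex_connected convex_halfspace_Re_gt\<close>)

text \<open>Reflection by 1 - cnj s, which fixes the critical line pointwise, keeps the equation
  within a single character.\<close>

lemma L_functional_equation:
  assumes "Re s < 1"
  shows "dirichlet_L chi s = fe_factor s * cnj (dirichlet_L chi (1 - cnj s))"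
proof (rule identity_on_real_interval[of "dirichlet_L chi" "{s. Re s < 1}"
      "\<lambda>s. fe_factor s * cnj (dirichlet_L chi (1 - cnj s))" "-1" 0 s])
  have "(cnj \<circ> (\<lambda>s. dirichlet_L chi (1 - s)) \<circ> cnj) holomorphic_on UNIV"
  proof (subst holomorphic_on_compose_cnj_cnj)
    show "(\<lambda>s. dirichlet_L chi (1 - s)) holomorphic_on (cnj ` UNIV)"
      using holomorphic_on_compose_gen[OF one_minus_holomorphic L_holomorphic[of UNIV], of "cnj ` UNIV"]
      by (auto simp: o_def)
  qed auto
  then have "(\<lambda>s. cnj (dirichlet_L chi (1 - cnj s))) holomorphic_on {s. Re s < 1}"
    unfolding o_def by (rule holomorphic_on_subset) simp
  then show "(\<lambda>s. fe_factor s * cnj (dirichlet_L chi (1 - cnj s))) holomorphic_on {s. Re s < 1}"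
    by (intro holomorphic_on_mult fe_factor_holomorphic)
  fix x :: real assume x: "-1 < x" "x < 0"
  have "dseries (\<lambda>n. cnj (chi (int n))) (1 - of_real x) = cnj (dirichlet_L chi (1 - cnj (of_real x)))"
    using dseries_cnj[of "1 - of_real x"] L_eq_dseries[of "1 - of_real x"] x by simp
  then show "dirichlet_L chi (of_real x) = fe_factor (of_real x) * cnj (dirichlet_L chi (1 - cnj (of_real x)))"
    unfolding L_eq_cont using cont_eq2[of "of_real x"] x by (simp add: cont2_def L_eq_cont)
qed (use assms L_holomorphic in \<open>auto intro: open_halfspace_Re_lt convex_connected convex_halfspace_Re_lt\<close>)

lemma L_nonzero_gt_1:
  assumes "Re s > 1"
  shows "dirichlet_L chi s \<noteq> 0"
  using coef.dseries_lower_bound[OF assms] L_eq_dseries[of s] assms by auto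

lemma L_nonzero_line_1:
  assumes "t \<noteq> 0"
  shows "dirichlet_L chi (Complex 1 t) \<noteq> 0"
proof (rule coef.nonzero_on_line_1[of q])
  show "norm (chi (int n)) = 1 \<or> chi (int n) = 0" for n
    using norm_chi_coprime chi_nonzero_iff by blast
  show "chi (int (n + q)) = chi (int n)" for n using chi_add_q by simp
qed (use q_gt_1 assms L_holomorphic L_eq_dseries in auto)

end

section \<open>Gamma quotients and growth in vertical strips\<close>

text \<open>In both comparisons the quotients of the partial products of Euler's formula for Gamma are
  compared factor by factor.\<close>

lemma norm_Gamma_ratio:
  assumes "0 \<le> \<delta>" "\<delta> < Re w"
  shows "norm (Gamma (w - of_real \<delta>)) * Gamma (Re w) \<le> Gamma (Re w - \<delta>) * norm (Gamma w)"
proof (rule LIMSEQ_le)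
  define u where "u = Re w"
  have u: "u > \<delta>" "u > 0" using assms u_def by auto
  show "(\<lambda>n. norm (Gamma_series (w - of_real \<delta>) n) * Gamma_series (Re w) n) \<longlonglongrightarrow> norm (Gamma (w - of_real \<delta>)) * Gamma (Re w)"
    by (intro tendsto_mult tendsto_norm Gamma_series_LIMSEQ)
  show "(\<lambda>n. Gamma_series (Re w - \<delta>) n * norm (Gamma_series w n)) \<longlonglongrightarrow> Gamma (Re w - \<delta>) * norm (Gamma w)"
    by (intro tendsto_mult tendsto_norm Gamma_series_LIMSEQ)
  have "norm (Gamma_series (w - of_real \<delta>) n) * Gamma_series u n \<le> Gamma_series (u - \<delta>) n * norm (Gamma_series w n)" for n
  proof -
    define l where "l = ln (real n)"
    define P where "P = (\<lambda>z::complex. norm (pochhammer z (Suc n)))"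
    define p where "p = (\<lambda>x::real. pochhammer x (Suc n))"
    have pp: "p u > 0" "p (u - \<delta>) > 0" unfolding p_def using u by (auto intro!: pochhammer_pos)
    have PP: "P w > 0" "P (w - of_real \<delta>) > 0"
    proof -
      have "w + of_nat k \<noteq> 0" "w - of_real \<delta> + of_nat k \<noteq> 0" for k
      proof -
        have "Re (w + of_nat k) > 0" "Re (w - of_real \<delta> + of_nat k) > 0" using u by (auto simp: u_def)
        then show "w + of_nat k \<noteq> 0" "w - of_real \<delta> + of_nat k \<noteq> 0" by (metis less_irrefl zero_complex.sel(1))+
      qed
      then show "P w > 0" "P (w - of_real \<delta>) > 0" unfolding P_def pochhammer_prod by auto
    qed
    have key: "P w * p (u - \<delta>) \<le> P (w - of_real \<delta>) * p u"
      unfolding P_def p_def pochhammer_prod prod_norm[symmetric] prod.distrib[symmetric]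
    proof (rule prod_mono, intro conjI)
      fix k
      define x where "x = w - of_real \<delta> + of_nat k"
      \<comment> \<open>Factor by factor, with r the real part of x: |x + \<delta>| r \<le> (|x| +
        \<delta>) r \<le> |x| (r + \<delta>), since r \<le> |x|.\<close>
      have "norm (x + of_real \<delta>) \<le> norm x + \<delta>" using norm_triangle_ineq[of x "of_real \<delta>"] assms by simp
      moreover have "u - \<delta> + real k \<le> norm x" using complex_Re_le_cmod[of x] by (simp add: x_def u_def)
      ultimately have "norm (x + of_real \<delta>) * (u - \<delta> + real k) \<le> (norm x + \<delta>) * (u - \<delta> + real k)"
        "\<delta> * (u - \<delta> + real k) \<le> \<delta> * norm x"
        using u assms by (auto intro!: mult_right_mono mult_left_mono)
      then have "norm (x + of_real \<delta>) * (u - \<delta> + real k) \<le> norm x * (u + real k)"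
        by (simp add: algebra_simps)
      then show "norm (w + of_nat k) * (u - \<delta> + of_nat k) \<le> norm (w - of_real \<delta> + of_nat k) * (u + of_nat k)"
        by (simp add: x_def)
      show "0 \<le> norm (w + of_nat k) * (u - \<delta> + of_nat k)" using u by (intro mult_nonneg_nonneg) auto
    qed
    have e: "norm (Gamma_series (w - of_real \<delta>) n) = fact n * exp ((u - \<delta>) * l) / P (w - of_real \<delta>)"
      "norm (Gamma_series w n) = fact n * exp (u * l) / P w"
      unfolding Gamma_series_def P_def l_def u_def by (simp_all add: norm_mult norm_divide algebra_simps)
    have e2: "Gamma_series u n = fact n * exp (u * l) / p u" "Gamma_series (u - \<delta>) n = fact n * exp ((u - \<delta>) * l) / p (u - \<delta>)"
      unfolding Gamma_series_def p_def l_def by simp_all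
    define E where "E = (fact n :: real) * exp ((u - \<delta>) * l) * (fact n * exp (u * l))"
    have E: "E \<ge> 0" unfolding E_def by simp
    have "norm (Gamma_series (w - of_real \<delta>) n) * Gamma_series u n = E / (P (w - of_real \<delta>) * p u)"
      unfolding e e2 E_def by simp
    also have "\<dots> \<le> E / (P w * p (u - \<delta>))"
      using key pp PP E by (intro divide_left_mono mult_pos_pos) auto
    also have "\<dots> = Gamma_series (u - \<delta>) n * norm (Gamma_series w n)"
      unfolding e e2 E_def by (simp add: mult_ac)
    finally show ?thesis .
  qed
  then show "\<exists>N. \<forall>n\<ge>N. norm (Gamma_series (w - of_real \<delta>) n) * Gamma_series (Re w) n \<le> Gamma_series (Re w - \<delta>) n * norm (Gamma_series w n)"
    unfolding u_def by blast
qed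

lemma Gamma_ratio_antimono:
  fixes u v \<delta> :: real
  assumes "0 \<le> \<delta>" "\<delta> < u" "u \<le> v"
  shows "Gamma (v - \<delta>) * Gamma u \<le> Gamma (u - \<delta>) * Gamma v"
proof (rule LIMSEQ_le)
  show "(\<lambda>n. Gamma_series (v - \<delta>) n * Gamma_series u n) \<longlonglongrightarrow> Gamma (v - \<delta>) * Gamma u"
    by (intro tendsto_mult Gamma_series_LIMSEQ)
  show "(\<lambda>n. Gamma_series (u - \<delta>) n * Gamma_series v n) \<longlonglongrightarrow> Gamma (u - \<delta>) * Gamma v"
    by (intro tendsto_mult Gamma_series_LIMSEQ)
  have "Gamma_series (v - \<delta>) n * Gamma_series u n \<le> Gamma_series (u - \<delta>) n * Gamma_series v n" for n
  proof -
    define l where "l = ln (real n)"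
    define p where "p = (\<lambda>x::real. pochhammer x (Suc n))"
    have pp: "p u > 0" "p (u - \<delta>) > 0" "p v > 0" "p (v - \<delta>) > 0" unfolding p_def using assms by (auto intro!: pochhammer_pos)
    have key: "p v * p (u - \<delta>) \<le> p (v - \<delta>) * p u"
      unfolding p_def pochhammer_prod prod.distrib[symmetric]
    proof (rule prod_mono, intro conjI)
      fix k
      have "0 \<le> \<delta> * (v - u)" using assms by simp
      then show "(v + of_nat k) * (u - \<delta> + of_nat k) \<le> (v - \<delta> + of_nat k) * (u + of_nat k)"
        by (simp add: algebra_simps)
      show "0 \<le> (v + of_nat k) * (u - \<delta> + of_nat k)" using assms by (intro mult_nonneg_nonneg) auto
    qed
    define E where "E = (fact n :: real) * exp ((v - \<delta>) * l) * (fact n * exp (u * l))"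
    have E: "E \<ge> 0" "E = fact n * exp ((u - \<delta>) * l) * (fact n * exp (v * l))"
      unfolding E_def by (simp_all add: algebra_simps flip: exp_add)
    have "Gamma_series (v - \<delta>) n * Gamma_series u n = E / (p (v - \<delta>) * p u)"
      unfolding E_def Gamma_series_def p_def l_def by simp
    also have "\<dots> \<le> E / (p v * p (u - \<delta>))"
      using key pp E by (intro divide_left_mono mult_pos_pos) auto
    also have "\<dots> = Gamma_series (u - \<delta>) n * Gamma_series v n"
      unfolding E(2) Gamma_series_def p_def l_def by (simp add: mult_ac)
    finally show ?thesis .
  qed
  then show "\<exists>N. \<forall>n\<ge>N. Gamma_series (v - \<delta>) n * Gamma_series u n \<le> Gamma_series (u - \<delta>) n * Gamma_series v n"
    by blast
qed

text \<open>Chains the two comparisons, so that the constant depends only on a lower bound u for the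
  real part.\<close>

lemma norm_Gamma_ratio_half_plane:
  assumes "0 \<le> \<delta>" "\<delta> < u" "u \<le> Re w"
  shows "norm (Gamma (w - of_real \<delta>)) \<le> Gamma (u - \<delta>) / Gamma u * norm (Gamma w)"
proof -
  have G: "Gamma u > 0" "Gamma (Re w) > 0" "Gamma (u - \<delta>) > 0" using assms by auto
  have "norm (Gamma (w - of_real \<delta>)) * Gamma (Re w) \<le> Gamma (Re w - \<delta>) * norm (Gamma w)"
    by (rule norm_Gamma_ratio) (use assms in auto)
  then have "norm (Gamma (w - of_real \<delta>)) \<le> Gamma (Re w - \<delta>) / Gamma (Re w) * norm (Gamma w)"
    using G by (simp add: field_simps)
  also have "\<dots> \<le> Gamma (u - \<delta>) / Gamma u * norm (Gamma w)"
    using Gamma_ratio_antimono[OF assms] G by (intro mult_right_mono) (auto simp: field_simps)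
  finally show ?thesis .
qed

text \<open>In the series for Digamma + \<gamma> all terms have nonnegative real part, so finitely
  many of them give a lower bound. Each differs from 1/(n + 1) by at most 1/(2 Im z) \<le>
  1/100.\<close>

lemma Re_Digamma_ge:
  assumes "Re z \<ge> 1" "Im z \<ge> 50"
  shows "Re (Digamma z) \<ge> 2"
proof -
  define t where "t = (\<lambda>n. Re (inverse (of_nat (Suc n)) - inverse (z + of_nat n)))"
  have z0: "z \<noteq> 0" using assms by auto
  have "(\<lambda>n. inverse (of_nat (Suc n)) - inverse (z + of_nat n)) sums (Digamma z + euler_mascheroni)"
    using summable_Digamma[OF z0] by (simp add: Digamma_def summable_sums)
  from sums_Re[OF this] have "t sums (Re (Digamma z) + Re euler_mascheroni)"
    unfolding t_def plus_complex.sel .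
  moreover have "Re (euler_mascheroni :: complex) = euler_mascheroni"
    by (metis Re_complex_of_real of_real_euler_mascheroni)
  ultimately have S: "t sums (Re (Digamma z) + euler_mascheroni)" by (simp only:)
  have Reinv: "Re (inverse (z + of_nat n)) = (Re z + real n) / ((Re z + real n)\<^sup>2 + (Im z)\<^sup>2)" for n
    by (simp add: inverse_complex.sel power2_eq_square)
  have tn: "t n = 1 / real (Suc n) - (Re z + real n) / ((Re z + real n)\<^sup>2 + (Im z)\<^sup>2)" for n
    unfolding t_def minus_complex.sel(1) Reinv by (simp add: inverse_eq_divide Re_divide_of_nat[of 1, simplified])
  have le1: "(Re z + real n) / ((Re z + real n)\<^sup>2 + (Im z)\<^sup>2) \<le> 1 / real (Suc n)" for n
  proof -
    define x where "x = Re z + real n"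
    have x: "x \<ge> real (Suc n)" "x > 0" unfolding x_def using assms by auto
    have "x / (x\<^sup>2 + (Im z)\<^sup>2) \<le> x / (x * x)" using x by (intro divide_left_mono) (auto simp: power2_eq_square intro!: mult_pos_pos add_pos_nonneg)
    also have "\<dots> = 1 / x" using x by simp
    also have "\<dots> \<le> 1 / real (Suc n)" using x by (intro divide_left_mono) auto
    finally show ?thesis unfolding x_def .
  qed
  have le2: "(Re z + real n) / ((Re z + real n)\<^sup>2 + (Im z)\<^sup>2) \<le> 1 / 100" for n
  proof -
    define x y where "x = Re z + real n" and "y = Im z"
    have xy: "x > 0" "y \<ge> 50" unfolding x_def y_def using assms by auto
    have "0 \<le> (x - y)\<^sup>2" by simp
    then have "2 * x * y \<le> x\<^sup>2 + y\<^sup>2" by (simp add: power2_diff)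
    moreover have "x * 100 \<le> 2 * x * y" using xy by simp
    ultimately have "x * 100 \<le> x\<^sup>2 + y\<^sup>2" by linarith
    moreover have "x\<^sup>2 + y\<^sup>2 > 0" using xy by (simp add: add_pos_nonneg)
    ultimately show ?thesis unfolding x_def y_def by (simp add: field_simps)
  qed
  \<comment> \<open>Eight terms suffice: 1 + 1/2 + ... + 1/8 - 8/100 exceeds 2.63, and \<gamma> <
    13/22.\<close>
  have "(\<Sum>n<8. t n) \<le> Re (Digamma z) + euler_mascheroni"
    using sum_le_suminf[of t "{..<8}"] S le1 tn by (auto simp: sums_iff)
  moreover have "(\<Sum>n<8. 1 / real (Suc n) - 1 / 100) \<le> (\<Sum>n<8. t n)"
    by (intro sum_mono) (use le2 tn in auto)
  moreover have "(\<Sum>n<8. 1 / real (Suc n) - 1 / 100) \<ge> 2.63"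
    by (simp add: numeral_eq_Suc lessThan_Suc)
  moreover have "(euler_mascheroni :: real) < 13 / 22" by (rule euler_mascheroni_less_13_over_22)
  ultimately show ?thesis by simp
qed

text \<open>Two steps of the recursion move z into the half-plane of the previous bound at a cost of
  1/50 each.\<close>

lemma Re_Digamma_ge':
  assumes "Re z \<ge> -1" "Im z \<ge> 50"
  shows "Re (Digamma z) \<ge> 19 / 10"
proof -
  have z0: "z \<noteq> 0" "z + 1 \<noteq> 0" using assms by (auto simp: complex_eq_iff)
  have inv: "Re (1 / w) \<le> 1 / 50" if "Im w \<ge> 50" for w :: complex
  proof -
    have "norm w \<ge> 50" using abs_Im_le_cmod[of w] that by linarith
    then have "norm (1 / w) \<le> 1 / 50" by (simp add: norm_divide divide_simps)
    then show ?thesis using complex_Re_le_cmod[of "1 / w"] by linarith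
  qed
  have "Digamma (z + 1 + 1) = Digamma z + 1 / z + 1 / (z + 1)"
    using Digamma_plus1[OF z0(1)] Digamma_plus1[OF z0(2)] by simp
  then have "Re (Digamma z) = Re (Digamma (z + 1 + 1)) - Re (1 / z) - Re (1 / (z + 1))" by simp
  moreover have "Re (Digamma (z + 1 + 1)) \<ge> 2" by (rule Re_Digamma_ge) (use assms in auto)
  moreover have "Re (1 / z) \<le> 1 / 50" "Re (1 / (z + 1)) \<le> 1 / 50" by (intro inv; use assms in simp)+
  ultimately show ?thesis by linarith
qed

lemma Gamma_compact_bounds:
  fixes B :: real
  assumes "A > 0"
  shows "\<exists>C>0. \<forall>x\<in>{A..B}. 1 / C \<le> Gamma x \<and> Gamma x \<le> C"
proof -
  have c: "continuous_on {A..B} (\<lambda>x. Gamma x :: real)"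
    using assms by (intro continuous_intros) (auto elim!: nonpos_Ints_cases)
  have pos: "Gamma x > 0" if "x \<in> {A..B}" for x using that assms by auto
  have c2: "continuous_on {A..B} (\<lambda>x. 1 / Gamma x :: real)"
    by (intro continuous_on_divide continuous_on_const c) (use pos in force)
  obtain C1 where C1: "\<And>x. x \<in> {A..B} \<Longrightarrow> norm (Gamma x) \<le> C1"
    using compact_imp_bounded[OF compact_continuous_image[OF c compact_Icc]] unfolding bounded_iff by blast
  obtain C2 where C2: "\<And>x. x \<in> {A..B} \<Longrightarrow> norm (1 / Gamma x) \<le> C2"
    using compact_imp_bounded[OF compact_continuous_image[OF c2 compact_Icc]] unfolding bounded_iff by blast
  define C where "C = max 1 (max C1 C2)"
  have "1 / C \<le> Gamma x \<and> Gamma x \<le> C" if x: "x \<in> {A..B}" for x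
  proof
    have "1 / Gamma x \<le> C" using C2[OF x] pos[OF x] unfolding C_def by simp
    then show "1 / C \<le> Gamma x" using pos[OF x] C_def by (simp add: field_simps)
    show "Gamma x \<le> C" using C1[OF x] unfolding C_def by simp
  qed
  moreover have "C > 0" unfolding C_def by simp
  ultimately show ?thesis by blast
qed

lemma norm_pochhammer_le: "norm (pochhammer (z::complex) n) \<le> (norm z + real n) ^ n"
proof -
  have "norm (pochhammer z n) \<le> (\<Prod>i = 0..<n. norm (z + of_nat i))"
    unfolding pochhammer_prod by (rule norm_prod_le)
  also have "\<dots> \<le> (\<Prod>i = 0..<n. norm z + real n)"
    by (intro prod_mono conjI norm_ge_zero norm_triangle_le) auto
  finally show ?thesis by simp
qed

text \<open>Shifting the denominator by an integer reduces to the previous comparison.\<close>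

lemma fe_Gamma_quotient_bound:
  fixes R :: real
  assumes "R > 0"
  shows "\<exists>C N. C > 0 \<and> real N \<ge> R + 1 \<and> (\<forall>s a. - R \<le> Re s \<longrightarrow> Re s < 1 / 2 \<longrightarrow> (a = 0 \<or> a = 1) \<longrightarrow>
     norm (Gamma ((1 - s + of_real a) / 2)) * norm (rGamma ((s + of_real a) / 2)) \<le> C * (norm s + 2) ^ N)"
proof -
  define N where "N = nat \<lceil>R + 1\<rceil>"
  have N: "real N \<ge> R + 1" unfolding N_def by linarith
  obtain C where C: "C > 0" "\<And>x. x \<in> {1 / 4..R + 2 + real N} \<Longrightarrow> 1 / C \<le> Gamma x \<and> Gamma x \<le> C"
    using Gamma_compact_bounds[of "1 / 4" "R + 2 + real N"] by auto
  have "norm (Gamma ((1 - s + of_real a) / 2)) * norm (rGamma ((s + of_real a) / 2)) \<le> (C * C * (real N + 1) ^ N) * (norm s + 2) ^ N"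
    if s: "- R \<le> Re s" "Re s < 1 / 2" and a: "a = 0 \<or> a = 1" for s a
  proof -
    define v where "v = (s + of_real a) / 2"
    \<comment> \<open>\<open>\<beta>\<close> is the real part by which the numerator argument
      exceeds the denominator argument v. With w = v + N and \<delta> = N - \<beta>, the point w -
      \<delta> is the conjugate of the numerator argument, and N \<ge> R + 1 makes \<delta>
      nonnegative.\<close>
    define \<beta> where "\<beta> = 1 / 2 - Re s"
    define w where "w = v + of_nat N"
    define \<delta> where "\<delta> = real N - \<beta>"
    have d: "0 \<le> \<delta>" "\<delta> < Re w" unfolding \<delta>_def \<beta>_def w_def v_def using s a N by (auto simp: field_simps)
    have wd: "w - of_real \<delta> = cnj ((1 - s + of_real a) / 2)"
      unfolding w_def \<delta>_def \<beta>_def v_def by (simp add: complex_eq_iff field_simps)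
    have r1: "Re w - \<delta> \<in> {1 / 4..R + 2 + real N}" "Re w \<in> {1 / 4..R + 2 + real N}"
      unfolding w_def \<delta>_def \<beta>_def v_def using s a N assms by (auto simp: field_simps)
    have G: "Gamma (Re w) > 0" using r1 by auto
    have "norm (Gamma (w - of_real \<delta>)) * Gamma (Re w) \<le> Gamma (Re w - \<delta>) * norm (Gamma w)"
      by (rule norm_Gamma_ratio[OF d])
    then have "norm (Gamma (w - of_real \<delta>)) \<le> Gamma (Re w - \<delta>) * (1 / Gamma (Re w)) * norm (Gamma w)"
      using G by (simp add: field_simps)
    also have "\<dots> \<le> C * C * norm (Gamma w)"
    proof -
      have "1 / Gamma (Re w) \<le> C" using C(2)[OF r1(2)] C(1) G by (simp add: field_simps)
      moreover have "Gamma (Re w - \<delta>) > 0" using r1 by auto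
      ultimately show ?thesis using C(2)[OF r1(1)] C(1) G by (intro mult_right_mono mult_mono) auto
    qed
    finally have 1: "norm (Gamma (w - of_real \<delta>)) \<le> C * C * norm (Gamma w)" .
    have "norm (Gamma (w - of_real \<delta>)) = norm (Gamma ((1 - s + of_real a) / 2))"
      unfolding wd cnj_Gamma[symmetric] by simp
    then have 2: "norm (Gamma ((1 - s + of_real a) / 2)) \<le> C * C * norm (Gamma w)" using 1 by simp
    have wn: "w \<notin> \<int>\<^sub>\<le>\<^sub>0" using nonpos_Ints_Re_le[of w] r1 by auto
    have "rGamma v = pochhammer v N * rGamma w"
      unfolding w_def by (rule pochhammer_rGamma)
    then have "norm (Gamma ((1 - s + of_real a) / 2)) * norm (rGamma v) \<le> C * C * norm (Gamma w) * (norm (pochhammer v N) * norm (rGamma w))"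
      using 2 by (simp add: norm_mult mult_right_mono)
    also have "\<dots> = C * C * norm (pochhammer v N)"
      using wn by (simp add: rGamma_inverse_Gamma norm_inverse Gamma_eq_zero_iff)
    also have "\<dots> \<le> C * C * ((real N + 1) * (norm s + 2)) ^ N"
    proof (intro mult_left_mono)
      have "norm v \<le> (norm s + 1) / 2" unfolding v_def using a norm_triangle_ineq[of s 1] by (auto simp: norm_divide)
      then have "norm v + real N \<le> (norm s + 2) + real N * (norm s + 2)"
      proof -
        have "(norm s + 1) / 2 \<le> norm s + 2" using norm_ge_zero[of s] by (simp add: field_simps)
        moreover have "real N * 1 \<le> real N * (norm s + 2)" by (intro mult_left_mono) auto
        ultimately show ?thesis using \<open>norm v \<le> (norm s + 1) / 2\<close> by linarith
      qed
      then have "norm v + real N \<le> (real N + 1) * (norm s + 2)" by (simp add: algebra_simps)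
      then have "(norm v + real N) ^ N \<le> ((real N + 1) * (norm s + 2)) ^ N" by (intro power_mono) auto
      then show "norm (pochhammer v N) \<le> ((real N + 1) * (norm s + 2)) ^ N"
        using norm_pochhammer_le[of v N] by linarith
    qed (use C in auto)
    finally show ?thesis unfolding v_def by (simp add: power_mult_distrib mult.assoc)
  qed
  then show ?thesis using N C(1) by (intro exI[of _ "C * C * (real N + 1) ^ N"] exI[of _ N]) auto
qed

section \<open>Modulus of the functional equation factor and polynomial growth of L\<close>

context primitive_char begin

lemma norm_root_number: "norm root_number = sqrt (pi / real q)"
proof -
  define K where "K = norm root_number * (pi / real q) powr (-1/2)"
  have q0: "pi / real q > 0" using q_gt_1 by simp
  have factor: "norm (fe_factor (Complex (1/2) t)) = K" for t
  proof -
    define s where "s = Complex (1/2) t"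
    define w where "w = (s + of_real parity) / 2"
    have w: "w \<notin> \<int>\<^sub>\<le>\<^sub>0" using nonpos_Ints_Re_le[of w] parity_cases by (auto simp: w_def s_def)
    have "(1 - s + of_real parity) / 2 = cnj w" unfolding w_def s_def by (simp add: complex_eq_iff)
    then have "norm (Gamma ((1 - s + of_real parity) / 2)) = norm (Gamma w)" by (simp flip: cnj_Gamma)
    moreover have "norm (Gamma w) * norm (rGamma w) = 1"
      using w by (simp add: rGamma_inverse_Gamma norm_inverse Gamma_eq_zero_iff)
    moreover have "norm (of_real (pi / real q) powr (s - 1)) = (pi / real q) powr (-1/2)"
      using norm_of_real_powr[OF q0, of "s - 1"] by (simp add: s_def)
    ultimately show ?thesis
      unfolding s_def[symmetric] fe_factor_def w_def[symmetric] norm_mult K_def by (simp add: mult.assoc)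
  qed
  have "\<exists>t. dirichlet_L chi (Complex (1/2) t) \<noteq> 0"
  proof (rule ccontr)
    assume "\<nexists>t. dirichlet_L chi (Complex (1/2) t) \<noteq> 0"
    then have z: "dirichlet_L chi (1/2 + \<i> * of_real t) = 0" for t
      by (metis Complex_eq of_real_divide of_real_1 of_real_numeral)
    \<comment> \<open>This argument is the point 2, where L does not vanish.\<close>
    have "dirichlet_L chi (1/2 + \<i> * (- \<i> * (3/2))) = 0"
    proof (rule identity_on_real_interval[of "\<lambda>z. dirichlet_L chi (1/2 + \<i> * z)" UNIV "\<lambda>_. 0" 0 1 "- \<i> * (3/2)"])
      show "(\<lambda>z. dirichlet_L chi (1/2 + \<i> * z)) holomorphic_on UNIV"
        using holomorphic_on_compose_gen[OF _ L_holomorphic[of UNIV], of "\<lambda>z. 1/2 + \<i> * z" UNIV]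
        unfolding o_def by (fastforce intro: holomorphic_intros)
    qed (use z in auto)
    then show False using L_nonzero_gt_1[of 2] by simp
  qed
  then obtain t where t: "dirichlet_L chi (Complex (1/2) t) \<noteq> 0" by blast
  have "1 - cnj (Complex (1/2) t) = Complex (1/2) t" by (simp add: complex_eq_iff)
  then have "dirichlet_L chi (Complex (1/2) t) = fe_factor (Complex (1/2) t) * cnj (dirichlet_L chi (Complex (1/2) t))"
    using L_functional_equation[of "Complex (1/2) t"] by simp
  then have "norm (dirichlet_L chi (Complex (1/2) t)) = K * norm (dirichlet_L chi (Complex (1/2) t))"
    by (metis factor norm_mult complex_mod_cnj)
  then have "K = 1" using t by simp
  then show ?thesis unfolding K_def using q0 powr_half_sqrt[of "pi / real q"] q_gt_1
    by (simp add: powr_minus field_simps)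
qed

lemma norm_fe_factor:
  "norm (fe_factor s) = (pi / real q) powr (Re s - 1/2) *
     (norm (Gamma ((1 - s + of_real parity) / 2)) * norm (rGamma ((s + of_real parity) / 2)))"
proof -
  have q0: "pi / real q > 0" using q_gt_1 by simp
  have "sqrt (pi / real q) * (pi / real q) powr (Re s - 1) = (pi / real q) powr (Re s - 1/2)"
    using q0 powr_half_sqrt[of "pi / real q"] powr_add[of "pi / real q" "1/2" "Re s - 1"] by simp
  then show ?thesis
    unfolding fe_factor_def norm_mult norm_root_number using norm_of_real_powr[OF q0, of "s - 1"] by simp
qed

end

text \<open>For Re s \<ge> 1/2 the bound from summation by parts is linear in q and |s|; the
  functional equation carries it to the left at the price of a power. The constants depend on R
  only, which the uniformity in q of all later counts rests on.\<close>

lemma L_growth: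
  fixes R :: real
  assumes "R > 0"
  shows "\<exists>C A. C > 0 \<and> (\<forall>q chi s. primitive_char q chi \<longrightarrow> - R \<le> Re s \<longrightarrow>
     norm (dirichlet_L chi s) \<le> C * (real q * (norm s + 2)) ^ A)"
proof -
  obtain C N where CN: "C > 0" "real N \<ge> R + 1"
    "\<And>s a. - R \<le> Re s \<Longrightarrow> Re s < 1 / 2 \<Longrightarrow> a = 0 \<or> a = 1 \<Longrightarrow>
     norm (Gamma ((1 - s + of_real a) / 2)) * norm (rGamma ((s + of_real a) / 2)) \<le> C * (norm s + 2) ^ N"
    using fe_Gamma_quotient_bound[OF assms] by metis
  define Z where "Z = zeta_tail (1/2) + 1"
  have Z: "Z \<ge> 1" "zeta_tail (1/2) \<le> Z" unfolding Z_def using zeta_tail_nonneg[of "1/2"] by auto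
  have "norm (dirichlet_L chi s) \<le> ((C + 1) * Z) * (real q * (norm s + 2)) ^ Suc N"
    if p: "primitive_char q chi" and s: "- R \<le> Re s" for q chi s
  proof -
    interpret primitive_char q chi by (rule p)
    have q: "real q \<ge> 1" using q_gt_1 by simp
    have right: "norm (dirichlet_L chi z) \<le> real q * norm z * Z" if "Re z \<ge> 1/2" for z
    proof -
      have "norm (dirichlet_L chi z) \<le> real q * norm z * zeta_tail (Re z)"
        using norm_dseries_chi_le[of z] L_eq_dseries[of z] that by simp
      also have "\<dots> \<le> real q * norm z * Z"
        using zeta_tail_antimono[of "1/2" "Re z"] that Z by (intro mult_left_mono) auto
      finally show ?thesis .
    qed
    define Y where "Y = real q * (norm s + 2)"
    have Y: "Y \<ge> 1" unfolding Y_def using mult_mono[of 1 "real q" 1 "norm s + 2"] q by simp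
    show ?thesis
    proof (cases "Re s < 1/2")
      case False
      then have "norm (dirichlet_L chi s) \<le> real q * norm s * Z" using right by simp
      also have "\<dots> \<le> Y * Z" unfolding Y_def using Z q by (intro mult_right_mono mult_left_mono) auto
      also have "\<dots> \<le> Y ^ Suc N * ((C + 1) * Z)"
        using Y Z CN(1) self_le_power[of Y "Suc N"] mult_right_mono[of 1 "C + 1" Z] by (intro mult_mono) auto
      finally show ?thesis unfolding Y_def by (simp add: mult_ac)
    next
      case True
      have "norm (dirichlet_L chi s) = norm (fe_factor s) * norm (dirichlet_L chi (1 - cnj s))"
        using L_functional_equation[of s] True by (simp add: norm_mult)
      also have "\<dots> \<le> (real q ^ N * (C * (norm s + 2) ^ N)) * (real q * (norm s + 2) * Z)"
      proof (intro mult_mono)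
        have "(pi / real q) powr (Re s - 1/2) = inverse (real q / pi) powr (Re s - 1/2)" by simp
        also have "\<dots> = (real q / pi) powr (- (Re s - 1/2))"
          using q_gt_1 by (simp only: inverse_powr powr_minus)
        finally have e: "(pi / real q) powr (Re s - 1/2) = (real q / pi) powr (1/2 - Re s)" by simp
        have "(real q / pi) powr (1/2 - Re s) \<le> real q powr (1/2 - Re s)"
          using True pi_gt3 q by (intro powr_mono2) (auto simp: field_simps intro: order_trans[OF _ mult_left_mono[of 1 pi "real q"]])
        also have "\<dots> \<le> real q powr real N" using s CN(2) q by (intro powr_mono) auto
        also have "\<dots> = real q ^ N" using q by (simp add: powr_realpow)
        finally show "norm (fe_factor s) \<le> real q ^ N * (C * (norm s + 2) ^ N)"
          unfolding norm_fe_factor e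
          by (intro mult_mono CN(3)) (use s True parity_cases q in auto)
        have "norm (dirichlet_L chi (1 - cnj s)) \<le> real q * norm (1 - cnj s) * Z"
          by (rule right) (use True in simp)
        also have "\<dots> \<le> real q * (norm s + 2) * Z"
          using norm_triangle_ineq4[of 1 "cnj s"] Z q by (intro mult_right_mono mult_left_mono) auto
        finally show "norm (dirichlet_L chi (1 - cnj s)) \<le> real q * (norm s + 2) * Z" .
      qed (use q CN(1) in auto)
      also have "\<dots> = C * Z * Y ^ Suc N" unfolding Y_def by (simp add: power_mult_distrib mult_ac)
      also have "\<dots> \<le> (C + 1) * Z * Y ^ Suc N" using Z Y by (intro mult_right_mono) auto
      finally show ?thesis unfolding Y_def by (simp add: mult_ac)
    qed
  qed
  then show ?thesis using CN(1) Z(1) by (intro exI[of _ "(C + 1) * Z"] exI[of _ "Suc N"]) auto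
qed

section \<open>The completed function to the right of the critical line\<close>

text \<open>Dividing by (1 + e s)^(A+1), of modulus at least 1 in the half-plane, makes the function
  small on distant arcs. The maximum principle on a truncated half-plane applies, and e -> 0 removes
  the divisor.\<close>

lemma phragmen_lindelof_half_plane:
  fixes Q :: "complex \<Rightarrow> complex"
  assumes c: "c > 0" and hol: "Q holomorphic_on {s. Re s > c}" and cont: "continuous_on {s. Re s \<ge> c} Q"
    and K: "K \<ge> 0" and growth: "\<And>s. Re s \<ge> c \<Longrightarrow> norm (Q s) \<le> K * (norm s + 4) ^ A"
    and bdry: "\<And>s. Re s = c \<Longrightarrow> norm (Q s) \<le> 1" and s0: "Re s0 \<ge> c"
  shows "norm (Q s0) \<le> 1"
proof (cases "Re s0 = c")
  case False
  then have s0': "Re s0 > c" using s0 by simp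
  have eps: "norm (Q s0) \<le> norm (1 + of_real e * s0) ^ Suc A" if e: "e > 0" for e :: real
  proof -
    define h where "h = (\<lambda>s. Q s / (1 + of_real e * s) ^ Suc A)"
    have den: "norm (1 + of_real e * s) \<ge> 1" "norm (1 + of_real e * s) \<ge> e * norm s" if "Re s \<ge> c" for s
    proof -
      have "Re (1 + of_real e * s) \<ge> 1" using that e c by simp
      then show "norm (1 + of_real e * s) \<ge> 1" using complex_Re_le_cmod order_trans by blast
      have "(norm (of_real e * s))\<^sup>2 \<le> (norm (1 + of_real e * s))\<^sup>2"
        unfolding cmod_power2 using that e c by (simp add: power2_eq_square algebra_simps)
      then have "norm (of_real e * s) \<le> norm (1 + of_real e * s)" by (rule power2_le_imp_le) simp
      then show "norm (1 + of_real e * s) \<ge> e * norm s" using e by (simp add: norm_mult)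
    qed
    have denp: "0 < norm (1 + of_real e * s) ^ Suc A" if "Re s \<ge> c" for s
      by (rule zero_less_power) (use den(1)[OF that] in linarith)
    have den0: "1 + of_real e * s \<noteq> 0" if "Re s \<ge> c" for s using den(1)[OF that] by force
    \<comment> \<open>On the arc of this radius K (\<rho> + 4)^A \<le> K (2 \<rho>)^A \<le> (e
      \<rho>)^(A+1), where \<rho> \<ge> 4 gives the first inequality and the last entry of the
      maximum gives the second.\<close>
    define \<rho> where "\<rho> = max (norm s0 + 1) (max 4 (K * 2 ^ A / e ^ Suc A))"
    have \<rho>: "\<rho> > norm s0" "\<rho> \<ge> 4" "K * 2 ^ A / e ^ Suc A \<le> \<rho>" unfolding \<rho>_def by auto
    define S where "S = {s. Re s > c} \<inter> ball 0 \<rho>"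
    have "open S" unfolding S_def by (intro open_Int open_halfspace_Re_gt open_ball)
    have cl: "closure S \<subseteq> {s. Re s \<ge> c} \<inter> cball 0 \<rho>"
      unfolding S_def by (rule closure_minimal) (auto intro: closed_Int closed_halfspace_Re_ge)
    have "norm (h s0) \<le> 1"
    proof (rule maximum_modulus_frontier[of h S])
      show "h holomorphic_on interior S"
        unfolding h_def interior_open[OF \<open>open S\<close>]
        by (intro holomorphic_intros holomorphic_on_subset[OF hol]) (auto simp: S_def dest: den0[OF less_imp_le])
      show "continuous_on (closure S) h"
        unfolding h_def using cl by (intro continuous_intros continuous_on_subset[OF cont]) (auto dest: den0)
      show "bounded S" unfolding S_def by (simp add: bounded_Int)
      show "s0 \<in> S" using s0' \<rho> by (simp add: S_def)
      fix z assume z: "z \<in> frontier S"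
      then have zc: "Re z \<ge> c" "norm z \<le> \<rho>" "z \<notin> S"
        using cl interior_open[OF \<open>open S\<close>] by (auto simp: frontier_def)
      show "norm (h z) \<le> 1"
      proof (cases "Re z = c")
        case True
        have "1 \<le> norm (1 + of_real e * z) ^ Suc A" using den(1)[OF zc(1)] by (rule one_le_power)
        then show ?thesis unfolding h_def norm_divide norm_power
          unfolding divide_le_eq_1_pos[OF denp[OF zc(1)]] using bdry[OF True] by linarith
      next
        case False
        then have nz: "norm z = \<rho>" using zc by (auto simp: S_def)
        have "norm (Q z) \<le> K * (\<rho> + 4) ^ A" using growth[OF zc(1)] nz by simp
        also have "\<dots> \<le> K * (2 * \<rho>) ^ A" using \<rho> K by (intro mult_left_mono power_mono) auto
        also have "\<dots> = (K * 2 ^ A / e ^ Suc A) * (e ^ Suc A * \<rho> ^ A)" using e by (simp add: power_mult_distrib)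
        also have "\<dots> \<le> \<rho> * (e ^ Suc A * \<rho> ^ A)" using \<rho> e by (intro mult_right_mono) auto
        also have "\<dots> = (e * norm z) ^ Suc A" using nz by (simp add: power_mult_distrib)
        also have "\<dots> \<le> norm (1 + of_real e * z) ^ Suc A" using den(2)[OF zc(1)] e by (intro power_mono) auto
        finally show ?thesis unfolding h_def norm_divide norm_power
          unfolding divide_le_eq_1_pos[OF denp[OF zc(1)]] .
      qed
    qed
    then show ?thesis unfolding h_def norm_divide norm_power divide_le_eq_1_pos[OF denp[OF s0]] .
  qed
  have "(\<lambda>n. norm (1 + of_real (1 / real (Suc n)) * s0) ^ Suc A) \<longlonglongrightarrow> norm (1 + of_real 0 * s0) ^ Suc A"
    by (intro tendsto_intros LIMSEQ_Suc[OF lim_1_over_n]) 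
  moreover have "norm (Q s0) \<le> norm (1 + of_real (1 / real (Suc n)) * s0) ^ Suc A" for n
    by (rule eps) simp
  ultimately show ?thesis using LIMSEQ_le_const[of _ _ "norm (Q s0)"] by fastforce
qed (use bdry in auto)

lemma norm_square_has_derivative:
  assumes "(f has_field_derivative D) (at s)"
  shows "((\<lambda>h. (norm (f (s + of_real (k * h))))\<^sup>2) has_real_derivative 2 * k * Re (cnj (f s) * D)) (at 0)"
proof -
  have "((\<lambda>h. s + of_real (k * h)) has_vector_derivative of_real k) (at 0)"
    by (auto intro!: derivative_eq_intros simp: scaleR_conv_of_real)
  from field_vector_diff_chain_at[OF this, of f D]
  have g: "((\<lambda>h. f (s + of_real (k * h))) has_vector_derivative (of_real k * D)) (at 0)"
    using assms by (simp add: o_def)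
  have r: "((\<lambda>h. Re (f (s + of_real (k * h)))) has_real_derivative Re (of_real k * D)) (at 0)"
    and i: "((\<lambda>h. Im (f (s + of_real (k * h)))) has_real_derivative Im (of_real k * D)) (at 0)"
    using bounded_linear.has_vector_derivative[OF bounded_linear_Re g]
      bounded_linear.has_vector_derivative[OF bounded_linear_Im g]
    by (simp_all add: has_real_derivative_iff_has_vector_derivative)
  have "((\<lambda>h. (Re (f (s + of_real (k * h))))\<^sup>2 + (Im (f (s + of_real (k * h))))\<^sup>2) has_real_derivative
      2 * k * Re (cnj (f s) * D)) (at 0)"
    by (rule DERIV_cong[OF DERIV_add[OF DERIV_power[OF r, of 2] DERIV_power[OF i, of 2]]])
       (simp add: algebra_simps)
  then show ?thesis by (simp only: cmod_power2)
qed

text \<open>The difference of |f|^2 at s + h and at s - h vanishes at h = 0 and is nonnegative for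
  small h > 0, so its derivative 4 Re (cnj (f s) D) at 0 cannot be negative.\<close>

lemma logderiv_nonneg_if_dominates:
  assumes D: "(f has_field_derivative D) (at s)" and f0: "f s \<noteq> 0" and d: "d > 0"
    and dom: "\<And>h. 0 < h \<Longrightarrow> h < d \<Longrightarrow> norm (f (s - of_real h)) \<le> norm (f (s + of_real h))"
  shows "Re (D / f s) \<ge> 0"
proof -
  define \<phi> where "\<phi> = (\<lambda>h. (norm (f (s + of_real (1 * h))))\<^sup>2 - (norm (f (s + of_real ((-1) * h))))\<^sup>2)"
  have \<phi>: "(\<phi> has_real_derivative 2 * 1 * Re (cnj (f s) * D) - 2 * (-1) * Re (cnj (f s) * D)) (at 0)"
    unfolding \<phi>_def by (intro DERIV_diff norm_square_has_derivative D)
  have "Re (cnj (f s) * D) \<ge> 0"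
  proof (rule ccontr)
    assume "\<not> Re (cnj (f s) * D) \<ge> 0"
    then have "2 * 1 * Re (cnj (f s) * D) - 2 * (-1) * Re (cnj (f s) * D) < 0" by linarith
    then obtain e where e: "e > 0" "\<And>h. 0 < h \<Longrightarrow> h < e \<Longrightarrow> \<phi> (0 + h) < \<phi> 0"
      using DERIV_neg_dec_right[OF \<phi>] by blast
    define h where "h = min (e / 2) (d / 2)"
    have h: "0 < h" "h < e" "h < d" unfolding h_def using e d by auto
    have "(norm (f (s - of_real h)))\<^sup>2 \<le> (norm (f (s + of_real h)))\<^sup>2"
      using dom[OF h(1,3)] by (intro power_mono) auto
    moreover have "\<phi> (0 + h) = (norm (f (s + of_real h)))\<^sup>2 - (norm (f (s - of_real h)))\<^sup>2" "\<phi> 0 = 0"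
      unfolding \<phi>_def by simp_all
    ultimately show False using e(2)[OF h(1,2)] by linarith
  qed
  moreover have "Re (D / f s) = Re (cnj (f s) * D) / (norm (f s))\<^sup>2"
    by (subst complex_div_cnj) (simp add: mult.commute)
  ultimately show ?thesis by simp
qed

section \<open>The completed function and its reflection\<close>

context primitive_char begin

text \<open>In the even case the argument is s/2 + 1, that is (s/2) Gamma(s/2): the pole at 0 is
  removed, and the factor s - 1 in \<open>pfac\<close> restores the symmetry under reflection. In
  the odd case this is the usual Gamma((s + 1)/2). Either way \<open>xi\<close> is holomorphic for
  Re s > -1.\<close>

definition gam :: "complex \<Rightarrow> complex" where "gam s = Gamma ((s + of_real (2 - parity)) / 2)"
definition pfac :: "complex \<Rightarrow> complex" where "pfac s = (if parity = 0 then s - 1 else 1)"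
definition xi :: "complex \<Rightarrow> complex" where
  "xi s = pfac s * of_real (real q / pi) powr (s / 2) * gam s * dirichlet_L chi s"

lemma gam_arg: "Re s > -1 \<Longrightarrow> (s + of_real (2 - parity)) / 2 \<notin> \<int>\<^sub>\<le>\<^sub>0"
  using nonpos_Ints_Re_le[of "(s + of_real (2 - parity)) / 2"] parity_cases by auto

lemma q_pi_pos: "real q / pi > 0" using q_gt_1 by simp

lemma xi_holomorphic: "xi holomorphic_on {s. Re s > -1}"
proof -
  have "gam holomorphic_on {s. Re s > -1}"
    unfolding gam_def by (intro holomorphic_intros) (use gam_arg in auto)
  moreover have "pfac holomorphic_on {s. Re s > -1}"
  proof (cases "parity = 0")
    case True
    then show ?thesis unfolding pfac_def by (auto intro!: holomorphic_intros)
  next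
    case False
    then have "pfac = (\<lambda>_. 1)" unfolding pfac_def by simp
    then show ?thesis by simp
  qed
  moreover have "(\<lambda>s. of_real (real q / pi) powr (s / 2)) holomorphic_on {s. Re s > -1}"
    using q_pi_pos by (intro holomorphic_intros) auto
  ultimately show ?thesis unfolding xi_def by (intro holomorphic_on_mult L_holomorphic)
qed

lemma norm_xi: "norm (xi s) = norm (pfac s) * (real q / pi) powr (Re s / 2) * norm (gam s) * norm (dirichlet_L chi s)"
  unfolding xi_def norm_mult using norm_of_real_powr[OF q_pi_pos, of "s / 2"] by simp

text \<open>The functional equation in moduli, which removes the root number. In the even case the
  factors s and s - 1 change places under reflection.\<close>

lemma xi_reflect:
  assumes s: "-1 < Re s" "Re s < 0"
  shows "norm (xi s) = norm (xi (1 - cnj s))"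
proof -
  define G where "G = norm (Gamma ((1 - s + of_real parity) / 2))"
  have L: "norm (dirichlet_L chi s) = (pi / real q) powr (Re s - 1/2) *
     (G * norm (rGamma ((s + of_real parity) / 2))) * norm (dirichlet_L chi (1 - cnj s))"
    using L_functional_equation[of s] s unfolding G_def norm_fe_factor[symmetric] by (simp add: norm_mult)
  have "(pi / real q) powr (Re s - 1/2) = inverse (real q / pi) powr (Re s - 1/2)" by simp
  also have "\<dots> = (real q / pi) powr (- (Re s - 1/2))" by (simp only: inverse_powr powr_minus)
  finally have "(real q / pi) powr (Re s / 2) * (pi / real q) powr (Re s - 1/2) = (real q / pi) powr (Re s / 2 + - (Re s - 1/2))"
    by (simp only: powr_add)
  also have "Re s / 2 + - (Re s - 1/2) = Re (1 - cnj s) / 2" by (simp add: field_simps)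
  finally have P: "(real q / pi) powr (Re s / 2) * (pi / real q) powr (Re s - 1/2) = (real q / pi) powr (Re (1 - cnj s) / 2)" .
  have key: "norm (pfac s) * norm (gam s) * (G * norm (rGamma ((s + of_real parity) / 2))) = norm (pfac (1 - cnj s)) * norm (gam (1 - cnj s))"
  proof (cases "parity = 0")
    case True
    have n1: "s / 2 \<notin> \<int>\<^sub>\<le>\<^sub>0"
    proof
      assume "s / 2 \<in> \<int>\<^sub>\<le>\<^sub>0"
      then obtain n where n: "s / 2 = of_int n" by (elim nonpos_Ints_cases)
      then have "Re s = 2 * of_int n" by (metis Re_divide_numeral mult.commute nonzero_eq_divide_eq complex_Re_of_int zero_neq_numeral)
      then have "-1 < 2 * n" "n < 0" using s by linarith+
      then show False by simp
    qed
    have n2: "(1 - cnj s) / 2 \<notin> \<int>\<^sub>\<le>\<^sub>0" using nonpos_Ints_Re_le[of "(1 - cnj s) / 2"] s by auto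
    have "gam s = s / 2 * Gamma (s / 2)"
      unfolding gam_def True using Gamma_plus1[OF n1] by (simp add: add_divide_distrib)
    moreover have "Gamma (s / 2) * rGamma (s / 2) = 1"
      using n1 by (simp add: rGamma_inverse_Gamma Gamma_eq_zero_iff)
    ultimately have "gam s * rGamma (s / 2) = s / 2" by (simp only: mult.assoc mult_1_right)
    then have "norm (gam s * rGamma (s / 2)) = norm (s / 2)" by (simp only:)
    then have "norm (gam s * rGamma (s / 2)) = norm s / 2" by (simp only: norm_divide norm_numeral)
    then have 1: "norm (gam s) * norm (rGamma (s / 2)) = norm s / 2" by (simp only: norm_mult)
    have "gam (1 - cnj s) = (1 - cnj s) / 2 * Gamma ((1 - cnj s) / 2)"
      unfolding gam_def True using Gamma_plus1[OF n2] by (simp add: add_divide_distrib diff_divide_distrib)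
    moreover have "norm (Gamma ((1 - cnj s) / 2)) = G"
    proof -
      have "(1 - cnj s) / 2 = cnj ((1 - s + of_real parity) / 2)" using True by simp
      then show ?thesis unfolding G_def by (simp only: cnj_Gamma[symmetric] complex_mod_cnj)
    qed
    moreover have "norm (1 - cnj s) = norm (1 - s)" by (metis complex_cnj_diff complex_cnj_one complex_mod_cnj)
    ultimately have 2: "norm (gam (1 - cnj s)) = norm (1 - s) / 2 * G" by (simp only: norm_mult norm_divide norm_numeral)
    have 3: "norm (pfac s) = norm (1 - s)" "norm (pfac (1 - cnj s)) = norm s"
      unfolding pfac_def using True by (simp_all add: norm_minus_commute)
    have "norm (pfac s) * norm (gam s) * (G * norm (rGamma ((s + of_real parity) / 2))) =
       norm (1 - s) * G * (norm (gam s) * norm (rGamma (s / 2)))" unfolding 3 using True by simp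
    then show ?thesis unfolding 1 2 3 by simp
  next
    case False
    then have p: "parity = 1" using parity_cases by blast
    have n1: "(s + 1) / 2 \<notin> \<int>\<^sub>\<le>\<^sub>0" using nonpos_Ints_Re_le[of "(s + 1) / 2"] s by auto
    have "norm (gam s) * norm (rGamma ((s + 1) / 2)) = 1"
      unfolding gam_def p using n1 by (simp add: rGamma_inverse_Gamma norm_inverse Gamma_eq_zero_iff)
    moreover have "norm (gam (1 - cnj s)) = G"
    proof -
      have "(1 - cnj s + of_real (2 - parity)) / 2 = cnj ((1 - s + of_real parity) / 2)" using p by simp
      then show ?thesis unfolding G_def gam_def by (simp only: cnj_Gamma[symmetric] complex_mod_cnj)
    qed
    ultimately show ?thesis using p by (simp add: pfac_def)
  qed
  have "norm (xi s) = (norm (pfac s) * norm (gam s) * (G * norm (rGamma ((s + of_real parity) / 2)))) *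
      ((real q / pi) powr (Re s / 2) * (pi / real q) powr (Re s - 1/2)) * norm (dirichlet_L chi (1 - cnj s))"
    unfolding norm_xi L by (simp only: mult_ac)
  then show ?thesis unfolding key P norm_xi[of "1 - cnj s"] by (simp only: mult_ac)
qed

lemma xi_nonzero:
  assumes "Re s > 1"
  shows "xi s \<noteq> 0"
proof -
  have "gam s \<noteq> 0" unfolding gam_def using gam_arg[of s] assms by (simp add: Gamma_eq_zero_iff)
  moreover have "pfac s \<noteq> 0" unfolding pfac_def using assms by auto
  moreover have "complex_of_real (real q / pi) powr (s / 2) \<noteq> 0" using q_gt_1 by simp
  ultimately show ?thesis unfolding xi_def using L_nonzero_gt_1[OF assms] by simp
qed

text \<open>The shift by 1 - 2c carries the line of real part c to its mirror image. The constants
  may depend on q and c in any way, since Phragmen-Lindelof discards them; only polynomial growth in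
  s matters, and it comes from L in the numerator.\<close>

lemma xi_quotient_growth:
  assumes c: "1 < c" "c < 3/2"
  shows "\<exists>K A. K \<ge> 0 \<and> (\<forall>s. Re s \<ge> c \<longrightarrow> norm (xi (s + of_real (1 - 2 * c)) / xi s) \<le> K * (norm s + 4) ^ A)"
proof -
  \<comment> \<open>The shift is by -2 \<delta>, and the argument of Gamma, being halved, moves by
    \<delta>.\<close>
  define \<delta> where "\<delta> = c - 1/2"
  define u where "u = (c + (2 - parity)) / 2"
  have \<delta>u: "0 \<le> \<delta>" "\<delta> < u" unfolding \<delta>_def u_def using c parity_cases by (auto simp: field_simps)
  obtain C A where CA: "C > 0" "\<And>s. -1 \<le> Re s \<Longrightarrow> norm (dirichlet_L chi s) \<le> C * (real q * (norm s + 2)) ^ A"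
    using L_growth[of 1] primitive_char_axioms by (metis zero_less_one)
  obtain d where d: "d > 0" "\<And>s. Re s \<ge> c \<Longrightarrow> norm (dirichlet_L chi s) \<ge> d"
    using coef.dseries_away_from_0[OF c(1)] L_eq_dseries c(1) by (metis less_trans order_less_le_trans zero_less_one)
  define P where "P = 1 + 2 * \<delta> / (c - 1)"
  define G where "G = Gamma (u - \<delta>) / Gamma u"
  define B where "B = (real q / pi) powr (- \<delta>)"
  have G0: "G \<ge> 0" unfolding G_def using \<delta>u by (intro divide_nonneg_nonneg) (auto intro!: less_imp_le[OF Gamma_real_pos])
  have P0: "P \<ge> 0" unfolding P_def using c \<delta>u by simp
  have "norm (xi (s + of_real (1 - 2 * c)) / xi s) \<le> (P * B * G * (C * real q ^ A / d)) * (norm s + 4) ^ A" if s: "Re s \<ge> c" for s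
  proof -
    define z where "z = s + of_real (1 - 2 * c)"
    have zs: "z = s - of_real (2 * \<delta>)" unfolding z_def \<delta>_def by (simp add: algebra_simps)
    have b1: "norm (pfac z) \<le> P * norm (pfac s)"
    proof (cases "parity = 0")
      case True
      have "c - 1 \<le> norm (s - 1)" using complex_Re_le_cmod[of "s - 1"] s by simp
      then have "2 * \<delta> / (c - 1) * (c - 1) \<le> 2 * \<delta> / (c - 1) * norm (s - 1)"
        using \<delta>u c by (intro mult_left_mono) auto
      moreover have "2 * \<delta> / (c - 1) * (c - 1) = 2 * \<delta>" using c by simp
      moreover have "norm (z - 1) \<le> norm (s - 1) + 2 * \<delta>"
        using norm_triangle_ineq4[of "s - 1" "of_real (2 * \<delta>)"] \<delta>u unfolding zs by (simp add: algebra_simps)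
      ultimately show ?thesis using True unfolding pfac_def P_def by (simp add: distrib_right)
    qed (use c \<delta>u in \<open>auto simp: pfac_def P_def\<close>)
    have b2: "(real q / pi) powr (Re z / 2) = B * (real q / pi) powr (Re s / 2)"
      unfolding B_def powr_add[symmetric] zs by (simp add: field_simps)
    have b3: "norm (gam z) \<le> G * norm (gam s)"
    proof -
      define w where "w = (s + of_real (2 - parity)) / 2"
      have "norm (Gamma (w - of_real \<delta>)) \<le> Gamma (u - \<delta>) / Gamma u * norm (Gamma w)"
        by (rule norm_Gamma_ratio_half_plane[OF \<delta>u]) (use s in \<open>simp add: u_def w_def\<close>)
      moreover have "w - of_real \<delta> = (z + of_real (2 - parity)) / 2" unfolding w_def zs by (simp add: field_simps)
      ultimately show ?thesis unfolding gam_def G_def w_def[symmetric] by (simp only:)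
    qed
    have "norm (complex_of_real (2 * \<delta>)) \<le> 2" using c unfolding norm_of_real \<delta>_def by simp
    then have "norm z \<le> norm s + 2" using norm_triangle_ineq4[of s "of_real (2 * \<delta>)"] unfolding zs by linarith
    then have "norm (dirichlet_L chi z) \<le> C * (real q * (norm s + 4)) ^ A"
    proof -
      assume nz: "norm z \<le> norm s + 2"
      have "norm (dirichlet_L chi z) \<le> C * (real q * (norm z + 2)) ^ A"
        by (rule CA(2)) (use s c in \<open>simp add: z_def\<close>)
      also have "\<dots> \<le> C * (real q * (norm s + 4)) ^ A"
        using nz CA(1) by (intro mult_left_mono power_mono) auto
      finally show ?thesis .
    qed
    also have "\<dots> = C * real q ^ A / d * (norm s + 4) ^ A * d" using d by (simp add: power_mult_distrib)
    also have "\<dots> \<le> C * real q ^ A / d * (norm s + 4) ^ A * norm (dirichlet_L chi s)"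
      using d CA(1) s by (intro mult_left_mono) auto
    finally have b4: "norm (dirichlet_L chi z) \<le> C * real q ^ A / d * (norm s + 4) ^ A * norm (dirichlet_L chi s)" .
    have "norm (xi z) \<le> (P * norm (pfac s)) * (B * (real q / pi) powr (Re s / 2)) * (G * norm (gam s)) *
        (C * real q ^ A / d * (norm s + 4) ^ A * norm (dirichlet_L chi s))"
      unfolding norm_xi b2 using P0 G0 by (intro mult_mono b1 b3 b4 mult_nonneg_nonneg) (auto simp: B_def)
    also have "\<dots> = (P * B * G * (C * real q ^ A / d)) * (norm s + 4) ^ A * norm (xi s)"
      unfolding norm_xi by (simp only: mult_ac)
    finally show ?thesis using xi_nonzero[of s] s c unfolding z_def[symmetric] by (simp add: norm_divide divide_le_eq)
  qed
  moreover have "P * B * G * (C * real q ^ A / d) \<ge> 0"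
    using P0 G0 CA(1) d by (auto simp: B_def)
  ultimately show ?thesis by blast
qed

text \<open>Compare \<open>xi\<close> with its mirror image in a vertical line, by Phragmen-Lindelof on the right of it.\<close>

lemma xi_logderiv_nonneg:
  assumes s: "1 < Re s" "Re s < 3/2" and D: "(xi has_field_derivative D) (at s)"
  shows "Re (D / xi s) \<ge> 0"
proof -
  define c where "c = Re s"
  have c: "1 < c" "c < 3/2" unfolding c_def using s by auto
  \<comment> \<open>On Re s = c the shifted point is the reflection 1 - cnj s, so the quotient has
    modulus 1 there.\<close>
  define Q where "Q = (\<lambda>s. xi (s + of_real (1 - 2 * c)) / xi s)"
  obtain K A where KA: "K \<ge> 0" "\<And>s. Re s \<ge> c \<Longrightarrow> norm (Q s) \<le> K * (norm s + 4) ^ A"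
    using xi_quotient_growth[OF c] unfolding Q_def by blast
  have hol: "Q holomorphic_on {s. Re s > 1} \<inter> {s. Re s > 2 * c - 2}"
  proof -
    have "(\<lambda>s. xi (s + of_real (1 - 2 * c))) holomorphic_on {s. Re s > 1} \<inter> {s. Re s > 2 * c - 2}"
      using holomorphic_on_compose_gen[OF _ xi_holomorphic, of "\<lambda>s. s + of_real (1 - 2 * c)" "{s. Re s > 1} \<inter> {s. Re s > 2 * c - 2}"]
      unfolding o_def by (fastforce intro!: holomorphic_intros)
    moreover have "xi holomorphic_on {s. Re s > 1} \<inter> {s. Re s > 2 * c - 2}"
      by (rule holomorphic_on_subset[OF xi_holomorphic]) auto
    ultimately show ?thesis unfolding Q_def by (intro holomorphic_on_divide) (use xi_nonzero in auto)
  qed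
  have bdry: "norm (Q z) \<le> 1" if "Re z = c" for z
  proof -
    have e: "z + of_real (1 - 2 * c) = 1 - cnj z" using that by (simp add: complex_eq_iff)
    have "norm (xi (1 - cnj z)) = norm (xi (1 - cnj (1 - cnj z)))"
      by (rule xi_reflect) (use that c in auto)
    then show ?thesis unfolding Q_def e using xi_nonzero[of z] that c by (simp add: norm_divide)
  qed
  have Q1: "norm (Q z) \<le> 1" if "Re z \<ge> c" for z
  proof (rule phragmen_lindelof_half_plane[of c Q K A])
    show "Q holomorphic_on {s. Re s > c}" by (rule holomorphic_on_subset[OF hol]) (use c in auto)
    show "continuous_on {s. Re s \<ge> c} Q"
      by (rule holomorphic_on_imp_continuous_on[OF holomorphic_on_subset[OF hol]]) (use c in auto)
  qed (use c KA bdry that in auto)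
  show ?thesis
  proof (rule logderiv_nonneg_if_dominates[OF D, of "c - 1"])
    show "xi s \<noteq> 0" by (rule xi_nonzero) (use s in simp)
    show "c - 1 > 0" using c by simp
    fix h :: real assume h: "0 < h" "h < c - 1"
    \<comment> \<open>The point shifted from z is the reflection of s - h, so |Q z| \<le> 1 compares
      the values of \<open>xi\<close> at s - h and s + h.\<close>
    define z where "z = s + of_real h"
    have "norm (xi (z + of_real (1 - 2 * c)) / xi z) \<le> 1" using Q1[of z] h unfolding Q_def z_def c_def by simp
    moreover have "xi z \<noteq> 0" by (rule xi_nonzero) (use s h in \<open>simp add: z_def\<close>)
    ultimately have "norm (xi (z + of_real (1 - 2 * c))) \<le> norm (xi z)" by (simp add: norm_divide divide_le_eq)
    moreover have "norm (xi (z + of_real (1 - 2 * c))) = norm (xi (1 - cnj (z + of_real (1 - 2 * c))))"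
      by (rule xi_reflect) (use h c in \<open>auto simp: z_def c_def[symmetric]\<close>)
    moreover have "1 - cnj (z + of_real (1 - 2 * c)) = s - of_real h"
      unfolding z_def c_def by (simp add: complex_eq_iff)
    ultimately show "norm (xi (s - of_real h)) \<le> norm (xi (s + of_real h))" unfolding z_def by (simp only:)
  qed
qed

end

section \<open>The real part of the logarithmic derivative\<close>

lemma cnj_Digamma:
  assumes "z \<noteq> 0"
  shows "cnj (Digamma z) = Digamma (cnj z)"
proof (rule LIMSEQ_unique)
  show "(\<lambda>m. cnj (of_real (ln (real m)) - (\<Sum>n<m. inverse (z + of_nat n)))) \<longlonglongrightarrow> cnj (Digamma z)"
    unfolding lim_cnj by (rule Digamma_LIMSEQ[OF assms])
  show "(\<lambda>m. cnj (of_real (ln (real m)) - (\<Sum>n<m. inverse (z + of_nat n)))) \<longlonglongrightarrow> Digamma (cnj z)"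
    using Digamma_LIMSEQ[of "cnj z"] assms by simp
qed

context primitive_char begin

abbreviation (input) L where "L \<equiv> dirichlet_L chi"

lemma L_has_derivative: "(dirichlet_L chi has_field_derivative deriv (dirichlet_L chi) s) (at s)"
  by (rule holomorphic_derivI[OF L_holomorphic[of UNIV] open_UNIV UNIV_I])

definition psi_half :: "complex \<Rightarrow> complex" where
  "psi_half s = Digamma ((s + of_real parity) / 2)"

lemma non_nonpos_Int_if_Im: "Im z \<noteq> 0 \<Longrightarrow> z \<notin> \<int>\<^sub>\<le>\<^sub>0"
  by (auto elim!: nonpos_Ints_cases)

lemma ln_q_pi_ge: "ln (real q / pi) \<ge> -1"
proof -
  have "real q / pi \<ge> 1 / 2" using q_gt_1 pi_less_4 by (simp add: field_simps)
  then have "ln (real q / pi) \<ge> ln (1 / 2)" using q_pi_pos by (subst ln_le_cancel_iff) auto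
  moreover have "ln (1 / 2 :: real) \<ge> -1" using ln_2_less_1 by (simp add: ln_div)
  ultimately show ?thesis by linarith
qed

text \<open>Expands Re (xi'/xi) \<ge> 0 into its factors. The error 1/50 covers, in the even case,
  the terms 1/(s - 1) from \<open>pfac\<close> and 1/s from shifting Digamma, each at most 1/100 in
  real part at this height.\<close>

lemma L_logderiv_right:
  assumes s: "1 < Re s" "Re s < 3/2" "Im s \<ge> 100"
  shows "Re (deriv L s / L s) \<ge> - ln (real q / pi) / 2 - Re (psi_half s) / 2 - 1 / 50"
proof -
  define b where "b = 2 - parity"
  define w where "w = (s + of_real b) / 2"
  have w: "w \<notin> \<int>\<^sub>\<le>\<^sub>0" unfolding w_def b_def using gam_arg[of s] s by simp
  define D1 where "D1 = (if parity = 0 then 1 else 0 :: complex)"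
  have d1: "(pfac has_field_derivative D1) (at s)"
  proof (cases "parity = 0")
    case True
    then have "pfac = (\<lambda>s. s - 1)" unfolding pfac_def by simp
    then show ?thesis unfolding D1_def using True by (auto intro!: derivative_eq_intros)
  next
    case False
    then have "pfac = (\<lambda>s. 1)" unfolding pfac_def by simp
    then show ?thesis unfolding D1_def using False by simp
  qed
  define pw where "pw = (\<lambda>s. complex_of_real (real q / pi) powr (s / 2))"
  have "((\<lambda>s. complex_of_real (real q / pi) powr (s / 2)) has_field_derivative
      Ln (of_real (real q / pi)) * of_real (real q / pi) powr (s / 2) * (1 / 2)) (at s)"
    using q_gt_1 by (intro DERIV_chain2[OF has_field_derivative_powr_right]) (auto intro!: derivative_eq_intros)
  moreover have "Ln (complex_of_real (real q / pi)) = of_real (ln (real q / pi))"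
    by (rule Ln_of_real[OF q_pi_pos])
  ultimately have d2: "(pw has_field_derivative of_real (ln (real q / pi)) * pw s * (1/2)) (at s)"
    unfolding pw_def by simp
  have d3: "(gam has_field_derivative Gamma w * Digamma w * (1/2)) (at s)"
    unfolding gam_def w_def b_def
    by (intro DERIV_chain2[OF has_field_derivative_Gamma]) (use w in \<open>auto intro!: derivative_eq_intros simp: w_def b_def\<close>)
  have gw: "gam s = Gamma w" unfolding gam_def w_def b_def ..
  have xi_eq: "xi = (\<lambda>s. pfac s * pw s * gam s * L s)" unfolding xi_def pw_def by simp
  define D where "D = ((D1 * pw s + of_real (ln (real q / pi)) * pw s * (1/2) * pfac s) * gam s + Gamma w * Digamma w * (1/2) * (pfac s * pw s)) * L s
      + deriv L s * (pfac s * pw s * gam s)"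
  have xiD: "(xi has_field_derivative D) (at s)"
    unfolding xi_eq D_def by (intro DERIV_mult d1 d2 d3 L_has_derivative)
  have nz: "pfac s \<noteq> 0" "pw s \<noteq> 0" "gam s \<noteq> 0" "L s \<noteq> 0"
    using xi_nonzero[OF s(1)] unfolding xi_eq by auto
  have "D / xi s = D1 / pfac s + of_real (ln (real q / pi) / 2) + Digamma w / 2 + deriv L s / L s"
    unfolding D_def xi_eq using nz by (simp add: gw[symmetric] field_simps)
  moreover have "Re (D / xi s) \<ge> 0" by (rule xi_logderiv_nonneg[OF s(1,2) xiD])
  moreover have "Re (D1 / pfac s) + Re (Digamma w / 2) \<le> Re (psi_half s) / 2 + 1 / 50"
  proof (cases "parity = 0")
    case True
    have s0: "s / 2 \<noteq> 0" using s by auto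
    have inv: "Re (1 / z) \<le> 1 / 100" if "Im z \<ge> 100" for z :: complex
    proof -
      have "norm z \<ge> 100" using abs_Im_le_cmod[of z] that by linarith
      then have "norm (1 / z) \<le> 1 / 100" by (simp add: norm_divide divide_simps)
      then show ?thesis using complex_Re_le_cmod[of "1 / z"] by linarith
    qed
    have "Digamma w = Digamma (s / 2) + 1 / (s / 2)"
      using Digamma_plus1[OF s0] True unfolding w_def b_def by (simp add: add_divide_distrib)
    then have "Digamma w / 2 = psi_half s / 2 + 1 / s" using True by (simp add: psi_half_def add_divide_distrib)
    then have "Re (Digamma w / 2) = Re (psi_half s / 2 + 1 / s)" by (simp only:)
    then have "Re (Digamma w / 2) = Re (psi_half s) / 2 + Re (1 / s)" by simp
    moreover have "D1 / pfac s = 1 / (s - 1)" using True by (simp add: D1_def pfac_def)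
    moreover have "Re (1 / s) \<le> 1 / 100" "Re (1 / (s - 1)) \<le> 1 / 100" by (intro inv; use s in simp)+
    ultimately show ?thesis by (simp only:)
  next
    case False
    then have "parity = 1" using parity_cases by blast
    then show ?thesis by (simp add: D1_def psi_half_def w_def b_def)
  qed
  ultimately show ?thesis by simp
qed

lemma psi_half_reflect:
  assumes "Im s \<noteq> 0"
  shows "psi_half (1 - cnj s) = cnj (Digamma ((1 - s + of_real parity) / 2))"
proof -
  have nz: "(1 - s + of_real parity) / 2 \<noteq> 0" using assms by (auto simp: complex_eq_iff)
  have e: "(1 - cnj s + of_real parity) / 2 = cnj ((1 - s + of_real parity) / 2)" by simp
  show ?thesis unfolding psi_half_def e cnj_Digamma[OF nz] ..
qed

lemma fe_factor_deriv:
  assumes s: "Re s < 1" "Im s \<noteq> 0"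
  shows "(fe_factor has_field_derivative fe_factor s * (- of_real (ln (real q / pi)) - cnj (psi_half (1 - cnj s)) / 2 - psi_half s / 2)) (at s)"
proof -
  define u v where "u = (1 - s + of_real parity) / 2" and "v = (s + of_real parity) / 2"
  have uv: "u \<notin> \<int>\<^sub>\<le>\<^sub>0" "v \<notin> \<int>\<^sub>\<le>\<^sub>0" unfolding u_def v_def using s by (auto intro!: non_nonpos_Int_if_Im)
  define r where "r = complex_of_real (pi / real q)"
  have r0: "r \<noteq> 0" unfolding r_def using q_gt_1 by simp
  have "ln (pi / real q) = - ln (real q / pi)" using q_gt_1 by (simp add: ln_div)
  then have lnr: "Ln r = - of_real (ln (real q / pi))"
    unfolding r_def using Ln_of_real[of "pi / real q"] q_gt_1 by simp
  have d1: "((\<lambda>s. r powr (s - 1)) has_field_derivative Ln r * r powr (s - 1) * 1) (at s)"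
    by (intro DERIV_chain2[OF has_field_derivative_powr_right[OF r0]]) (auto intro!: derivative_eq_intros)
  have d2: "((\<lambda>s. Gamma ((1 - s + of_real parity) / 2)) has_field_derivative Gamma u * Digamma u * (- 1 / 2)) (at s)"
    unfolding u_def by (intro DERIV_chain2[OF has_field_derivative_Gamma]) (use uv in \<open>auto intro!: derivative_eq_intros simp: u_def\<close>)
  have d3: "((\<lambda>s. rGamma ((s + of_real parity) / 2)) has_field_derivative - rGamma v * Digamma v * (1 / 2)) (at s)"
    unfolding v_def by (intro DERIV_chain2[OF has_field_derivative_rGamma_no_nonpos_int]) (use uv in \<open>auto intro!: derivative_eq_intros simp: v_def\<close>)
  have fe: "fe_factor = (\<lambda>s. root_number * r powr (s - 1) * Gamma ((1 - s + of_real parity) / 2) * rGamma ((s + of_real parity) / 2))"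
    unfolding fe_factor_def r_def by simp
  have "(fe_factor has_field_derivative ((root_number * (Ln r * r powr (s - 1) * 1)) * Gamma u + Gamma u * Digamma u * (- 1 / 2) * (root_number * r powr (s - 1))) * rGamma v
      + - rGamma v * Digamma v * (1 / 2) * (root_number * r powr (s - 1) * Gamma u)) (at s)"
    unfolding fe u_def v_def
    by (intro DERIV_mult DERIV_cmult d1 d2[unfolded u_def] d3[unfolded v_def])
  moreover have "((root_number * (Ln r * r powr (s - 1) * 1)) * Gamma u + Gamma u * Digamma u * (- 1 / 2) * (root_number * r powr (s - 1))) * rGamma v
      + - rGamma v * Digamma v * (1 / 2) * (root_number * r powr (s - 1) * Gamma u)
     = fe_factor s * (Ln r - Digamma u / 2 - Digamma v / 2)"
    unfolding fe u_def[symmetric] v_def[symmetric] by (simp add: algebra_simps)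
  moreover have "Digamma u = cnj (psi_half (1 - cnj s))" unfolding psi_half_reflect[OF s(2)] u_def by simp
  ultimately show ?thesis unfolding lnr psi_half_def v_def by simp
qed

lemma fe_factor_nonzero:
  assumes "Im s \<noteq> 0"
  shows "fe_factor s \<noteq> 0"
proof -
  have n: "(1 - s + of_real parity) / 2 \<notin> \<int>\<^sub>\<le>\<^sub>0" "(s + of_real parity) / 2 \<notin> \<int>\<^sub>\<le>\<^sub>0"
    using assms by (auto intro!: non_nonpos_Int_if_Im)
  have "root_number \<noteq> 0" using norm_root_number q_gt_1 by auto
  moreover have "complex_of_real (pi / real q) powr (s - 1) \<noteq> 0" using q_gt_1 by simp
  ultimately show ?thesis unfolding fe_factor_def using n
    by (simp add: Gamma_eq_zero_iff rGamma_eq_zero_iff)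
qed

lemma L_zero_reflect:
  assumes "Re s < 1" "Im s \<noteq> 0"
  shows "L s = 0 \<longleftrightarrow> L (1 - cnj s) = 0"
  using L_functional_equation[OF assms(1)] fe_factor_nonzero[OF assms(2)] by simp

text \<open>Logarithmic differentiation of the functional equation. Reflection reverses the sign of
  the derivative, so the two logarithmic derivatives appear as a sum, free of the root
  number.\<close>

lemma L_logderiv_reflect:
  assumes s: "Re s < 1" "Im s \<noteq> 0" and Ls: "L s \<noteq> 0"
  shows "Re (deriv L s / L s) + Re (deriv L (1 - cnj s) / L (1 - cnj s)) =
     - ln (real q / pi) - Re (psi_half s) / 2 - Re (psi_half (1 - cnj s)) / 2"
proof -
  define z where "z = 1 - cnj s"
  have Lz: "L z \<noteq> 0" using L_zero_reflect[OF s] Ls z_def by simp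
  have "((\<lambda>x. L (1 - x)) has_field_derivative deriv L (1 - cnj s) * (-1)) (at (cnj s))"
    by (intro DERIV_chain2[OF L_has_derivative]) (auto intro!: derivative_eq_intros)
  from has_field_derivative_cnj_cnj[OF this]
  have M: "((\<lambda>s. cnj (L (1 - cnj s))) has_field_derivative - cnj (deriv L z)) (at s)"
    by (simp add: o_def z_def)
  have P: "((\<lambda>s. fe_factor s * cnj (L (1 - cnj s))) has_field_derivative
      fe_factor s * (- of_real (ln (real q / pi)) - cnj (psi_half z) / 2 - psi_half s / 2) * cnj (L z)
      + - cnj (deriv L z) * fe_factor s) (at s)"
    using DERIV_mult[OF fe_factor_deriv[OF s] M] by (simp add: z_def)
  have "(L has_field_derivative
      fe_factor s * (- of_real (ln (real q / pi)) - cnj (psi_half z) / 2 - psi_half s / 2) * cnj (L z)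
      + - cnj (deriv L z) * fe_factor s) (at s)"
    by (rule has_field_derivative_transform_within_open[OF P open_halfspace_Re_lt[of 1]])
       (use s L_functional_equation in auto)
  then have "deriv L s = fe_factor s * (- of_real (ln (real q / pi)) - cnj (psi_half z) / 2 - psi_half s / 2) * cnj (L z)
      + - cnj (deriv L z) * fe_factor s"
    by (rule DERIV_imp_deriv)
  moreover have "L s = fe_factor s * cnj (L z)" unfolding z_def by (rule L_functional_equation[OF s(1)])
  ultimately have "deriv L s / L s = - of_real (ln (real q / pi)) - cnj (psi_half z) / 2 - psi_half s / 2 - cnj (deriv L z) / cnj (L z)"
    using fe_factor_nonzero[OF s(2)] Lz by (simp add: field_simps)
  then have "Re (deriv L s / L s) = - ln (real q / pi) - Re (psi_half z) / 2 - Re (psi_half s) / 2 - Re (cnj (deriv L z / L z))"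
    by simp
  then have "Re (deriv L s / L s) = - ln (real q / pi) - Re (psi_half z) / 2 - Re (psi_half s) / 2 - Re (deriv L z / L z)"
    by (simp only: complex_cnj_divide[symmetric] cnj.sel)
  then show ?thesis unfolding z_def by linarith
qed

lemma Re_psi_half_ge:
  assumes "Re s \<ge> -1/2" "Im s \<ge> 100"
  shows "Re (psi_half s) \<ge> 19 / 10"
  unfolding psi_half_def by (rule Re_Digamma_ge') (use assms parity_cases in auto)

text \<open>The lower bound at the mirror point uses up its digamma term and half of the logarithm.
  What remains is at most 1/2 - 19/20 + 1/50, by \<open>ln_q_pi_ge\<close> and the digamma
  bound.\<close>

lemma L_logderiv_left:
  assumes s: "-1/2 < Re s" "Re s < 0" "Im s \<ge> 100"
  shows "Re (deriv L s / L s) \<le> - 1 / 4"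
proof -
  have z: "1 < Re (1 - cnj s)" "Re (1 - cnj s) < 3/2" "Im (1 - cnj s) \<ge> 100" using s by auto
  have "L s \<noteq> 0" using L_zero_reflect[of s] L_nonzero_gt_1[OF z(1)] s by simp
  then have "Re (deriv L s / L s) + Re (deriv L (1 - cnj s) / L (1 - cnj s)) =
     - ln (real q / pi) - Re (psi_half s) / 2 - Re (psi_half (1 - cnj s)) / 2"
    by (intro L_logderiv_reflect) (use s in auto)
  moreover note L_logderiv_right[OF z]
  moreover have "Re (psi_half s) \<ge> 19 / 10" by (rule Re_psi_half_ge) (use s in auto)
  moreover note ln_q_pi_ge
  ultimately show ?thesis by simp
qed

lemma L_nonzero_left:
  assumes "-1/2 < Re s" "Re s \<le> 0" "Im s \<noteq> 0"
  shows "L s \<noteq> 0"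
proof -
  have "L (1 - cnj s) \<noteq> 0"
  proof (cases "Re s = 0")
    case True
    then have "1 - cnj s = Complex 1 (Im s)" by (simp add: complex_eq_iff)
    then show ?thesis using L_nonzero_line_1[OF assms(3)] by simp
  next
    case False
    then show ?thesis using L_nonzero_gt_1[of "1 - cnj s"] assms by simp
  qed
  then show ?thesis using L_zero_reflect[of s] assms by simp
qed

lemma continuous_logderiv:
  assumes "L s \<noteq> 0"
  shows "isCont (\<lambda>s. deriv L s / L s) s"
proof (intro isCont_divide assms)
  show "isCont L s" using L_has_derivative DERIV_isCont by blast
  have "deriv L holomorphic_on UNIV" by (intro holomorphic_deriv L_holomorphic open_UNIV)
  then show "isCont (deriv L) s"
    by (meson UNIV_I continuous_on_eq_continuous_at holomorphic_on_imp_continuous_on open_UNIV)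
qed

text \<open>The mirror line Re s = 1 lies outside the range of \<open>L_logderiv_right\<close>, so
  the bound is passed to the limit from the left; the limit exists because L has no zero on this
  line.\<close>

lemma L_logderiv_line_0:
  assumes s: "Re s = 0" "Im s \<ge> 100"
  shows "Re (deriv L s / L s) \<le> - 1 / 4"
proof -
  have "L s \<noteq> 0" by (rule L_nonzero_left) (use s in auto)
  from continuous_logderiv[OF this]
  have c: "((\<lambda>z. deriv L z / L z) \<longlongrightarrow> deriv L s / L s) (at s)" by (simp add: isCont_def)
  define z where "z = (\<lambda>n. s - of_real (1 / real (Suc (Suc (Suc n)))))"
  have "(\<lambda>n. s - of_real (1 / real (Suc (Suc (Suc n))))) \<longlonglongrightarrow> s - of_real 0"
    by (intro tendsto_intros LIMSEQ_Suc[OF LIMSEQ_Suc[OF LIMSEQ_Suc[OF lim_1_over_n]]])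
  then have zl: "z \<longlonglongrightarrow> s" unfolding z_def by simp
  moreover have "z n \<noteq> s" for n
  proof -
    have "1 / real (Suc (Suc (Suc n))) > 0" by simp
    then show ?thesis unfolding z_def by (metis diff_eq_eq less_irrefl add_cancel_right_right of_real_eq_0_iff)
  qed
  ultimately have "filterlim z (at s) sequentially" by (auto simp: filterlim_at)
  from filterlim_compose[OF c this] have "(\<lambda>n. deriv L (z n) / L (z n)) \<longlonglongrightarrow> deriv L s / L s" .
  from tendsto_Re[OF this] have "(\<lambda>n. Re (deriv L (z n) / L (z n))) \<longlonglongrightarrow> Re (deriv L s / L s)" .
  moreover have "Re (deriv L (z n) / L (z n)) \<le> - 1 / 4" for n
    by (rule L_logderiv_left) (use s in \<open>auto simp: z_def field_simps\<close>)
  ultimately show ?thesis using LIMSEQ_le_const2 by blast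
qed

text \<open>The point is its own mirror image, so \<open>L_logderiv_reflect\<close> gives twice the
  wanted real part.\<close>

lemma L_logderiv_critical_line:
  assumes s: "Re s = 1/2" "Im s \<ge> 100" and "L s \<noteq> 0"
  shows "Re (deriv L s / L s) \<le> - 1 / 4"
proof -
  have e: "1 - cnj s = s" using s by (simp add: complex_eq_iff)
  have "Re (deriv L s / L s) + Re (deriv L s / L s) = - ln (real q / pi) - Re (psi_half s) / 2 - Re (psi_half s) / 2"
    using L_logderiv_reflect[of s] assms e by simp
  moreover have "Re (psi_half s) \<ge> 19 / 10" by (rule Re_psi_half_ge) (use s in auto)
  ultimately show ?thesis using ln_q_pi_ge by linarith
qed

lemma L_not_identically_zero: "\<exists>z\<in>S. L z \<noteq> 0" if "open S" "S \<noteq> {}"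
proof (rule ccontr)
  assume "\<not> (\<exists>z\<in>S. L z \<noteq> 0)"
  then have z: "\<And>z. z \<in> S \<Longrightarrow> L z = 0" by blast
  have "L 2 = 0"
    by (rule analytic_continuation_open[of S UNIV L "\<lambda>_. 0"]) (use that z L_holomorphic in auto)
  then show False using L_nonzero_gt_1[of 2] by simp
qed

text \<open>Next to a zero of order \<open>k\<close> on the critical line, \<open>k / (s - \<rho>)\<close> only helps on the left.\<close>

lemma L_logderiv_left_of_critical_line:
  assumes \<rho>: "Re \<rho> = 1/2" "Im \<rho> > 100"
  shows "\<exists>e>0. \<forall>s\<in>ball \<rho> e. Re s < 1/2 \<longrightarrow> L s \<noteq> 0 \<and> Re (deriv L s / L s) < 0"
proof -
  obtain k g r where r: "r > 0" and g: "g holomorphic_on cball \<rho> r" "\<And>w. w \<in> cball \<rho> r \<Longrightarrow> L w = g w * (w - \<rho>) ^ k \<and> g w \<noteq> 0"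
  proof -
    have "\<exists>w\<in>UNIV. L w \<noteq> 0" using L_not_identically_zero[of UNIV] by auto
    from zorder_exist_zero[OF L_holomorphic open_UNIV connected_UNIV UNIV_I this]
    show ?thesis using that by blast
  qed
  have gh: "g holomorphic_on ball \<rho> r" using g(1) holomorphic_on_subset ball_subset_cball by blast
  define h where "h = (\<lambda>w. deriv g w / g w)"
  have hc: "continuous_on (ball \<rho> r) h"
    unfolding h_def using g(2)
    by (intro continuous_intros holomorphic_on_imp_continuous_on[OF holomorphic_deriv[OF gh]]
          holomorphic_on_imp_continuous_on[OF gh]) auto
  have F: "deriv L w / L w = h w + of_nat k / (w - \<rho>)" and Lnz: "L w \<noteq> 0" if w: "w \<in> ball \<rho> r" "w \<noteq> \<rho>" for w
  proof -
    have gd: "(g has_field_derivative deriv g w) (at w)"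
      by (rule holomorphic_derivI[OF gh open_ball w(1)])
    have pd: "((\<lambda>w. (w - \<rho>) ^ k) has_field_derivative of_nat k * (w - \<rho>) ^ (k - 1)) (at w)"
      by (auto intro!: derivative_eq_intros)
    have "(L has_field_derivative deriv g w * (w - \<rho>) ^ k + of_nat k * (w - \<rho>) ^ (k - 1) * g w) (at w)"
      by (rule has_field_derivative_transform_within_open[OF DERIV_mult[OF gd pd] open_ball w(1)]) (use g(2) in auto)
    then have "deriv L w = deriv g w * (w - \<rho>) ^ k + of_nat k * (w - \<rho>) ^ (k - 1) * g w" by (rule DERIV_imp_deriv)
    moreover have Lw: "L w = g w * (w - \<rho>) ^ k" "g w \<noteq> 0" using g(2) w by auto
    moreover have "of_nat k * (w - \<rho>) ^ (k - 1) = of_nat k / (w - \<rho>) * (w - \<rho>) ^ k"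
      using w by (cases k) auto
    ultimately have quot: "deriv L w / L w = (deriv g w * (w - \<rho>) ^ k + of_nat k / (w - \<rho>) * (w - \<rho>) ^ k * g w) / (g w * (w - \<rho>) ^ k)"
      by (simp only:)
    have alg: "(a * P + b * P * c) / (c * P) = a / c + b" if "c \<noteq> 0" "P \<noteq> 0" for a b c P :: complex
      using that by (simp add: field_simps)
    have "(w - \<rho>) ^ k \<noteq> 0" using w by simp
    then show "deriv L w / L w = h w + of_nat k / (w - \<rho>)"
      unfolding h_def by (rule trans[OF quot alg[OF Lw(2)]])
    show "L w \<noteq> 0" using Lw w by simp
  qed
  \<comment> \<open>Points of the critical line tending to \<rho>. There k / (y - \<rho>) is purely
    imaginary, so the bound for L'/L passes to the regular part \<open>h\<close> and, in the limit,
    to \<open>h \<rho>\<close>.\<close>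
  define y where "y = (\<lambda>n. \<rho> + \<i> * of_real (r / 2 / real (Suc n)))"
  have "(\<lambda>n. \<rho> + \<i> * of_real (r / 2 * (1 / real (Suc n)))) \<longlonglongrightarrow> \<rho> + \<i> * of_real (r / 2 * 0)"
    by (intro tendsto_intros LIMSEQ_Suc[OF lim_1_over_n])
  then have yl: "y \<longlonglongrightarrow> \<rho>" unfolding y_def by simp
  have yb: "y n \<in> ball \<rho> r" "y n \<noteq> \<rho>" for n
  proof -
    have "r / 2 / real (Suc n) \<le> r / 2 / 1" using r by (intro divide_left_mono) auto
    also have "\<dots> < r" using r by simp
    finally have "r / 2 / real (Suc n) < r" .
    moreover have dd: "dist \<rho> (y n) = r / 2 / real (Suc n)"
    proof -
      have "dist \<rho> (y n) = norm (\<i> * complex_of_real (r / 2 / real (Suc n)))"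
        unfolding y_def dist_norm by (simp only: diff_add_cancel norm_minus_commute[of \<rho>] add_diff_cancel_left')
      also have "\<dots> = \<bar>r / 2 / real (Suc n)\<bar>" by (simp only: norm_mult norm_of_real norm_ii mult_1)
      finally show ?thesis using r by simp
    qed
    ultimately show "y n \<in> ball \<rho> r" by simp
    have "dist \<rho> (y n) > 0" unfolding dd using r by simp
    then show "y n \<noteq> \<rho>" by auto
  qed
  have "Re (h (y n)) \<le> - 1 / 4" for n
  proof -
    have "Re (deriv L (y n) / L (y n)) \<le> - 1 / 4"
    proof (rule L_logderiv_critical_line)
      show "Re (y n) = 1/2" using \<rho> by (simp add: y_def)
      have "0 \<le> r / 2 / real (Suc n)" using r by simp
      then show "Im (y n) \<ge> 100" using \<rho> unfolding y_def by simp
    qed (rule Lnz[OF yb])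
    moreover have "Re (of_nat k / (y n - \<rho>)) = 0"
      unfolding y_def by (simp add: Re_divide)
    ultimately show ?thesis using F[OF yb, of n] by simp
  qed
  moreover have "(\<lambda>n. Re (h (y n))) \<longlonglongrightarrow> Re (h \<rho>)"
  proof (rule tendsto_Re)
    have "isCont h \<rho>" using hc r by (simp add: continuous_on_eq_continuous_at)
    then show "(\<lambda>n. h (y n)) \<longlonglongrightarrow> h \<rho>" using yl isCont_tendsto_compose by blast
  qed
  ultimately have "Re (h \<rho>) \<le> - 1 / 4" using LIMSEQ_le_const2 by blast
  moreover have "isCont (\<lambda>w. Re (h w)) \<rho>" using hc r by (simp add: continuous_on_eq_continuous_at)
  ultimately obtain e where e: "e > 0" "\<And>w. dist w \<rho> < e \<Longrightarrow> \<bar>Re (h w) - Re (h \<rho>)\<bar> < 1 / 4"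
    unfolding continuous_at_eps_delta dist_real_def by (metis zero_less_divide_1_iff zero_less_numeral)
  have "L s \<noteq> 0 \<and> Re (deriv L s / L s) < 0" if s: "s \<in> ball \<rho> (min e r)" "Re s < 1/2" for s
  proof -
    have s': "s \<in> ball \<rho> r" "s \<noteq> \<rho>" "dist s \<rho> < e" using s \<rho> by (auto simp: dist_commute)
    have "Re (of_nat k / (s - \<rho>)) \<le> 0"
      using s \<rho> by (simp add: Re_divide divide_nonpos_nonneg mult_nonneg_nonpos)
    moreover have "Re (h s) < 0" using e(2)[OF s'(3)] \<open>Re (h \<rho>) \<le> - 1 / 4\<close> by linarith
    ultimately show ?thesis using F[OF s'(1,2)] Lnz[OF s'(1,2)] by simp
  qed
  then show ?thesis using e(1) r by (intro exI[of _ "min e r"]) auto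
qed

text \<open>Compactness makes the previous bound uniform: a rectangle edge can be placed just left of
  the critical line.\<close>

lemma L_right_edge:
  assumes t: "100 < t1" "t1 \<le> t2"
  shows "\<exists>d>0. d < 1/4 \<and> (\<forall>s. 1/2 - d \<le> Re s \<longrightarrow> Re s < 1/2 \<longrightarrow> t1 \<le> Im s \<longrightarrow> Im s \<le> t2 \<longrightarrow>
      L s \<noteq> 0 \<and> Re (deriv L s / L s) < 0)"
proof (rule ccontr)
  assume neg: "\<not> ?thesis"
  \<comment> \<open>The offset 5 keeps the widths below the required 1/4.\<close>
  have "\<exists>s. 1/2 - 1 / real (n + 5) \<le> Re s \<and> Re s < 1/2 \<and> t1 \<le> Im s \<and> Im s \<le> t2 \<and>
      \<not> (L s \<noteq> 0 \<and> Re (deriv L s / L s) < 0)" for n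
  proof -
    have "1 / real (n + 5) > 0" "1 / real (n + 5) < 1/4" by (auto simp: field_simps)
    then show ?thesis using neg by blast
  qed
  then obtain s where s: "\<And>n. 1/2 - 1 / real (n + 5) \<le> Re (s n)" "\<And>n. Re (s n) < 1/2" "\<And>n. t1 \<le> Im (s n)" "\<And>n. Im (s n) \<le> t2"
     "\<And>n. \<not> (L (s n) \<noteq> 0 \<and> Re (deriv L (s n) / L (s n)) < 0)" by metis
  define K where "K = cbox (Complex 0 t1) (Complex (1/2) t2)"
  have "s n \<in> K" for n
  proof -
    have "1 / real (n + 5) \<le> 1 / 2" by (simp add: field_simps)
    then have "0 \<le> Re (s n)" using s(1)[of n] by linarith
    then show ?thesis unfolding K_def in_cbox_complex_iff using s(2-4)[of n] by simp
  qed
  then obtain \<rho> f where f: "\<rho> \<in> K" "strict_mono f" "(s \<circ> f) \<longlonglongrightarrow> \<rho>"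
    using compact_cbox[of "Complex 0 t1" "Complex (1/2) t2"] unfolding compact_def K_def by meson
  have "Re \<rho> = 1/2"
  proof (rule LIMSEQ_unique[OF tendsto_Re[OF f(3)]])
    have "(\<lambda>n. 1 / real (n + 5)) \<longlonglongrightarrow> 0" using LIMSEQ_ignore_initial_segment[OF lim_1_over_n, of 5] by simp
    then have "(\<lambda>n. 1/2 - 1 / real (n + 5)) \<longlonglongrightarrow> 1/2 - 0" by (intro tendsto_diff tendsto_const)
    then have "(\<lambda>n. Re (s n)) \<longlonglongrightarrow> 1/2"
      using tendsto_sandwich[of "\<lambda>n. 1/2 - 1 / real (n + 5)" "\<lambda>n. Re (s n)" sequentially "\<lambda>_. 1/2" "1/2"] s(1,2)
      by (simp add: less_imp_le)
    from LIMSEQ_subseq_LIMSEQ[OF this f(2)] show "(\<lambda>x. Re ((s \<circ> f) x)) \<longlonglongrightarrow> 1/2" by (simp add: o_def)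
  qed
  moreover have "Im \<rho> > 100" using f(1) t unfolding K_def in_cbox_complex_iff by simp
  ultimately obtain e where e: "e > 0" "\<And>s. s \<in> ball \<rho> e \<Longrightarrow> Re s < 1/2 \<Longrightarrow> L s \<noteq> 0 \<and> Re (deriv L s / L s) < 0"
    using L_logderiv_left_of_critical_line by blast
  obtain n where "dist ((s \<circ> f) n) \<rho> < e" using metric_LIMSEQ_D[OF f(3) e(1)] by blast
  then show False using e(2)[of "s (f n)"] s(2,5)[of "f n"] by (simp add: dist_commute)
qed

end

text \<open>The functional equation reflects -1/4 + iT to real part 5/4, where |L| \<ge>
  1/zeta(5/4). The factor (q/\<pi>)^(3/4) is bounded below because q/\<pi> \<ge> 1/2, and the Gamma
  quotient by comparing arguments that differ by 3/4.\<close>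

lemma L_center_lower_bound:
  "\<exists>c>0. \<forall>q chi T. primitive_char q chi \<longrightarrow> T \<ge> 100 \<longrightarrow> c \<le> norm (dirichlet_L chi (Complex (-1/4) T))"
proof -
  define z where "z = norm (dseries (\<lambda>_. 1) (of_real (5/4)))"
  \<comment> \<open>The comparison of Gamma values needs a positive real part, but Re v can be -1/8;
    the arguments are therefore raised by 1. The value 13/8 is the least real part of w = v + 3/4 +
    1, and 7/8 = 13/8 - 3/4.\<close>
  define \<kappa> where "\<kappa> = Gamma (13/8 :: real) / Gamma (7/8)"
  have \<kappa>: "\<kappa> > 0" unfolding \<kappa>_def by (intro divide_pos_pos Gamma_real_pos) auto
  define c where "c = (1/2) powr (3/4) * (\<kappa> / 2) / (z + 1)"
  have z0: "z \<ge> 0" unfolding z_def by simp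
  have "c > 0" unfolding c_def using \<kappa> z0 by (intro divide_pos_pos mult_pos_pos) auto
  moreover have "c \<le> norm (dirichlet_L chi (Complex (-1/4) T))" if p: "primitive_char q chi" and T: "T \<ge> 100" for q chi T
  proof -
    interpret primitive_char q chi by (rule p)
    define s where "s = Complex (-1/4) T"
    define v where "v = (s + of_real parity) / 2"
    define G where "G = norm (Gamma ((1 - s + of_real parity) / 2))"
    have Imv: "Im v \<ge> 50" unfolding v_def s_def using T by simp
    have Gv: "G = norm (Gamma (v + of_real (3/4)))"
    proof -
      have "(1 - s + of_real parity) / 2 = cnj (v + of_real (3/4))"
        unfolding v_def s_def by (simp add: complex_eq_iff field_simps)
      then show ?thesis unfolding G_def by (simp only: cnj_Gamma[symmetric] complex_mod_cnj)
    qed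
    have nv: "v \<notin> \<int>\<^sub>\<le>\<^sub>0" "v + of_real (3/4) \<notin> \<int>\<^sub>\<le>\<^sub>0" "v + 1 \<notin> \<int>\<^sub>\<le>\<^sub>0" using Imv by (auto intro!: non_nonpos_Int_if_Im)
    define w where "w = v + of_real (3/4) + 1"
    have "norm (Gamma (w - of_real (3/4))) \<le> Gamma (13/8 - 3/4) / Gamma (13/8) * norm (Gamma w)"
      by (rule norm_Gamma_ratio_half_plane) (use parity_cases in \<open>auto simp: w_def v_def s_def field_simps\<close>)
    moreover have "w - of_real (3/4) = v + 1" unfolding w_def by simp
    moreover have "Gamma (13/8 - 3/4 :: real) = Gamma (7/8)" by simp
    ultimately have "norm (Gamma (v + 1)) \<le> Gamma (7/8) / Gamma (13/8) * norm (Gamma w)" by (simp only:)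
    then have "\<kappa> * norm (Gamma (v + 1)) \<le> norm (Gamma w)"
      unfolding \<kappa>_def using Gamma_real_pos[of "7/8"] Gamma_real_pos[of "13/8"] by (simp add: field_simps)
    moreover have "Gamma w = (v + of_real (3/4)) * Gamma (v + of_real (3/4))" unfolding w_def by (rule Gamma_plus1[OF nv(2)])
    moreover have "Gamma (v + 1) = v * Gamma v" by (rule Gamma_plus1[OF nv(1)])
    ultimately have 1: "\<kappa> * (norm v * norm (Gamma v)) \<le> norm (v + of_real (3/4)) * G"
      unfolding Gv by (simp add: norm_mult)
    have "norm v \<ge> 50" using Imv abs_Im_le_cmod[of v] by linarith
    moreover have "norm (v + of_real (3/4)) \<le> norm v + 3/4" using norm_triangle_ineq[of v "of_real (3/4)"] by simp
    ultimately have "norm (v + of_real (3/4)) \<le> 2 * norm v" by linarith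
    then have "norm (v + of_real (3/4)) * G \<le> 2 * norm v * G" by (intro mult_right_mono) (auto simp: G_def)
    with 1 have "norm v * (\<kappa> * norm (Gamma v)) \<le> norm v * (2 * G)" by (simp add: mult_ac)
    then have 2: "\<kappa> * norm (Gamma v) \<le> 2 * G" using \<open>norm v \<ge> 50\<close> by (subst (asm) mult_le_cancel_left_pos) auto
    have inv: "norm (Gamma v) * norm (rGamma v) = 1"
      using nv by (simp add: rGamma_inverse_Gamma norm_inverse Gamma_eq_zero_iff)
    have "\<kappa> * norm (Gamma v) * norm (rGamma v) \<le> 2 * G * norm (rGamma v)"
      using 2 by (intro mult_right_mono) auto
    then have "\<kappa> \<le> 2 * (G * norm (rGamma v))" using inv by (simp only: mult.assoc mult_1_right)
    then have 3: "\<kappa> / 2 \<le> G * norm (rGamma v)" by simp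
    have q1: "1 / 2 \<le> real q / pi" using q_gt_1 pi_less_4 by (simp add: field_simps)
    have "(pi / real q) powr (Re s - 1/2) = inverse (real q / pi) powr (- (3/4))" by (simp add: s_def)
    also have "\<dots> = (real q / pi) powr (3/4)" by (simp only: inverse_powr powr_minus inverse_inverse_eq)
    finally have "(1/2) powr (3/4) \<le> (pi / real q) powr (Re s - 1/2)"
      using q1 by (simp add: powr_mono2)
    then have "(1/2) powr (3/4) * (\<kappa> / 2) \<le> norm (fe_factor s)"
      unfolding norm_fe_factor G_def[symmetric] v_def[symmetric] using 3 \<kappa> by (intro mult_mono) auto
    moreover have "1 / (z + 1) \<le> norm (dirichlet_L chi (1 - cnj s))"
    proof -
      have r: "Re (1 - cnj s) = 5/4" by (simp add: s_def)
      have "1 \<le> norm (dseries (\<lambda>n. chi (int n)) (1 - cnj s)) * norm (dseries (\<lambda>_. 1) (of_real (Re (1 - cnj s))))"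
        by (rule coef.dseries_lower_bound) (simp add: s_def)
      moreover have "dirichlet_L chi (1 - cnj s) = dseries (\<lambda>n. chi (int n)) (1 - cnj s)"
        by (rule L_eq_dseries) (simp add: s_def)
      ultimately have "1 \<le> norm (dirichlet_L chi (1 - cnj s)) * z"
        unfolding r z_def by (simp only:)
      also have "\<dots> \<le> norm (dirichlet_L chi (1 - cnj s)) * (z + 1)" by (intro mult_left_mono) auto
      finally show ?thesis using z0 by (simp add: field_simps)
    qed
    ultimately have "(1/2) powr (3/4) * (\<kappa> / 2) * (1 / (z + 1)) \<le> norm (fe_factor s) * norm (dirichlet_L chi (1 - cnj s))"
      using \<kappa> z0 by (intro mult_mono) auto
    also have "\<dots> = norm (dirichlet_L chi s)"
      using L_functional_equation[of s] by (simp add: s_def norm_mult)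
    finally show ?thesis unfolding c_def s_def by simp
  qed
  ultimately show ?thesis by blast
qed

section \<open>Zero counting by Jensen's formula and the argument principle\<close>

lemma entire_factor:
  assumes f: "f holomorphic_on UNIV" "\<exists>w. f w \<noteq> 0"
  shows "\<exists>g. g holomorphic_on UNIV \<and> (\<forall>w. f w = (w - z) ^ nat (zorder f z) * g w) \<and> g z \<noteq> 0"
proof -
  define k where "k = nat (zorder f z)"
  have "\<exists>w\<in>UNIV. f w \<noteq> 0" using f(2) by simp
  from zorder_exist_zero[OF f(1) open_UNIV connected_UNIV UNIV_I this]
  obtain r where r: "r > 0" "zor_poly f z holomorphic_on cball z r"
    "\<And>w. w \<in> cball z r \<Longrightarrow> f w = zor_poly f z w * (w - z) ^ k \<and> zor_poly f z w \<noteq> 0"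
    unfolding k_def by blast
  define g where "g = (\<lambda>w. if w = z then zor_poly f z z else f w / (w - z) ^ k)"
  have "g holomorphic_on (ball z r) \<union> (- {z})"
  proof (rule holomorphic_on_Un)
    have "zor_poly f z holomorphic_on ball z r" using r(2) holomorphic_on_subset ball_subset_cball by blast
    then show "g holomorphic_on ball z r"
      by (rule holomorphic_transform) (use r(3) in \<open>auto simp: g_def\<close>)
    have "(\<lambda>w. f w / (w - z) ^ k) holomorphic_on (- {z})"
      by (intro holomorphic_intros holomorphic_on_subset[OF f(1)]) auto
    then show "g holomorphic_on (- {z})" by (rule holomorphic_transform) (simp add: g_def)
  qed auto
  moreover have "ball z r \<union> (- {z}) = UNIV" using r(1) by auto
  moreover have "f w = (w - z) ^ k * g w" for w
    using r(1) r(3)[of z] by (cases "w = z") (auto simp: g_def mult.commute)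
  moreover have "g z \<noteq> 0" using r(1) r(3)[of z] by (simp add: g_def)
  ultimately show ?thesis unfolding k_def by auto
qed

lemma zorder_mult_nonzero:
  assumes p: "p holomorphic_on UNIV" "p z \<noteq> 0" and g: "g holomorphic_on UNIV" "\<exists>w. g w \<noteq> 0"
  shows "zorder (\<lambda>w. p w * g w) z = zorder g z"
proof -
  have "\<exists>w\<in>UNIV. g w \<noteq> 0" using g(2) by simp
  from zorder_exist_zero[OF g(1) open_UNIV connected_UNIV UNIV_I this]
  obtain r where r: "r > 0" "zor_poly g z holomorphic_on cball z r"
    "\<And>w. w \<in> cball z r \<Longrightarrow> g w = zor_poly g z w * (w - z) ^ nat (zorder g z) \<and> zor_poly g z w \<noteq> 0"
    and n: "zorder g z \<ge> 0"
    by (smt (verit, best))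
  show ?thesis
  proof (rule zorder_eqI[of "ball z r" z "\<lambda>w. p w * zor_poly g z w"])
    show "(\<lambda>w. p w * zor_poly g z w) holomorphic_on ball z r"
      by (intro holomorphic_on_mult holomorphic_on_subset[OF p(1)] holomorphic_on_subset[OF r(2)]) auto
    show "p z * zor_poly g z z \<noteq> 0" using p(2) r(1) r(3)[of z] by simp
    show "p w * g w = p w * zor_poly g z w * (w - z) powi zorder g z" if "w \<in> ball z r" "w \<noteq> z" for w
      using r(3)[of w] that n by (simp add: power_int_def)
  qed (use r(1) in auto)
qed

text \<open>Zeros are divided out one at a time; a factor that does not vanish at x leaves the order
  at x unchanged.\<close>

lemma entire_factor_finite:
  assumes f: "f holomorphic_on UNIV" "\<exists>w. f w \<noteq> 0" and Z: "finite Z"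
  shows "\<exists>g. g holomorphic_on UNIV \<and> (\<forall>w. f w = (\<Prod>z\<in>Z. (w - z) ^ nat (zorder f z)) * g w)"
  using Z
proof (induction Z rule: finite_induct)
  case empty
  then show ?case using f by (intro exI[of _ f]) auto
next
  case (insert x Z)
  then obtain g where g: "g holomorphic_on UNIV" "\<And>w. f w = (\<Prod>z\<in>Z. (w - z) ^ nat (zorder f z)) * g w" by blast
  define p where "p = (\<lambda>w. \<Prod>z\<in>Z. (w - z) ^ nat (zorder f z))"
  have gn: "\<exists>w. g w \<noteq> 0" using f(2) g(2) by (metis mult_zero_right)
  have fpg: "f = (\<lambda>w. p w * g w)" using g(2) p_def by (simp add: fun_eq_iff)
  have ph: "p holomorphic_on UNIV" unfolding p_def by (intro holomorphic_intros)
  have px: "p x \<noteq> 0" unfolding p_def using insert.hyps by auto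
  have "zorder f x = zorder g x" unfolding fpg by (rule zorder_mult_nonzero[OF ph px g(1) gn])
  moreover obtain h where h: "h holomorphic_on UNIV" "\<And>w. g w = (w - x) ^ nat (zorder g x) * h w"
    using entire_factor[OF g(1) gn] by blast
  ultimately have "f w = (\<Prod>z\<in>insert x Z. (w - z) ^ nat (zorder f z)) * h w" for w
    using insert.hyps g(2)[of w] by (simp add: mult_ac)
  then show ?case using h(1) by blast
qed

text \<open>A coarse form of Jensen's formula: divide f by the product of (w - z)^order. On the
  circle of radius 3r each linear factor is at least 2r, at the centre at most r, so the maximum
  principle gains a factor 2 for each zero, counted with multiplicity.\<close>

lemma jensen_finite:
  assumes f: "f holomorphic_on UNIV" "f s0 \<noteq> 0" and r: "r > 0"
    and M: "\<And>w. dist s0 w = 3 * r \<Longrightarrow> norm (f w) \<le> M"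
    and Z: "finite Z" "Z \<subseteq> cball s0 r"
  shows "norm (f s0) * 2 ^ (\<Sum>z\<in>Z. nat (zorder f z)) \<le> M"
proof -
  define K where "K = (\<Sum>z\<in>Z. nat (zorder f z))"
  define p where "p = (\<lambda>w. \<Prod>z\<in>Z. (w - z) ^ nat (zorder f z))"
  obtain g where g: "g holomorphic_on UNIV" "\<And>w. f w = p w * g w"
    using entire_factor_finite[OF f(1) _ Z(1)] f(2) unfolding p_def by blast
  have pn: "norm (p w) = (\<Prod>z\<in>Z. norm (w - z) ^ nat (zorder f z))" for w
    unfolding p_def by (simp add: prod_norm[symmetric] norm_power)
  have "norm (g s0) \<le> M / (2 * r) ^ K"
  proof (rule maximum_modulus_frontier[of g "ball s0 (3 * r)"])
    show "g holomorphic_on interior (ball s0 (3 * r))" using g(1) by (rule holomorphic_on_subset) simp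
    show "continuous_on (closure (ball s0 (3 * r))) g"
      using holomorphic_on_imp_continuous_on[OF g(1)] continuous_on_subset by blast
    fix w assume "w \<in> frontier (ball s0 (3 * r))"
    then have w: "dist s0 w = 3 * r" using r by (simp add: frontier_ball)
    have "(2 * r) ^ K = (\<Prod>z\<in>Z. (2 * r) ^ nat (zorder f z))" unfolding K_def by (simp add: power_sum)
    also have "\<dots> \<le> norm (p w)"
      unfolding pn
    proof (intro prod_mono conjI power_mono)
      fix z assume "z \<in> Z"
      then have "dist s0 z \<le> r" using Z(2) by auto
      then show "2 * r \<le> norm (w - z)" using w dist_triangle[of s0 w z] by (simp add: dist_norm norm_minus_commute)
    qed (use r in auto)
    finally have "(2 * r) ^ K * norm (g w) \<le> norm (p w) * norm (g w)" by (intro mult_right_mono) auto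
    also have "\<dots> \<le> M" using M[OF w] g(2)[of w] by (simp add: norm_mult)
    finally show "norm (g w) \<le> M / (2 * r) ^ K" using r by (simp add: field_simps)
  qed (use r in auto)
  moreover have "norm (p s0) \<le> r ^ K"
  proof -
    have "norm (p s0) \<le> (\<Prod>z\<in>Z. r ^ nat (zorder f z))"
      unfolding pn using Z(2) by (intro prod_mono conjI power_mono) (auto simp: dist_norm)
    then show ?thesis unfolding K_def by (simp add: power_sum)
  qed
  ultimately have "norm (p s0) * norm (g s0) \<le> r ^ K * (M / (2 * r) ^ K)"
    using r by (intro mult_mono) auto
  then have "norm (f s0) \<le> M / 2 ^ K" using g(2)[of s0] r by (simp add: norm_mult power_mult_distrib)
  then show ?thesis unfolding K_def by (simp add: field_simps)
qed

lemma zorder_pos: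
  assumes "f holomorphic_on UNIV" "\<exists>w. f w \<noteq> 0" "f z = 0"
  shows "zorder f z > 0"
proof -
  have "\<exists>w\<in>UNIV. f w \<noteq> 0" using assms by simp
  from zorder_exist_zero[OF assms(1) open_UNIV connected_UNIV UNIV_I this] show ?thesis using assms(3) by simp
qed

lemma jensen_zero_count:
  assumes f: "f holomorphic_on UNIV" "f s0 \<noteq> 0" and r: "r > 0"
    and M: "\<And>w. dist s0 w = 3 * r \<Longrightarrow> norm (f w) \<le> M"
    and S: "S \<subseteq> cball s0 r"
  shows "finite {z. z \<in> S \<and> f z = 0}" "0 \<le> zero_count f S"
    "real (card {z. z \<in> S \<and> f z = 0}) \<le> real_of_int (zero_count f S)"
    "real_of_int (zero_count f S) \<le> 2 * ln (M / norm (f s0))"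
proof -
  have fn: "\<exists>w. f w \<noteq> 0" using f(2) by blast
  have pos: "zorder f z \<ge> 1" if "f z = 0" for z using zorder_pos[OF f(1) fn that] by simp
  have key: "real (\<Sum>z\<in>Z. nat (zorder f z)) \<le> 2 * ln (M / norm (f s0))" if Z: "finite Z" "Z \<subseteq> cball s0 r" for Z
  proof -
    define K where "K = (\<Sum>z\<in>Z. nat (zorder f z))"
    have "2 ^ K \<le> M / norm (f s0)"
      using jensen_finite[OF f r M Z] f(2) unfolding K_def by (simp add: field_simps)
    then have "ln (2 ^ K) \<le> ln (M / norm (f s0))"
      by (intro ln_mono) (auto intro: less_le_trans[of 0 "2 ^ K"])
    then have "real K * ln 2 \<le> ln (M / norm (f s0))" by (simp add: ln_realpow)
    \<comment> \<open>Estimating ln 2 below by 1/2 gives the constant 2 of the conclusion.\<close>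
    moreover have "real K * (1 / 2) \<le> real K * ln 2"
      using ln2_ge_two_thirds by (intro mult_left_mono) auto
    ultimately show ?thesis unfolding K_def by simp
  qed
  let ?Z = "{z. z \<in> S \<and> f z = 0}"
  have cardle: "card Z \<le> (\<Sum>z\<in>Z. nat (zorder f z))" if "finite Z" "Z \<subseteq> ?Z" for Z
  proof -
    have "card Z = (\<Sum>z\<in>Z. 1)" by simp
    also have "\<dots> \<le> (\<Sum>z\<in>Z. nat (zorder f z))" by (intro sum_mono) (use that pos in force)
    finally show ?thesis .
  qed
  show fin: "finite ?Z"
  \<comment> \<open>The same estimate bounds the size of every finite set of zeros in S, which makes
    the set of zeros finite.\<close>
  proof (rule conjunct1[OF finite_if_finite_subsets_card_bdd[of _ "nat \<lceil>2 * ln (M / norm (f s0))\<rceil>"]])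
    fix G assume G: "G \<subseteq> ?Z" "finite G"
    then have "G \<subseteq> cball s0 r" using S by blast
    from key[OF G(2) this] cardle[OF G(2,1)] show "card G \<le> nat \<lceil>2 * ln (M / norm (f s0))\<rceil>" by linarith
  qed
  have eq: "real_of_int (zero_count f S) = real (\<Sum>z\<in>?Z. nat (zorder f z))"
  proof -
    have "zero_count f S = (\<Sum>z\<in>?Z. int (nat (zorder f z)))"
      unfolding zero_count_def by (intro sum.cong refl) (use pos in force)
    then show ?thesis by (simp only: of_int_sum of_int_of_nat_eq of_nat_sum)
  qed
  show "real_of_int (zero_count f S) \<le> 2 * ln (M / norm (f s0))"
    unfolding eq by (rule key[OF fin]) (use S in auto)
  show "real (card ?Z) \<le> real_of_int (zero_count f S)"
    unfolding eq of_nat_le_iff by (rule cardle[OF fin]) simp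
  then show "0 \<le> zero_count f S" using of_nat_0_le_iff order_trans of_int_0_le_iff by metis
qed

lemma finite_zeros_bounded:
  assumes f: "f holomorphic_on UNIV" "\<exists>w. f w \<noteq> 0" and S: "bounded S"
  shows "finite {z. z \<in> S \<and> f z = 0}"
proof -
  obtain s0 where s0: "f s0 \<noteq> 0" using f(2) by blast
  obtain B where B: "S \<subseteq> ball s0 B" using bounded_subset_ballD[OF S] by blast
  define r where "r = max B 1"
  have r: "r > 0" "S \<subseteq> cball s0 r" using B unfolding r_def by auto
  have "compact (f ` sphere s0 (3 * r))"
    by (intro compact_continuous_image compact_sphere continuous_on_subset[OF holomorphic_on_imp_continuous_on[OF f(1)]]) auto
  then obtain M where "\<forall>y\<in>f ` sphere s0 (3 * r). norm y \<le> M"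
    using compact_imp_bounded bounded_iff by metis
  then have M: "\<And>w. w \<in> sphere s0 (3 * r) \<Longrightarrow> norm (f w) \<le> M" by blast
  have "norm (f w) \<le> M" if "dist s0 w = 3 * r" for w using M[of w] that by simp
  then show ?thesis by (rule jensen_zero_count(1)[OF f(1) s0 r(1) _ r(2)])
qed

section \<open>Counting in rectangles by the argument principle\<close>

lemma zero_count_Un:
  assumes "finite {z. z \<in> A \<union> B \<and> f z = 0}" "A \<inter> B = {}"
  shows "zero_count f (A \<union> B) = zero_count f A + zero_count f B"
proof -
  have e: "{z. z \<in> A \<union> B \<and> f z = 0} = {z. z \<in> A \<and> f z = 0} \<union> {z. z \<in> B \<and> f z = 0}" by auto
  show ?thesis unfolding zero_count_def e
    by (rule sum.union_disjoint) (use assms e in \<open>auto dest: finite_subset\<close>)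
qed

text \<open>Zeros inside have winding number 1, those outside 0, and none lie on the boundary. A
  ball around the rectangle serves as domain, so that only finitely many zeros occur in the
  sum.\<close>

lemma zero_count_box:
  assumes f: "f holomorphic_on UNIV" "\<exists>w. f w \<noteq> 0" and ab: "Re a < Re b" "Im a < Im b"
    and nz: "\<And>z. z \<in> path_image (rectpath a b) \<Longrightarrow> f z \<noteq> 0"
  shows "contour_integral (rectpath a b) (\<lambda>z. deriv f z / f z) = 2 * of_real pi * \<i> * of_int (zero_count f (box a b))"
proof -
  have "bounded (cbox a b)" by (rule bounded_cbox)
  then obtain R where R: "cbox a b \<subseteq> ball 0 R" using bounded_subset_ballD by blast
  have sub: "path_image (rectpath a b) \<subseteq> cbox a b" using ab by (intro path_image_rectpath_subset_cbox) auto
  let ?Z = "{w \<in> ball 0 R. f w = 0 \<or> w \<in> {}}"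
  have fin: "finite ?Z" using finite_zeros_bounded[OF f bounded_ball[of 0 R]] by simp
  have "contour_integral (rectpath a b) (\<lambda>x. deriv f x * 1 / f x) =
      2 * pi * \<i> * (\<Sum>p\<in>?Z. winding_number (rectpath a b) p * 1 * zorder f p)"
  proof (rule argument_principle[of "ball 0 R" f "{}" "\<lambda>_. 1"])
    show "f holomorphic_on ball 0 R - {}" using f(1) by (rule holomorphic_on_subset) simp
    show "path_image (rectpath a b) \<subseteq> ball 0 R - ?Z" using sub R nz by auto
    show "\<forall>z. z \<notin> ball 0 R \<longrightarrow> winding_number (rectpath a b) z = 0"
      using R ab by (intro allI impI winding_number_rectpath_outside) auto
  qed (use fin in auto)
  also have "(\<Sum>p\<in>?Z. winding_number (rectpath a b) p * 1 * zorder f p) = (\<Sum>p | p \<in> box a b \<and> f p = 0. of_int (zorder f p))"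
  proof (rule sum.mono_neutral_cong_right[OF fin])
    show "{p. p \<in> box a b \<and> f p = 0} \<subseteq> ?Z" using R box_subset_cbox[of a b] by auto
    show "\<forall>p\<in>?Z - {p. p \<in> box a b \<and> f p = 0}. winding_number (rectpath a b) p * 1 * of_int (zorder f p) = 0"
    proof
      fix p assume p: "p \<in> ?Z - {p. p \<in> box a b \<and> f p = 0}"
      then have "p \<notin> box a b" "f p = 0" by auto
      then have "p \<notin> cbox a b"
        using nz[of p] path_image_rectpath_cbox_minus_box[of a b] ab by auto
      then have "winding_number (rectpath a b) p = 0" using ab by (intro winding_number_rectpath_outside) auto
      then show "winding_number (rectpath a b) p * 1 * of_int (zorder f p) = 0" by simp
    qed
    show "winding_number (rectpath a b) p * 1 * of_int (zorder f p) = of_int (zorder f p)"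
      if "p \<in> {p. p \<in> box a b \<and> f p = 0}" for p
      using that winding_number_rectpath[of p a b] by simp
  qed
  finally show ?thesis unfolding zero_count_def by simp
qed

text \<open>On the segment Ln F or Ln (-F) is a primitive of F'/F, with imaginary part between
  -\<pi>/2 and \<pi>/2. The closed half-plane is allowed: a nonzero value with nonnegative real part
  never meets the branch cut.\<close>

lemma arg_variation_half_plane:
  assumes A: "open A" "F holomorphic_on A" "\<And>z. z \<in> A \<Longrightarrow> F z \<noteq> 0" and seg: "closed_segment a b \<subseteq> A"
    and Re: "(\<forall>z\<in>closed_segment a b. Re (F z) \<ge> 0) \<or> (\<forall>z\<in>closed_segment a b. Re (F z) \<le> 0)"
  shows "\<bar>Im (contour_integral (linepath a b) (\<lambda>z. deriv F z / F z))\<bar> \<le> pi"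
proof -
  have main: "\<bar>Im (contour_integral (linepath a b) (\<lambda>z. deriv F z / F z))\<bar> \<le> pi"
    if k: "k = 1 \<or> k = -1" and pos: "\<And>z. z \<in> closed_segment a b \<Longrightarrow> Re (k * F z) \<ge> 0" for k :: complex
  proof -
    have kF: "k * F z \<noteq> 0" if "z \<in> A" for z using A(3)[OF that] k by auto
    have der: "((\<lambda>z. Ln (k * F z)) has_field_derivative deriv F z / F z) (at z within closed_segment a b)"
      if z: "z \<in> closed_segment a b" for z
    proof -
      have zA: "z \<in> A" using z seg by blast
      have "k * F z \<notin> \<real>\<^sub>\<le>\<^sub>0"
        using pos[OF z] kF[OF zA] by (auto simp: complex_nonpos_Reals_iff complex_eq_iff)
      moreover have "(F has_field_derivative deriv F z) (at z)" by (rule holomorphic_derivI[OF A(2,1) zA])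
      ultimately have "((\<lambda>z. Ln (k * F z)) has_field_derivative inverse (k * F z) * (k * deriv F z)) (at z)"
        by (intro DERIV_chain2[OF has_field_derivative_Ln] DERIV_cmult)
      moreover have "inverse (k * F z) * (k * deriv F z) = deriv F z / F z"
        using k A(3)[OF zA] by (auto simp: field_simps)
      ultimately show ?thesis using has_field_derivative_at_within by metis
    qed
    have "((\<lambda>z. deriv F z / F z) has_contour_integral (Ln (k * F b) - Ln (k * F a))) (linepath a b)"
      using contour_integral_primitive[OF der valid_path_linepath, of a b] by simp
    then have "contour_integral (linepath a b) (\<lambda>z. deriv F z / F z) = Ln (k * F b) - Ln (k * F a)"
      by (rule contour_integral_unique)
    moreover have "\<bar>Im (Ln (k * F z))\<bar> \<le> pi / 2" if "z \<in> closed_segment a b" for z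
      using Re_Ln_pos_le[of "k * F z"] kF[of z] pos[OF that] that seg by blast
    from this[of a] this[of b] have "\<bar>Im (Ln (k * F a))\<bar> \<le> pi / 2" "\<bar>Im (Ln (k * F b))\<bar> \<le> pi / 2" by auto
    ultimately show ?thesis by simp
  qed
  from Re show ?thesis
  proof
    assume "\<forall>z\<in>closed_segment a b. Re (F z) \<ge> 0"
    then show ?thesis by (intro main[of 1]) auto
  next
    assume "\<forall>z\<in>closed_segment a b. Re (F z) \<le> 0"
    then show ?thesis by (intro main[of "-1"]) auto
  qed
qed

text \<open>Backlund's trick: between consecutive zeros of the real part the argument changes by at most
  \<open>\<pi>\<close>.\<close>

lemma arg_variation_horizontal:
  assumes A: "open A" "F holomorphic_on A" "\<And>z. z \<in> A \<Longrightarrow> F z \<noteq> 0"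
    and seg: "\<And>x. a \<le> x \<Longrightarrow> x \<le> b \<Longrightarrow> Complex x t \<in> A" and ab: "a \<le> b"
    and fin: "finite {x. a < x \<and> x < b \<and> Re (F (Complex x t)) = 0}"
  shows "\<bar>Im (contour_integral (linepath (Complex a t) (Complex b t)) (\<lambda>z. deriv F z / F z))\<bar>
     \<le> (real (card {x. a < x \<and> x < b \<and> Re (F (Complex x t)) = 0}) + 1) * pi"
proof -
  define P where "P = (\<lambda>x. Re (F (Complex x t)))"
  define J where "J = (\<lambda>a b. contour_integral (linepath (Complex a t) (Complex b t)) (\<lambda>z. deriv F z / F z))"
  have segm: "closed_segment (Complex u t) (Complex v t) \<subseteq> A" if "a \<le> u" "u \<le> v" "v \<le> b" for u v
  proof
    fix z assume "z \<in> closed_segment (Complex u t) (Complex v t)"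
    then have "Im z = t" "u \<le> Re z" "Re z \<le> v"
      using that by (auto simp: closed_segment_same_Im closed_segment_eq_real_ivl split: if_splits)
    then show "z \<in> A" using seg[of "Re z"] that by (metis complex_surj order_trans)
  qed
  have Pc: "continuous_on {a..b} P"
  proof -
    have "continuous_on {a..b} (\<lambda>x. F (Complex x t))"
      by (rule continuous_on_compose2[OF holomorphic_on_imp_continuous_on[OF A(2)]])
         (use seg in \<open>auto intro!: continuous_intros simp: Complex_eq\<close>)
    then show ?thesis unfolding P_def by (rule continuous_on_Re)
  qed
  have "\<bar>Im (J u v)\<bar> \<le> (real (card {x. u < x \<and> x < v \<and> P x = 0}) + 1) * pi"
    if uv: "a \<le> u" "u \<le> v" "v \<le> b" for u v
    using uv
  proof (induction "card {x. u < x \<and> x < v \<and> P x = 0}" arbitrary: u v rule: less_induct)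
    case (less u v)
    let ?Z = "\<lambda>u v. {x. u < x \<and> x < v \<and> P x = 0}"
    have finZ: "finite (?Z u' v')" if "a \<le> u'" "v' \<le> b" for u' v'
      by (rule finite_subset[OF _ fin]) (use that in \<open>auto simp: P_def\<close>)
    show ?case
    proof (cases "?Z u v = {}")
      case True
      have sign: "(\<forall>x\<in>{u<..<v}. P x \<ge> 0) \<or> (\<forall>x\<in>{u<..<v}. P x \<le> 0)"
      proof (rule ccontr)
        assume "\<not> ?thesis"
        then obtain x y where xy: "x \<in> {u<..<v}" "y \<in> {u<..<v}" "P x < 0" "P y > 0" by (auto simp: not_le)
        have c: "continuous_on {min x y..max x y} P"
          by (rule continuous_on_subset[OF Pc]) (use xy less.prems in auto)
        have "\<exists>z. min x y \<le> z \<and> z \<le> max x y \<and> P z = 0"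
        proof (cases "x \<le> y")
          case True
          then show ?thesis using IVT'[of P x 0 y] c xy by (auto simp: min_def max_def)
        next
          case False
          then show ?thesis using IVT2'[of P x 0 y] c xy by (auto simp: min_def max_def)
        qed
        then obtain z where "min x y \<le> z" "z \<le> max x y" "P z = 0" by blast
        then have "z \<in> ?Z u v" using xy by auto
        then show False using True by blast
      qed
      show ?thesis
      proof (cases "u = v")
        case True
        then have "J u v = 0" unfolding J_def by simp
        then show ?thesis by (simp add: mult_nonneg_nonneg)
      next
        case False
        then have cl: "closure {u<..<v} = {u..v}" using less.prems by simp
        have Pc': "continuous_on (closure {u<..<v}) P"
          unfolding cl by (rule continuous_on_subset[OF Pc]) (use less.prems in auto)
        have "(\<forall>x\<in>{u..v}. P x \<ge> 0) \<or> (\<forall>x\<in>{u..v}. P x \<le> 0)"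
          using sign
        proof
          assume "\<forall>x\<in>{u<..<v}. P x \<ge> 0"
          then have "P x \<ge> 0" if "x \<in> {u..v}" for x
            using continuous_ge_on_closure[OF Pc', of x 0] that cl by simp
          then show ?thesis by blast
        next
          assume "\<forall>x\<in>{u<..<v}. P x \<le> 0"
          then have "P x \<le> 0" if "x \<in> {u..v}" for x
            using continuous_le_on_closure[OF Pc', of x 0] that cl by simp
          then show ?thesis by blast
        qed
        moreover have "Re (F z) = P (Re z) \<and> Re z \<in> {u..v}" if "z \<in> closed_segment (Complex u t) (Complex v t)" for z
        proof -
          have "Im z = t" "u \<le> Re z" "Re z \<le> v"
            using that less.prems by (auto simp: closed_segment_same_Im closed_segment_eq_real_ivl split: if_splits)
          then show ?thesis unfolding P_def by (metis atLeastAtMost_iff complex_surj)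
        qed
        ultimately have "(\<forall>z\<in>closed_segment (Complex u t) (Complex v t). Re (F z) \<ge> 0) \<or>
            (\<forall>z\<in>closed_segment (Complex u t) (Complex v t). Re (F z) \<le> 0)" by metis
        then have "\<bar>Im (J u v)\<bar> \<le> pi"
          unfolding J_def using arg_variation_half_plane[OF A segm[OF less.prems]] by blast
        then show ?thesis unfolding True by simp
      qed
    next
      case False
      then obtain x where x: "u < x" "x < v" "P x = 0" by blast
      \<comment> \<open>Splitting at a zero x removes x from the count, which pays for the extra
        summand: (n1 + 1) + (n2 + 1) \<le> n + 1.\<close>
      have c1: "card (?Z u x) + card (?Z x v) + 1 \<le> card (?Z u v)"
      proof -
        have "card (insert x (?Z u x \<union> ?Z x v)) \<le> card (?Z u v)"
          using finZ[OF less.prems(1,3)] x by (intro card_mono) auto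
        moreover have "card (insert x (?Z u x \<union> ?Z x v)) = Suc (card (?Z u x \<union> ?Z x v))"
          using finZ[of u x] finZ[of x v] less.prems x by (intro card_insert_disjoint) auto
        moreover have "card (?Z u x \<union> ?Z x v) = card (?Z u x) + card (?Z x v)"
          using finZ[of u x] finZ[of x v] less.prems x by (intro card_Un_disjoint) auto
        ultimately show ?thesis by simp
      qed
      have "\<bar>Im (J u x)\<bar> \<le> (real (card (?Z u x)) + 1) * pi"
        by (rule less.hyps) (use c1 x less.prems in auto)
      moreover have "\<bar>Im (J x v)\<bar> \<le> (real (card (?Z x v)) + 1) * pi"
        by (rule less.hyps) (use c1 x less.prems in auto)
      moreover have "J u v = J u x + J x v"
        unfolding J_def
      proof (rule contour_integral_split_linepath)
        show "continuous_on (closed_segment (Complex u t) (Complex v t)) (\<lambda>z. deriv F z / F z)"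
          using segm[OF less.prems] A(3)
          by (intro continuous_intros continuous_on_subset[OF holomorphic_on_imp_continuous_on[OF holomorphic_deriv[OF A(2,1)]]]
             continuous_on_subset[OF holomorphic_on_imp_continuous_on[OF A(2)]]) auto
        show "Complex x t \<in> closed_segment (Complex u t) (Complex v t)"
          using x by (auto simp: closed_segment_same_Im closed_segment_eq_real_ivl)
      qed
      ultimately have "\<bar>Im (J u v)\<bar> \<le> (real (card (?Z u x)) + 1) * pi + (real (card (?Z x v)) + 1) * pi" by simp
      also have "\<dots> = real (card (?Z u x) + card (?Z x v) + 1 + 1) * pi" by (simp add: algebra_simps)
      also have "\<dots> \<le> real (card (?Z u v) + 1) * pi"
        using c1 by (intro mult_right_mono) (auto simp del: of_nat_add)
      finally show ?thesis by (simp only: of_nat_add of_nat_1)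
    qed
  qed
  from this[OF order_refl ab order_refl] show ?thesis unfolding J_def P_def .
qed

text \<open>Argument principle for \<open>F = f' / f\<close>: the left and right edges contribute at most \<open>\<pi>\<close> each.\<close>

lemma zero_count_deriv_compare:
  assumes f: "f holomorphic_on UNIV" and ab: "Re a < Re b" "Im a < Im b"
    and nz: "\<And>z. z \<in> path_image (rectpath a b) \<Longrightarrow> f z \<noteq> 0 \<and> deriv f z \<noteq> 0"
    and vert: "\<And>z. Re z = Re a \<or> Re z = Re b \<Longrightarrow> Im a \<le> Im z \<Longrightarrow> Im z \<le> Im b \<Longrightarrow> Re (deriv f z / f z) \<le> 0"
    and hor: "\<And>t. t = Im a \<or> t = Im b \<Longrightarrow> finite {x. Re a < x \<and> x < Re b \<and> Re (deriv f (Complex x t) / f (Complex x t)) = 0} \<and>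
        real (card {x. Re a < x \<and> x < Re b \<and> Re (deriv f (Complex x t) / f (Complex x t)) = 0}) \<le> n"
  shows "\<bar>real_of_int (zero_count f (box a b)) - real_of_int (zero_count (deriv f) (box a b))\<bar> \<le> n + 2"
proof -
  define a2 a4 where "a2 = Complex (Re b) (Im a)" and "a4 = Complex (Re a) (Im b)"
  have a: "a = Complex (Re a) (Im a)" and b: "b = Complex (Re b) (Im b)" by simp_all
  define F where "F = (\<lambda>z. deriv f z / f z)"
  have df: "deriv f holomorphic_on UNIV" by (intro holomorphic_deriv f open_UNIV)
  define A where "A = {z. f z \<noteq> 0 \<and> deriv f z \<noteq> 0}"
  have oA: "open A"
  proof -
    have "A = (f -` (- {0}) \<inter> UNIV) \<inter> (deriv f -` (- {0}) \<inter> UNIV)" unfolding A_def by auto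
    moreover have "open (f -` (- {0}) \<inter> UNIV)" if "f holomorphic_on UNIV" for f :: "complex \<Rightarrow> complex"
    proof -
      have "open (- {0::complex})" by (simp add: open_Compl)
      from continuous_open_preimage[OF holomorphic_on_imp_continuous_on[OF that] open_UNIV this]
      show ?thesis by (simp add: Int_commute)
    qed
    note this[OF f] this[OF df]
    ultimately show ?thesis by auto
  qed
  have FA: "F holomorphic_on A" unfolding F_def
    by (intro holomorphic_on_divide holomorphic_on_subset[OF f] holomorphic_on_subset[OF df]) (auto simp: A_def)
  have F0: "F z \<noteq> 0" if "z \<in> A" for z using that by (simp add: F_def A_def)
  \<comment> \<open>F'/F = f''/f' - f'/f, so its integral counts the zeros of f' minus those of
    f.\<close>
  have dF: "deriv F z / F z = deriv (deriv f) z / deriv f z - deriv f z / f z" if z: "z \<in> A" for z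
  proof -
    have "(F has_field_derivative (deriv (deriv f) z * f z - deriv f z * deriv f z) / (f z * f z)) (at z)"
      unfolding F_def using z
      by (intro DERIV_divide holomorphic_derivI[OF f open_UNIV UNIV_I] holomorphic_derivI[OF df open_UNIV UNIV_I]) (simp add: A_def)
    then have "deriv F z = (deriv (deriv f) z * f z - deriv f z * deriv f z) / (f z * f z)" by (rule DERIV_imp_deriv)
    then show ?thesis using z by (simp add: F_def A_def field_simps)
  qed
  have pi_A: "path_image (rectpath a b) \<subseteq> A" using nz by (auto simp: A_def)
  have pi_eq: "path_image (rectpath a b) = closed_segment a a2 \<union> closed_segment a2 b \<union> closed_segment b a4 \<union> closed_segment a4 a"
    by (simp add: rectpath_def Let_def path_image_join a2_def a4_def Un_assoc)
  have segA: "closed_segment a a2 \<subseteq> A" "closed_segment a2 b \<subseteq> A" "closed_segment b a4 \<subseteq> A" "closed_segment a4 a \<subseteq> A"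
    using pi_A unfolding pi_eq by auto
  have cont: "continuous_on S (\<lambda>z. deriv F z / F z)" if "S \<subseteq> A" for S
    using that F0 by (intro continuous_intros continuous_on_subset[OF holomorphic_on_imp_continuous_on[OF holomorphic_deriv[OF FA oA]]]
        continuous_on_subset[OF holomorphic_on_imp_continuous_on[OF FA]]) auto
  have fn: "\<exists>w. f w \<noteq> 0" "\<exists>w. deriv f w \<noteq> 0" using nz[of a] unfolding pi_eq by auto
  have "contour_integral (rectpath a b) (\<lambda>z. deriv F z / F z) =
      contour_integral (rectpath a b) (\<lambda>z. deriv (deriv f) z / deriv f z - deriv f z / f z)"
    by (rule contour_integral_cong) (use dF pi_A in auto)
  also have "\<dots> = contour_integral (rectpath a b) (\<lambda>z. deriv (deriv f) z / deriv f z) - contour_integral (rectpath a b) (\<lambda>z. deriv f z / f z)"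
  proof (rule contour_integral_diff)
    have ddf: "deriv (deriv f) holomorphic_on A"
      using holomorphic_deriv[OF df open_UNIV] by (rule holomorphic_on_subset) simp
    have "(\<lambda>z. deriv (deriv f) z / deriv f z) holomorphic_on A"
      by (intro holomorphic_on_divide ddf holomorphic_on_subset[OF df]) (auto simp: A_def)
    then show "(\<lambda>z. deriv (deriv f) z / deriv f z) contour_integrable_on rectpath a b"
      by (rule contour_integrable_holomorphic_simple[OF _ oA _ pi_A]) auto
    show "(\<lambda>z. deriv f z / f z) contour_integrable_on rectpath a b"
      by (rule contour_integrable_holomorphic_simple[OF _ oA _ pi_A])
         (use FA in \<open>auto simp: F_def\<close>)
  qed
  also have "\<dots> = 2 * of_real pi * \<i> * of_int (zero_count (deriv f) (box a b)) - 2 * of_real pi * \<i> * of_int (zero_count f (box a b))"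
    using zero_count_box[OF df fn(2) ab] zero_count_box[OF f fn(1) ab] nz by simp
  finally have tot: "contour_integral (rectpath a b) (\<lambda>z. deriv F z / F z) =
     2 * of_real pi * \<i> * of_int (zero_count (deriv f) (box a b)) - 2 * of_real pi * \<i> * of_int (zero_count f (box a b))" .
  define I where "I = (\<lambda>u v. contour_integral (linepath u v) (\<lambda>z. deriv F z / F z))"
  have ci: "(\<lambda>z. deriv F z / F z) contour_integrable_on linepath u v" if "closed_segment u v \<subseteq> A" for u v
    by (rule contour_integrable_continuous_linepath[OF cont[OF that]])
  have "contour_integral (rectpath a b) (\<lambda>z. deriv F z / F z) = I a a2 + (I a2 b + (I b a4 + I a4 a))"
    unfolding rectpath_def Let_def I_def a2_def[symmetric] a4_def[symmetric]
    using ci[OF segA(1)] ci[OF segA(2)] ci[OF segA(3)] ci[OF segA(4)] by simp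
  moreover have "I b a4 = - I a4 b"
    unfolding I_def using contour_integral_reverse_linepath[OF cont, of b a4] segA(3) by simp
  ultimately have sum: "Im (contour_integral (rectpath a b) (\<lambda>z. deriv F z / F z)) = Im (I a a2) + Im (I a2 b) - Im (I a4 b) + Im (I a4 a)"
    by simp
  have v1: "\<bar>Im (I a2 b)\<bar> \<le> pi" unfolding I_def
  proof (rule arg_variation_half_plane[OF oA FA F0 segA(2)])
    show "(\<forall>z\<in>closed_segment a2 b. 0 \<le> Re (F z)) \<or> (\<forall>z\<in>closed_segment a2 b. Re (F z) \<le> 0)"
      using vert ab unfolding F_def a2_def by (auto simp: closed_segment_same_Re closed_segment_eq_real_ivl)
  qed
  have v2: "\<bar>Im (I a4 a)\<bar> \<le> pi" unfolding I_def
  proof (rule arg_variation_half_plane[OF oA FA F0 segA(4)])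
    show "(\<forall>z\<in>closed_segment a4 a. 0 \<le> Re (F z)) \<or> (\<forall>z\<in>closed_segment a4 a. Re (F z) \<le> 0)"
      using vert ab unfolding F_def a4_def by (auto simp: closed_segment_same_Re closed_segment_eq_real_ivl)
  qed
  have h: "\<bar>Im (I (Complex (Re a) t) (Complex (Re b) t))\<bar> \<le> (n + 1) * pi" if t: "t = Im a \<or> t = Im b" for t
  proof -
    let ?X = "{x. Re a < x \<and> x < Re b \<and> Re (F (Complex x t)) = 0}"
    have "\<bar>Im (I (Complex (Re a) t) (Complex (Re b) t))\<bar> \<le> (real (card ?X) + 1) * pi"
      unfolding I_def
    proof (rule arg_variation_horizontal[OF oA FA F0])
      show "Complex x t \<in> A" if "Re a \<le> x" "x \<le> Re b" for x
        using pi_A path_image_rectpath[of a b] ab that t by auto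
    qed (use ab hor[OF t] in \<open>auto simp: F_def\<close>)
    also have "\<dots> \<le> (n + 1) * pi" using hor[OF t] by (intro mult_right_mono) (auto simp: F_def)
    finally show ?thesis .
  qed
  have h1: "\<bar>Im (I a a2)\<bar> \<le> (n + 1) * pi" using h[of "Im a"] a a2_def by simp
  have h2: "\<bar>Im (I a4 b)\<bar> \<le> (n + 1) * pi" using h[of "Im b"] b a4_def by simp
  define N where "N = real_of_int (zero_count f (box a b)) - real_of_int (zero_count (deriv f) (box a b))"
  have "Im (contour_integral (rectpath a b) (\<lambda>z. deriv F z / F z)) = - (2 * pi * N)"
    unfolding tot N_def by (simp add: algebra_simps)
  \<comment> \<open>Two horizontal edges with n + 1 half-turns each and two vertical edges with one
    each add up to 2 \<pi> (n + 2).\<close>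
  then have "\<bar>2 * pi * N\<bar> \<le> (n + 1) * pi + pi + (n + 1) * pi + pi" using sum h1 h2 v1 v2 by linarith
  also have "\<dots> = 2 * pi * (n + 2)" by (simp add: algebra_simps)
  finally have "2 * pi * \<bar>N\<bar> \<le> 2 * pi * (n + 2)" by (simp add: abs_mult)
  then show ?thesis unfolding N_def by (subst (asm) mult_le_cancel_left_pos) auto
qed

section \<open>Comparison of the zero counts\<close>

lemma cnj_comp_holomorphic:
  assumes "f holomorphic_on UNIV"
  shows "(\<lambda>s. cnj (f (cnj s))) holomorphic_on UNIV"
proof -
  have "f holomorphic_on cnj ` UNIV" using assms by (rule holomorphic_on_subset) simp
  from holomorphic_on_compose_cnj_cnj[OF this open_UNIV] show ?thesis by (simp add: o_def)
qed

lemma zorder_cnj: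
  assumes f: "f holomorphic_on UNIV" "\<exists>w. f w \<noteq> 0"
  shows "zorder (\<lambda>s. cnj (f (cnj s))) z = zorder f (cnj z)"
proof -
  have "\<exists>w\<in>UNIV. f w \<noteq> 0" using f(2) by simp
  from zorder_exist_zero[OF f(1) open_UNIV connected_UNIV UNIV_I this, of "cnj z"]
  have n: "zorder f (cnj z) \<ge> 0" by (auto split: if_splits)
  from zorder_exist_zero[OF f(1) open_UNIV connected_UNIV UNIV_I \<open>\<exists>w\<in>UNIV. f w \<noteq> 0\<close>, of "cnj z"]
  obtain r where r: "r > 0" "zor_poly f (cnj z) holomorphic_on cball (cnj z) r"
    "\<And>w. w \<in> cball (cnj z) r \<Longrightarrow> f w = zor_poly f (cnj z) w * (w - cnj z) ^ nat (zorder f (cnj z)) \<and> zor_poly f (cnj z) w \<noteq> 0"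
    by blast
  have ball: "cnj w \<in> cball (cnj z) r" if "w \<in> ball z r" for w
    using that by (simp add: dist_norm flip: complex_cnj_diff)
  show ?thesis
  proof (rule zorder_eqI[of "ball z r" z "\<lambda>w. cnj (zor_poly f (cnj z) (cnj w))"])
    have "zor_poly f (cnj z) holomorphic_on cnj ` ball z r"
      by (rule holomorphic_on_subset[OF r(2)]) (use ball in auto)
    from holomorphic_on_compose_cnj_cnj[OF this open_ball]
    show "(\<lambda>w. cnj (zor_poly f (cnj z) (cnj w))) holomorphic_on ball z r" by (simp add: o_def)
    show "cnj (zor_poly f (cnj z) (cnj z)) \<noteq> 0" using r(1) r(3)[of "cnj z"] by simp
    show "cnj (f (cnj w)) = cnj (zor_poly f (cnj z) (cnj w)) * (w - z) powi zorder f (cnj z)"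
      if "w \<in> ball z r" "w \<noteq> z" for w
      using r(3)[OF ball[OF that(1)]] n by (simp add: power_int_def)
  qed (use r(1) in auto)
qed

lemma zero_count_cnj:
  assumes f: "f holomorphic_on UNIV" "\<exists>w. f w \<noteq> 0"
  shows "zero_count (\<lambda>s. cnj (f (cnj s))) S = zero_count f (cnj ` S)"
  unfolding zero_count_def
proof (rule sum.reindex_bij_witness[of _ cnj cnj])
  show "zorder f (cnj z) = zorder (\<lambda>s. cnj (f (cnj s))) z" for z
    by (rule zorder_cnj[OF f, symmetric])
qed auto

lemma deriv_cnj_comp:
  assumes "f holomorphic_on UNIV"
  shows "deriv (\<lambda>s. cnj (f (cnj s))) z = cnj (deriv f (cnj z))"
proof -
  have "(f has_field_derivative deriv f (cnj z)) (at (cnj z))"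
    by (rule holomorphic_derivI[OF assms open_UNIV UNIV_I])
  from has_field_derivative_cnj_cnj[OF this] show ?thesis
    by (simp add: o_def DERIV_imp_deriv)
qed

context primitive_char begin

lemma primitive_char_cnj: "primitive_char q (\<lambda>a. cnj (chi a))"
proof (rule primitive_charI[OF q_gt_1 primitive_character_cnj])
  show "primitive_character q chi"
    unfolding primitive_character_def using dchar prim by blast
qed

lemma L_cnj: "dirichlet_L (\<lambda>a. cnj (chi a)) = (\<lambda>s. cnj (L (cnj s)))"
proof -
  have "entire_continuation_of_L_series (\<lambda>a. cnj (chi a)) (\<lambda>s. cnj (L (cnj s)))"
    unfolding entire_continuation_of_L_series_def
  proof (intro conjI allI impI cnj_comp_holomorphic L_holomorphic)
    fix s :: complex assume s: "Re s > 1"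
    have "(\<lambda>n. cnj (chi (int (Suc n))) * of_nat (Suc n) powr (-s)) sums dseries (\<lambda>n. cnj (chi (int n))) s"
      by (rule cnj_coef.dseries_sums[OF s])
    moreover have "dseries (\<lambda>n. cnj (chi (int n))) s = cnj (L (cnj s))"
      using dseries_cnj[OF s] L_eq_dseries[of "cnj s"] s by simp
    ultimately show "(\<lambda>n. cnj (chi (int (Suc n))) / of_nat (Suc n) powr s) sums cnj (L (cnj s))"
      by (simp only: powr_minus divide_inverse)
  qed
  then show ?thesis unfolding dirichlet_L_def
    using entire_continuation_of_L_series_unique by (intro the_equality) blast+
qed

lemma deriv_L_holomorphic: "deriv L holomorphic_on UNIV"
  by (intro holomorphic_deriv L_holomorphic open_UNIV)

lemma L_nontrivial: "\<exists>w. L w \<noteq> 0"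
  using L_nonzero_gt_1[of 2] by auto

lemma logderiv_at_center:
  assumes "T \<ge> 100"
  shows "Re (deriv L (Complex (-1/4) T) / L (Complex (-1/4) T)) \<le> - 1 / 4"
  by (rule L_logderiv_left) (use assms in auto)

lemma deriv_L_nontrivial: "\<exists>w. deriv L w \<noteq> 0"
proof -
  have "deriv L (Complex (-1/4) 100) \<noteq> 0" using logderiv_at_center[of 100] by auto
  then show ?thesis by blast
qed

end

text \<open>Cauchy's inequality on the unit circle about s. The radius 1 accounts for growth being
  taken up to -(R + 1) and for 3 in place of 2.\<close>

lemma L_deriv_growth:
  fixes R :: real
  assumes "R > 0"
  shows "\<exists>C A. C > 0 \<and> (\<forall>q chi s. primitive_char q chi \<longrightarrow> - R \<le> Re s \<longrightarrow>
     norm (dirichlet_L chi s) \<le> C * (real q * (norm s + 3)) ^ A \<and>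
     norm (deriv (dirichlet_L chi) s) \<le> C * (real q * (norm s + 3)) ^ A)"
proof -
  obtain C A where CA: "C > 0" "\<And>q chi s. primitive_char q chi \<Longrightarrow> - (R + 1) \<le> Re s \<Longrightarrow>
     norm (dirichlet_L chi s) \<le> C * (real q * (norm s + 2)) ^ A"
    using L_growth[of "R + 1"] assms by (metis add_pos_pos zero_less_one)
  have "norm (dirichlet_L chi s) \<le> C * (real q * (norm s + 3)) ^ A \<and>
     norm (deriv (dirichlet_L chi) s) \<le> C * (real q * (norm s + 3)) ^ A"
    if p: "primitive_char q chi" and s: "- R \<le> Re s" for q chi s
  proof
    interpret primitive_char q chi by (rule p)
    have near: "norm (L z) \<le> C * (real q * (norm s + 3)) ^ A" if "norm (s - z) \<le> 1" for z
    proof -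
      have "- (R + 1) \<le> Re z" using s that abs_Re_le_cmod[of "s - z"] by simp
      then have "norm (L z) \<le> C * (real q * (norm z + 2)) ^ A" by (rule CA(2)[OF p])
      also have "\<dots> \<le> C * (real q * (norm s + 3)) ^ A"
        using CA(1) that norm_triangle_ineq3[of z s]
        by (intro mult_left_mono power_mono) (auto simp: norm_minus_commute)
      finally show ?thesis .
    qed
    show "norm (L s) \<le> C * (real q * (norm s + 3)) ^ A" using near[of s] by simp
    have "norm ((deriv ^^ 1) L s) \<le> fact 1 * (C * (real q * (norm s + 3)) ^ A) / 1 ^ 1"
      by (rule Cauchy_inequality[of L s 1])
         (use near in \<open>auto intro!: L_holomorphic holomorphic_on_imp_continuous_on\<close>)
    then show "norm (deriv L s) \<le> C * (real q * (norm s + 3)) ^ A" by simp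
  qed
  then show ?thesis using CA(1) by blast
qed

section \<open>Sign changes on horizontal edges and zeros of bounded height\<close>

lemma ln_ge_1: "(Y::real) \<ge> 3 \<Longrightarrow> ln Y \<ge> 1"
  using exp_le by (subst ln_ge_iff) auto

lemma ln_monomial_le:
  fixes C Y :: real
  assumes "C > 0" "Y \<ge> 3"
  shows "ln (C * Y ^ N) \<le> (\<bar>ln C\<bar> + real N) * ln Y"
proof -
  have "ln (C * Y ^ N) = ln C + real N * ln Y" using assms by (simp add: ln_mult ln_realpow)
  also have "\<dots> \<le> \<bar>ln C\<bar> * ln Y + real N * ln Y"
    using mult_left_mono[OF ln_ge_1[OF assms(2)], of "\<bar>ln C\<bar>"] by simp
  finally show ?thesis by (simp add: algebra_simps)
qed

text \<open>On the horizontal line at height \<open>T\<close>, \<open>Re (L' / L)\<close> is up to a positive factor the restriction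
  to the real axis of an entire function \<open>H\<close>, whose zeros are counted by Jensen's formula.  The
  disc is centred at \<open>-1/4\<close>, on the left of the critical strip, where the functional equation
  bounds \<open>L\<close> and \<open>Re (L' / L)\<close> away from 0.\<close>

lemma horizontal_sign_changes:
  "\<exists>K\<ge>0. \<forall>q chi T. primitive_char q chi \<longrightarrow> T \<ge> 100 \<longrightarrow>
     (\<forall>x. 0 < x \<longrightarrow> x < 1/2 \<longrightarrow> dirichlet_L chi (Complex x T) \<noteq> 0) \<longrightarrow>
     finite {x. 0 < x \<and> x < 1/2 \<and> Re (deriv (dirichlet_L chi) (Complex x T) / dirichlet_L chi (Complex x T)) = 0} \<and>
     real (card {x. 0 < x \<and> x < 1/2 \<and> Re (deriv (dirichlet_L chi) (Complex x T) / dirichlet_L chi (Complex x T)) = 0})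
       \<le> K * ln (real q * T)"
proof -
  obtain C A where CA: "C > 0" "\<And>q chi s. primitive_char q chi \<Longrightarrow> - 3 \<le> Re s \<Longrightarrow>
     norm (dirichlet_L chi s) \<le> C * (real q * (norm s + 3)) ^ A \<and>
     norm (deriv (dirichlet_L chi) s) \<le> C * (real q * (norm s + 3)) ^ A"
    using L_deriv_growth[of 3, OF zero_less_numeral] by blast
  obtain c where c: "c > 0" "\<And>q chi T. primitive_char q chi \<Longrightarrow> T \<ge> 100 \<Longrightarrow> c \<le> norm (dirichlet_L chi (Complex (-1/4) T))"
    using L_center_lower_bound by blast
  define K where "K = 2 * (\<bar>ln (4 * C\<^sup>2 / c\<^sup>2)\<bar> + real (4 * A))"
  have K: "K \<ge> 0" unfolding K_def by simp
  have "finite {x. 0 < x \<and> x < 1/2 \<and> Re (deriv (dirichlet_L chi) (Complex x T) / dirichlet_L chi (Complex x T)) = 0} \<and>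
     real (card {x. 0 < x \<and> x < 1/2 \<and> Re (deriv (dirichlet_L chi) (Complex x T) / dirichlet_L chi (Complex x T)) = 0})
       \<le> K * ln (real q * T)" (is "finite ?X \<and> _")
    if p: "primitive_char q chi" and T: "T \<ge> 100"
      and nz: "\<And>x. 0 < x \<Longrightarrow> x < 1/2 \<Longrightarrow> dirichlet_L chi (Complex x T) \<noteq> 0" for q chi T
  proof -
    interpret primitive_char q chi by (rule p)
    define Y where "Y = real q * T"
    have Y: "Y \<ge> 3" unfolding Y_def using mult_mono[of 2 "real q" 100 T] q_gt_1 T by simp
    define f where "f = (\<lambda>s. L (s + \<i> * of_real T))"
    define g where "g = (\<lambda>s. deriv L (s + \<i> * of_real T))"
    \<comment> \<open>Schwarz reflection: s -> cnj (f (cnj s)) is entire and takes the conjugate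
      values on the real axis. There H is Re (L' cnj L) = Re (L'/L) |L|^2 at height T.\<close>
    define H where "H = (\<lambda>s. (g s * cnj (f (cnj s)) + cnj (g (cnj s)) * f s) / 2)"
    have shift: "(\<lambda>s. h (s + \<i> * of_real T)) holomorphic_on UNIV" if "h holomorphic_on UNIV" for h :: "complex \<Rightarrow> complex"
      using holomorphic_on_compose_gen[OF _ that, of "\<lambda>s. s + \<i> * of_real T" UNIV]
      unfolding o_def by (fastforce intro: holomorphic_intros)
    have fh: "f holomorphic_on UNIV" "g holomorphic_on UNIV"
      unfolding f_def g_def by (intro shift L_holomorphic deriv_L_holomorphic)+
    have Hh: "H holomorphic_on UNIV" unfolding H_def
      by (intro holomorphic_intros fh cnj_comp_holomorphic) auto
    have Hreal: "H (of_real x) = of_real (Re (deriv L (Complex x T) / L (Complex x T)) * (norm (L (Complex x T)))\<^sup>2)"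
      if "L (Complex x T) \<noteq> 0" for x
    proof -
      have e: "complex_of_real x + \<i> * of_real T = Complex x T" by (simp add: Complex_eq)
      have "H (of_real x) = (deriv L (Complex x T) * cnj (L (Complex x T)) + cnj (deriv L (Complex x T) * cnj (L (Complex x T)))) / 2"
        unfolding H_def f_def g_def complex_cnj_complex_of_real e by simp
      also have "\<dots> = of_real (Re (deriv L (Complex x T) * cnj (L (Complex x T))))"
        by (simp only: complex_add_cnj) simp
      also have "Re (deriv L (Complex x T) * cnj (L (Complex x T))) = Re (deriv L (Complex x T) / L (Complex x T)) * (norm (L (Complex x T)))\<^sup>2"
        using that by (subst complex_div_cnj) (simp only: Re_divide_of_real norm_eq_zero not_False_eq_True power_eq_0_iff nonzero_eq_divide_eq of_real_power[symmetric], simp)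
      finally show ?thesis .
    qed
    define s0 where "s0 = complex_of_real (-1/4)"
    have Lc: "c \<le> norm (L (Complex (-1/4) T))" by (rule c(2)[OF p T])
    then have Lc0: "L (Complex (-1/4) T) \<noteq> 0" using c(1) by auto
    have H0: "norm (H s0) \<ge> c\<^sup>2 / 4"
    proof -
      have "1 / 4 \<le> \<bar>Re (deriv L (Complex (-1/4) T) / L (Complex (-1/4) T))\<bar>"
        using logderiv_at_center[OF T] by linarith
      moreover have "c\<^sup>2 \<le> (norm (L (Complex (-1/4) T)))\<^sup>2" using Lc c(1) by (intro power_mono) auto
      ultimately have "1 / 4 * c\<^sup>2 \<le> \<bar>Re (deriv L (Complex (-1/4) T) / L (Complex (-1/4) T))\<bar> * (norm (L (Complex (-1/4) T)))\<^sup>2"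
        by (intro mult_mono) auto
      also have "\<dots> = norm (H s0)"
        unfolding s0_def Hreal[OF Lc0] norm_of_real abs_mult by simp
      finally show ?thesis by simp
    qed
    then have H0': "H s0 \<noteq> 0" "norm (H s0) > 0" using c(1) by (auto intro: less_le_trans[of 0 "c\<^sup>2 / 4"])
    define M where "M = (C * (Y\<^sup>2) ^ A) * (C * (Y\<^sup>2) ^ A)"
    \<comment> \<open>The disc of radius 3/4 about -1/4 just reaches 1/2. Jensen's bound is needed
      on three times this radius, where |w| \<le> 5/2.\<close>
    have M: "norm (H w) \<le> M" if w: "dist s0 w = 3 * (3/4)" for w
    proof -
      have "norm (w - s0) = 9/4" using w by (simp add: dist_norm norm_minus_commute)
      then have nw: "norm w \<le> 5/2" using norm_triangle_ineq[of "w - s0" s0] by (simp add: s0_def)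
      have bound: "norm (L (v + \<i> * of_real T)) \<le> C * (Y\<^sup>2) ^ A \<and> norm (deriv L (v + \<i> * of_real T)) \<le> C * (Y\<^sup>2) ^ A"
        if v: "norm v \<le> 5/2" for v
      proof -
        have "- 3 \<le> Re (v + \<i> * of_real T)" using abs_Re_le_cmod[of v] v by simp
        note b = CA(2)[OF p this]
        have "norm (v + \<i> * of_real T) + 3 \<le> T + 6"
          using norm_triangle_ineq[of v "\<i> * of_real T"] v T by (simp add: norm_mult)
        also have "\<dots> \<le> T * T"
        proof -
          have "100 * T \<le> T * T" using T by (intro mult_right_mono) auto
          then show ?thesis using T by linarith
        qed
        also have "\<dots> \<le> real q * (T * T)" using mult_right_mono[of 1 "real q" "T * T"] q_gt_1 T by simp
        finally have "real q * (norm (v + \<i> * of_real T) + 3) \<le> real q * (real q * (T * T))"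
          by (intro mult_left_mono) auto
        then have "real q * (norm (v + \<i> * of_real T) + 3) \<le> Y\<^sup>2"
          unfolding Y_def by (simp add: power2_eq_square mult_ac)
        then have "C * (real q * (norm (v + \<i> * of_real T) + 3)) ^ A \<le> C * (Y\<^sup>2) ^ A"
          using CA(1) by (intro mult_left_mono power_mono) auto
        then show ?thesis using b by linarith
      qed
      have b1: "norm (f w) \<le> C * (Y\<^sup>2) ^ A" "norm (g w) \<le> C * (Y\<^sup>2) ^ A"
        "norm (f (cnj w)) \<le> C * (Y\<^sup>2) ^ A" "norm (g (cnj w)) \<le> C * (Y\<^sup>2) ^ A"
        unfolding f_def g_def using bound[of w] bound[of "cnj w"] nw by auto
      have "norm (g w * cnj (f (cnj w))) \<le> M" "norm (cnj (g (cnj w)) * f w) \<le> M"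
        unfolding M_def norm_mult complex_mod_cnj using CA(1) by (intro mult_mono b1; simp)+
      then show ?thesis unfolding H_def
        using norm_triangle_ineq[of "g w * cnj (f (cnj w))" "cnj (g (cnj w)) * f w"] by (simp add: norm_divide)
    qed
    define S where "S = complex_of_real ` ?X"
    have SH: "{z. z \<in> S \<and> H z = 0} = S" unfolding S_def using Hreal nz by auto
    have Sr: "S \<subseteq> cball s0 (3/4)"
    proof
      fix z assume "z \<in> S"
      then obtain x where x: "z = of_real x" "0 < x" "x < 1/2" unfolding S_def by auto
      have "s0 - z = of_real (-1/4 - x)" unfolding s0_def x(1) by simp
      then have "dist s0 z = \<bar>-1/4 - x\<bar>" unfolding dist_norm by (simp only: norm_of_real)
      then show "z \<in> cball s0 (3/4)" using x by simp
    qed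
    note J = jensen_zero_count[OF Hh H0'(1) _ M Sr]
    have fin: "finite S" using J(1) SH by simp
    have inj: "inj_on complex_of_real ?X" by (simp add: inj_on_def)
    have "finite ?X" using fin inj unfolding S_def by (simp add: finite_image_iff)
    moreover have "real (card ?X) \<le> K * ln Y"
    proof -
      have "card ?X = card S" unfolding S_def by (rule card_image[OF inj, symmetric])
      then have "real (card ?X) \<le> 2 * ln (M / norm (H s0))" using J(3,4) SH by simp
      also have "\<dots> \<le> 2 * ln ((4 * C\<^sup>2 / c\<^sup>2) * Y ^ (4 * A))"
      proof (intro mult_left_mono ln_mono)
        have "M / norm (H s0) \<le> M / (c\<^sup>2 / 4)"
          using H0 H0' c(1) Y CA(1) unfolding M_def by (intro divide_left_mono) auto
        moreover have "M = C\<^sup>2 * Y ^ (4 * A)"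
        proof -
          have "Y ^ (4 * A) = (Y ^ A) ^ 4" by (simp only: power_mult mult.commute[of 4 A])
          moreover have "(Y\<^sup>2) ^ A = (Y ^ A)\<^sup>2" by (simp only: power_mult[symmetric] mult.commute)
          ultimately show ?thesis unfolding M_def by (simp add: power2_eq_square power4_eq_xxxx mult_ac)
        qed
        ultimately show "M / norm (H s0) \<le> (4 * C\<^sup>2 / c\<^sup>2) * Y ^ (4 * A)" by (simp add: mult_ac)
      qed (use H0' CA(1) Y in \<open>auto simp: M_def\<close>)
      finally have "real (card ?X) \<le> 2 * ln ((4 * C\<^sup>2 / c\<^sup>2) * Y ^ (4 * A))" .
      also have "\<dots> \<le> 2 * ((\<bar>ln (4 * C\<^sup>2 / c\<^sup>2)\<bar> + real (4 * A)) * ln Y)"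
        using CA(1) c(1) Y by (intro mult_left_mono ln_monomial_le) auto
      finally show ?thesis unfolding K_def by (simp add: algebra_simps)
    qed
    ultimately show ?thesis unfolding Y_def by blast
  qed
  then show ?thesis using K by blast
qed

text \<open>One disc of radius 300 about -1/4 + 100i contains the whole region. At this centre L is
  bounded below by c, hence L' by c/4 because |L'/L| \<ge> 1/4; on the circle of radius 900 both
  grow polynomially in q, so each count is O(log q).\<close>

lemma small_height_zero_count:
  "\<exists>K\<ge>0. \<forall>q chi S. primitive_char q chi \<longrightarrow> S \<subseteq> {s. 0 < Re s \<and> Re s < 1/2 \<and> \<bar>Im s\<bar> \<le> 101} \<longrightarrow>
     0 \<le> zero_count (dirichlet_L chi) S \<and> real_of_int (zero_count (dirichlet_L chi) S) \<le> K * ln (real q * 2) \<and>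
     0 \<le> zero_count (deriv (dirichlet_L chi)) S \<and> real_of_int (zero_count (deriv (dirichlet_L chi)) S) \<le> K * ln (real q * 2)"
proof -
  obtain C A where CA: "C > 0" "\<And>q chi s. primitive_char q chi \<Longrightarrow> - 1000 \<le> Re s \<Longrightarrow>
     norm (dirichlet_L chi s) \<le> C * (real q * (norm s + 3)) ^ A \<and>
     norm (deriv (dirichlet_L chi) s) \<le> C * (real q * (norm s + 3)) ^ A"
    using L_deriv_growth[of 1000, OF zero_less_numeral] by blast
  obtain c where c: "c > 0" "\<And>q chi T. primitive_char q chi \<Longrightarrow> T \<ge> 100 \<Longrightarrow> c \<le> norm (dirichlet_L chi (Complex (-1/4) T))"
    using L_center_lower_bound by blast
  define D where "D = C * 1004 ^ A"
  have D: "D > 0" unfolding D_def using CA(1) by simp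
  define K where "K = 2 * (\<bar>ln (D / (c / 4))\<bar> + real A)"
  have K: "K \<ge> 0" unfolding K_def by simp
  have main: "0 \<le> zero_count f S \<and> real_of_int (zero_count f S) \<le> K * ln (real q * 2)"
    if p: "primitive_char q chi" and S: "S \<subseteq> {s. 0 < Re s \<and> Re s < 1/2 \<and> \<bar>Im s\<bar> \<le> 101}"
      and f: "f = dirichlet_L chi \<or> f = deriv (dirichlet_L chi)" for q chi S f
  proof -
    interpret primitive_char q chi by (rule p)
    define s0 where "s0 = Complex (-1/4) 100"
    define Y where "Y = real q * 2"
    have Y: "Y \<ge> 3" unfolding Y_def using q_gt_1 by simp
    have Lc: "c \<le> norm (L s0)" unfolding s0_def by (rule c(2)[OF p]) simp
    have "1 / 4 \<le> norm (deriv L s0 / L s0)"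
      using logderiv_at_center[of 100] abs_Re_le_cmod[of "deriv L s0 / L s0"] unfolding s0_def by simp
    then have "c / 4 \<le> norm (deriv L s0)"
    proof -
      assume a: "1 / 4 \<le> norm (deriv L s0 / L s0)"
      have "L s0 \<noteq> 0" using Lc c(1) by auto
      then have "norm (deriv L s0) = norm (deriv L s0 / L s0) * norm (L s0)" by (simp add: norm_divide)
      moreover have "1 / 4 * c \<le> norm (deriv L s0 / L s0) * norm (L s0)"
        using a Lc c(1) by (intro mult_mono) auto
      ultimately show ?thesis by simp
    qed
    then have fc: "c / 4 \<le> norm (f s0)" using f Lc c(1) by auto
    then have f0: "f s0 \<noteq> 0" using c(1) by auto
    have fh: "f holomorphic_on UNIV" using f L_holomorphic deriv_L_holomorphic by blast
    have ns0: "norm s0 \<le> 101" unfolding s0_def using cmod_le[of "Complex (-1/4) 100"] by simp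
    have M: "norm (f w) \<le> D * Y ^ A" if w: "dist s0 w = 3 * 300" for w
    proof -
      have nw: "norm w \<le> 1001" using w norm_triangle_ineq[of "w - s0" s0] ns0 by (simp add: dist_norm norm_minus_commute)
      have "- 1000 \<le> Re w" using w abs_Re_le_cmod[of "s0 - w"] by (simp add: dist_norm s0_def)
      from CA(2)[OF p this] have "norm (f w) \<le> C * (real q * (norm w + 3)) ^ A" using f by auto
      also have "\<dots> \<le> C * (1004 * Y) ^ A"
      proof (intro mult_left_mono power_mono)
        have "real q * (norm w + 3) \<le> real q * (1004 * 2)" using nw by (intro mult_left_mono) auto
        then show "real q * (norm w + 3) \<le> 1004 * Y" unfolding Y_def by simp
      qed (use CA(1) in auto)
      finally show ?thesis unfolding D_def by (simp add: power_mult_distrib)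
    qed
    have Sr: "S \<subseteq> cball s0 300"
    proof
      fix z assume "z \<in> S"
      then have z: "0 < Re z" "Re z < 1/2" "\<bar>Im z\<bar> \<le> 101" using S by auto
      then have "norm z \<le> 102" using cmod_le[of z] by linarith
      then show "z \<in> cball s0 300" using norm_triangle_ineq4[of s0 z] ns0 by (simp add: dist_norm)
    qed
    note J = jensen_zero_count[OF fh f0 _ M Sr]
    have "real_of_int (zero_count f S) \<le> 2 * ln (D * Y ^ A / norm (f s0))" using J(4) by simp
    also have "\<dots> \<le> 2 * ln (D / (c / 4) * Y ^ A)"
    proof (intro mult_left_mono ln_mono)
      have "D * Y ^ A / norm (f s0) \<le> D * Y ^ A / (c / 4)"
        using fc c(1) D Y by (intro divide_left_mono mult_pos_pos) auto
      then show "D * Y ^ A / norm (f s0) \<le> D / (c / 4) * Y ^ A" by (simp add: mult_ac)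
    qed (use D Y f0 in auto)
    also have "\<dots> \<le> 2 * ((\<bar>ln (D / (c / 4))\<bar> + real A) * ln Y)"
      using D c(1) Y by (intro mult_left_mono ln_monomial_le) auto
    finally show ?thesis using J(2) unfolding K_def Y_def by (simp add: algebra_simps)
  qed
  then show ?thesis using K by blast
qed

text \<open>Half way to the next height that occurs. This moves a horizontal edge off the zeros
  without changing the count.\<close>

lemma zero_free_height_above:
  fixes X :: "complex set" and h m :: real
  assumes "finite X" "h < m"
  shows "\<exists>t. h < t \<and> t < m \<and> (\<forall>z\<in>X. Im z \<le> h \<or> t < Im z)"
proof -
  define Y where "Y = insert m {y \<in> Im ` X. y > h}"
  have Y: "finite Y" "Y \<noteq> {}" unfolding Y_def using assms(1) by auto
  have "h < Min Y" using Y assms(2) by (subst Min_gr_iff) (auto simp: Y_def)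
  define t where "t = (h + Min Y) / 2"
  have t: "h < t" "t < Min Y" unfolding t_def using \<open>h < Min Y\<close> by (auto simp: field_simps)
  moreover have "Min Y \<le> m" using Y by (intro Min_le) (auto simp: Y_def)
  moreover have "Im z \<le> h \<or> t < Im z" if "z \<in> X" for z
  proof (cases "Im z > h")
    case True
    then have "Min Y \<le> Im z" using Y that by (intro Min_le) (auto simp: Y_def)
    then show ?thesis using t by linarith
  qed simp
  ultimately show ?thesis by (intro exI[of _ t]) auto
qed

text \<open>The rectangle starts just above height 101, ends just above T and stops at 1/2 - d. No
  zero of L or L' lies in the slivers between it and the region U, so both counts are those of the
  open rectangle, whose boundary carries no zeros.\<close>

lemma upper_zero_count_compare:
  "\<exists>K\<ge>0. \<forall>q chi T. primitive_char q chi \<longrightarrow> T > 101 \<longrightarrow>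
     \<bar>real_of_int (zero_count (dirichlet_L chi) {s. 0 < Re s \<and> Re s < 1/2 \<and> 101 < Im s \<and> Im s \<le> T}) -
      real_of_int (zero_count (deriv (dirichlet_L chi)) {s. 0 < Re s \<and> Re s < 1/2 \<and> 101 < Im s \<and> Im s \<le> T})\<bar>
       \<le> K * ln (real q * T)"
proof -
  obtain K where K: "K \<ge> 0" and hor: "\<And>q chi T. primitive_char q chi \<Longrightarrow> T \<ge> 100 \<Longrightarrow>
     (\<And>x. 0 < x \<Longrightarrow> x < 1/2 \<Longrightarrow> dirichlet_L chi (Complex x T) \<noteq> 0) \<Longrightarrow>
     finite {x. 0 < x \<and> x < 1/2 \<and> Re (deriv (dirichlet_L chi) (Complex x T) / dirichlet_L chi (Complex x T)) = 0} \<and>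
     real (card {x. 0 < x \<and> x < 1/2 \<and> Re (deriv (dirichlet_L chi) (Complex x T) / dirichlet_L chi (Complex x T)) = 0})
       \<le> K * ln (real q * T)"
    using horizontal_sign_changes by blast
  have "\<bar>real_of_int (zero_count (dirichlet_L chi) U) - real_of_int (zero_count (deriv (dirichlet_L chi)) U)\<bar>
       \<le> (2 * K + 2) * ln (real q * T)"
    if p: "primitive_char q chi" and T: "T > 101" and U: "U = {s. 0 < Re s \<and> Re s < 1/2 \<and> 101 < Im s \<and> Im s \<le> T}" for q chi T U
  proof -
    interpret primitive_char q chi by (rule p)
    define B where "B = cbox (Complex 0 0) (Complex (1/2) (T + 1))"
    define X where "X = {z. z \<in> B \<and> L z = 0} \<union> {z. z \<in> B \<and> deriv L z = 0}"
    have X: "finite X" unfolding X_def B_def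
      by (intro finite_UnI finite_zeros_bounded L_holomorphic deriv_L_holomorphic L_nontrivial deriv_L_nontrivial bounded_cbox)
    obtain t1 where t1: "101 < t1" "t1 < T" "\<And>z. z \<in> X \<Longrightarrow> Im z \<le> 101 \<or> t1 < Im z"
      using zero_free_height_above[OF X T] by blast
    obtain t2 where t2: "T < t2" "t2 < T + 1" "\<And>z. z \<in> X \<Longrightarrow> Im z \<le> T \<or> t2 < Im z"
      using zero_free_height_above[OF X, of T "T + 1"] by auto
    have inX: "z \<in> X" if "L z = 0 \<or> deriv L z = 0" "0 \<le> Re z" "Re z \<le> 1/2" "0 \<le> Im z" "Im z \<le> T + 1" for z
      using that unfolding X_def B_def in_cbox_complex_iff mem_Collect_eq Un_iff by auto
    have edge: "L z \<noteq> 0 \<and> deriv L z \<noteq> 0" if "0 \<le> Re z" "Re z \<le> 1/2" "Im z = t1 \<or> Im z = t2" for z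
    proof (rule ccontr)
      assume "\<not> ?thesis"
      then have "z \<in> X" using that t1 t2 T by (intro inX) auto
      then show False using t1(3)[of z] t2(3)[of z] that(3) t1(1,2) t2(1) by auto
    qed
    obtain d where d: "d > 0" "d < 1/4" "\<And>s. 1/2 - d \<le> Re s \<Longrightarrow> Re s < 1/2 \<Longrightarrow> t1 \<le> Im s \<Longrightarrow> Im s \<le> t2 \<Longrightarrow>
        L s \<noteq> 0 \<and> Re (deriv L s / L s) < 0"
      using L_right_edge[of t1 t2] t1 t2 by auto
    define a b where "a = Complex 0 t1" and "b = Complex (1/2 - d) t2"
    have ab: "Re a < Re b" "Im a < Im b" unfolding a_def b_def using d t1 t2 by auto
    have left: "L z \<noteq> 0 \<and> Re (deriv L z / L z) \<le> - 1 / 4" if "Re z = 0" "t1 \<le> Im z" for z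
      using L_nonzero_left[of z] L_logderiv_line_0[of z] that t1 by auto
    have zeros: "{z. z \<in> U \<and> f z = 0} = {z. z \<in> box a b \<and> f z = 0}" if f: "f = L \<or> f = deriv L" for f
    proof (intro Collect_cong iffI; elim conjE)
      fix z assume z: "z \<in> U" "f z = 0"
      then have zU: "0 < Re z" "Re z < 1/2" "101 < Im z" "Im z \<le> T" unfolding U by auto
      then have "z \<in> X" using f z(2) by (intro inX) auto
      then have "t1 < Im z" using t1(3)[of z] zU by auto
      moreover have "Re z < 1/2 - d"
      proof (rule ccontr)
        assume "\<not> Re z < 1/2 - d"
        then have "L z \<noteq> 0 \<and> Re (deriv L z / L z) < 0" using zU \<open>t1 < Im z\<close> t2 by (intro d(3)) auto
        then show False using f z(2) by auto
      qed
      ultimately show "z \<in> box a b \<and> f z = 0" using zU z t2 by (auto simp: a_def b_def in_box_complex_iff)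
    next
      fix z assume z: "z \<in> box a b" "f z = 0"
      then have zb: "0 < Re z" "Re z < 1/2 - d" "t1 < Im z" "Im z < t2" by (auto simp: a_def b_def in_box_complex_iff)
      then have "z \<in> X" using f z(2) t1 t2 d T by (intro inX) auto
      then have "Im z \<le> T" using t2(3)[of z] zb by auto
      then show "z \<in> U \<and> f z = 0" using zb z d t1 unfolding U by auto
    qed
    define n where "n = K * ln (real q * (T + 1))"
    have "\<bar>real_of_int (zero_count L (box a b)) - real_of_int (zero_count (deriv L) (box a b))\<bar> \<le> n + 2"
    proof (rule zero_count_deriv_compare[OF L_holomorphic ab])
      fix z assume "z \<in> path_image (rectpath a b)"
      then have "(Re z = 0 \<or> Re z = 1/2 - d) \<and> t1 \<le> Im z \<and> Im z \<le> t2 \<or> (Im z = t1 \<or> Im z = t2) \<and> 0 \<le> Re z \<and> Re z \<le> 1/2 - d"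
        using ab by (subst (asm) path_image_rectpath) (auto simp: a_def b_def)
      then show "L z \<noteq> 0 \<and> deriv L z \<noteq> 0"
      proof (elim disjE conjE)
        assume "Re z = 0" "t1 \<le> Im z" "Im z \<le> t2"
        then show ?thesis using left[of z] by auto
      next
        assume "Re z = 1/2 - d" "t1 \<le> Im z" "Im z \<le> t2"
        then show ?thesis using d(3)[of z] d(1) by auto
      qed (use edge[of z] d in auto)
    next
      fix z assume z: "Re z = Re a \<or> Re z = Re b" "Im a \<le> Im z" "Im z \<le> Im b"
      from z(1) show "Re (deriv L z / L z) \<le> 0"
      proof
        assume "Re z = Re a"
        then show ?thesis using left[of z] z by (auto simp: a_def)
      next
        assume "Re z = Re b"
        then show ?thesis using d(3)[of z] d(1) z by (auto simp: a_def b_def)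
      qed
    next
      fix t assume t: "t = Im a \<or> t = Im b"
      then have tt: "t = t1 \<or> t = t2" by (simp add: a_def b_def)
      then have t100: "100 \<le> t" "t \<le> T + 1" using t1 t2 by auto
      let ?X = "{x. 0 < x \<and> x < 1/2 \<and> Re (deriv L (Complex x t) / L (Complex x t)) = 0}"
      have h: "finite ?X \<and> real (card ?X) \<le> K * ln (real q * t)"
        by (rule hor[OF p t100(1)]) (use edge tt in auto)
      have sub: "{x. Re a < x \<and> x < Re b \<and> Re (deriv L (Complex x t) / L (Complex x t)) = 0} \<subseteq> ?X"
        using d by (auto simp: a_def b_def)
      have "K * ln (real q * t) \<le> n" unfolding n_def
        using t100 q_gt_1 K by (intro mult_left_mono ln_mono) auto
      then show "finite {x. Re a < x \<and> x < Re b \<and> Re (deriv L (Complex x t) / L (Complex x t)) = 0} \<and>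
          real (card {x. Re a < x \<and> x < Re b \<and> Re (deriv L (Complex x t) / L (Complex x t)) = 0}) \<le> n"
        using h sub finite_subset[OF sub] card_mono[OF _ sub] by (auto intro: order_trans[of _ "real (card ?X)"])
    qed
    moreover have "zero_count L U = zero_count L (box a b)" "zero_count (deriv L) U = zero_count (deriv L) (box a b)"
      unfolding zero_count_def using zeros[of L] zeros[of "deriv L"] by simp_all
    moreover have "n + 2 \<le> (2 * K + 2) * ln (real q * T)"
    proof -
      have qT: "real q * T \<ge> 3" using mult_mono[of 2 "real q" 101 T] q_gt_1 T by simp
      \<comment> \<open>The upper edge may lie near T + 1; squaring qT absorbs this and only doubles
        the logarithm.\<close>
      have "real q * (T + 1) \<le> (real q * T)\<^sup>2"
      proof -
        have "T + 1 \<le> 2 * T" using T by simp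
        also have "\<dots> \<le> (real q * T) * T" using mult_right_mono[of 2 "real q * T" T] qT T by simp
        finally have "real q * (T + 1) \<le> real q * ((real q * T) * T)" by (intro mult_left_mono) auto
        then show ?thesis by (simp add: power2_eq_square mult_ac)
      qed
      then have "ln (real q * (T + 1)) \<le> ln ((real q * T)\<^sup>2)" using q_gt_1 T by (intro ln_mono) auto
      also have "\<dots> = 2 * ln (real q * T)" using qT by (simp add: ln_realpow)
      finally have "n \<le> K * (2 * ln (real q * T))" unfolding n_def using K by (intro mult_left_mono) auto
      moreover have "2 \<le> 2 * ln (real q * T)" using ln_ge_1[OF qT] by simp
      ultimately show ?thesis by (simp add: algebra_simps)
    qed
    ultimately show ?thesis by simp
  qed
  then show ?thesis using K by (intro exI[of _ "2 * K + 2"]) auto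
qed

lemma zero_count_compare:
  "\<exists>K\<ge>0. \<forall>q chi T. primitive_char q chi \<longrightarrow> T \<ge> 2 \<longrightarrow>
     \<bar>real_of_int (N_minus T chi) - real_of_int (N1_minus T chi)\<bar> \<le> K * ln (real q * T)"
proof -
  obtain K1 where K1: "K1 \<ge> 0" "\<And>q chi T. primitive_char q chi \<Longrightarrow> T > 101 \<Longrightarrow>
     \<bar>real_of_int (zero_count (dirichlet_L chi) {s. 0 < Re s \<and> Re s < 1/2 \<and> 101 < Im s \<and> Im s \<le> T}) -
      real_of_int (zero_count (deriv (dirichlet_L chi)) {s. 0 < Re s \<and> Re s < 1/2 \<and> 101 < Im s \<and> Im s \<le> T})\<bar>
       \<le> K1 * ln (real q * T)"
    using upper_zero_count_compare by blast
  obtain K2 where K2: "K2 \<ge> 0" "\<And>q chi S. primitive_char q chi \<Longrightarrow> S \<subseteq> {s. 0 < Re s \<and> Re s < 1/2 \<and> \<bar>Im s\<bar> \<le> 101} \<Longrightarrow>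
     0 \<le> zero_count (dirichlet_L chi) S \<and> real_of_int (zero_count (dirichlet_L chi) S) \<le> K2 * ln (real q * 2) \<and>
     0 \<le> zero_count (deriv (dirichlet_L chi)) S \<and> real_of_int (zero_count (deriv (dirichlet_L chi)) S) \<le> K2 * ln (real q * 2)"
    using small_height_zero_count by blast
  have "\<bar>real_of_int (N_minus T chi) - real_of_int (N1_minus T chi)\<bar> \<le> (2 * K1 + K2) * ln (real q * T)"
    if p: "primitive_char q chi" and T: "T \<ge> 2" for q chi T
  proof -
    interpret primitive_char q chi by (rule p)
    have ln2: "K2 * ln (real q * 2) \<le> K2 * ln (real q * T)"
      using q_gt_1 T K2(1) by (intro mult_left_mono ln_mono) auto
    have ln0: "K1 * ln (real q * T) \<ge> 0"
    proof -
      have "real q * T \<ge> 1" using mult_mono[of 1 "real q" 1 T] q_gt_1 T by simp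
      then show ?thesis using K1(1) by simp
    qed
    show ?thesis
    proof (cases "T \<le> 101")
      case True
      have "left_half_box T \<subseteq> {s. 0 < Re s \<and> Re s < 1/2 \<and> \<bar>Im s\<bar> \<le> 101}"
        using True unfolding left_half_box_def by auto
      from K2(2)[OF p this] have "\<bar>real_of_int (N_minus T chi) - real_of_int (N1_minus T chi)\<bar> \<le> K2 * ln (real q * 2)"
        unfolding N_minus_def N1_minus_def by linarith
      then show ?thesis using ln2 ln0 by (simp add: distrib_right)
    next
      case False
      define U where "U = {s. 0 < Re s \<and> Re s < 1/2 \<and> 101 < Im s \<and> Im s \<le> T}"
      define M where "M = {s. 0 < Re s \<and> Re s < 1/2 \<and> \<bar>Im s\<bar> \<le> 101}"
      \<comment> \<open>The heights 101 and -101 belong to the middle part \<open>M\<close>, which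
        makes the three parts disjoint.\<close>
      have split: "left_half_box T = (U \<union> M) \<union> cnj ` U"
      proof (intro equalityI subsetI)
        fix z assume z: "z \<in> left_half_box T"
        show "z \<in> (U \<union> M) \<union> cnj ` U"
        proof (cases "Im z < -101")
          case True
          then have "cnj z \<in> U" using z unfolding left_half_box_def U_def by auto
          then have "z \<in> cnj ` U" by (metis complex_cnj_cnj image_eqI)
          then show ?thesis by blast
        next
          case False
          then show ?thesis using z unfolding left_half_box_def U_def M_def by auto
        qed
      qed (use False in \<open>auto simp: left_half_box_def U_def M_def\<close>)
      have disj: "U \<inter> M = {}" "(U \<union> M) \<inter> cnj ` U = {}" by (auto simp: U_def M_def)
      have bd: "bounded (left_half_box T)"
      proof -
        have "left_half_box T \<subseteq> cbox (Complex 0 (-T)) (Complex (1/2) T)"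
          by (auto simp: left_half_box_def in_cbox_complex_iff)
        then show ?thesis using bounded_cbox bounded_subset by blast
      qed
      have dec: "zero_count f (left_half_box T) = zero_count f U + zero_count f M + zero_count f (cnj ` U)"
        if f: "f holomorphic_on UNIV" "\<exists>w. f w \<noteq> 0" for f
      proof -
        have fin: "finite {z. z \<in> left_half_box T \<and> f z = 0}" by (rule finite_zeros_bounded[OF f bd])
        have "finite {z. z \<in> U \<union> M \<and> f z = 0}" by (rule finite_subset[OF _ fin]) (use split in auto)
        then show ?thesis unfolding split using fin disj by (simp add: zero_count_Un split)
      qed
      have low: "zero_count L (cnj ` U) = zero_count (dirichlet_L (\<lambda>a. cnj (chi a))) U"
        unfolding L_cnj by (rule zero_count_cnj[OF L_holomorphic L_nontrivial, symmetric])
      have "deriv (dirichlet_L (\<lambda>a. cnj (chi a))) = (\<lambda>s. cnj (deriv L (cnj s)))"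
        unfolding L_cnj using deriv_cnj_comp[OF L_holomorphic] by blast
      then have low': "zero_count (deriv L) (cnj ` U) = zero_count (deriv (dirichlet_L (\<lambda>a. cnj (chi a)))) U"
        using zero_count_cnj[OF deriv_L_holomorphic deriv_L_nontrivial, of U] by simp
      have T': "T > 101" using False by simp
      note u1 = K1(2)[OF p T', folded U_def] and u2 = K1(2)[OF primitive_char_cnj T', folded U_def]
      note m = K2(2)[OF p, of M, unfolded M_def, OF order_refl, folded M_def]
      have "real_of_int (N_minus T chi) - real_of_int (N1_minus T chi) =
         (real_of_int (zero_count L U) - real_of_int (zero_count (deriv L) U)) +
         (real_of_int (zero_count L M) - real_of_int (zero_count (deriv L) M)) +
         (real_of_int (zero_count L (cnj ` U)) - real_of_int (zero_count (deriv L) (cnj ` U)))"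
        unfolding N_minus_def N1_minus_def dec[OF L_holomorphic L_nontrivial] dec[OF deriv_L_holomorphic deriv_L_nontrivial] by simp
      moreover have "\<bar>real_of_int (zero_count L M) - real_of_int (zero_count (deriv L) M)\<bar> \<le> K2 * ln (real q * 2)"
        using m by linarith
      ultimately have "\<bar>real_of_int (N_minus T chi) - real_of_int (N1_minus T chi)\<bar> \<le>
          K1 * ln (real q * T) + K2 * ln (real q * T) + K1 * ln (real q * T)"
        using u1 u2 ln2 unfolding low low' by linarith
      then show ?thesis by (simp add: algebra_simps)
    qed
  qed
  then show ?thesis using K1(1) K2(1) by (intro exI[of _ "2 * K1 + K2"]) auto
qed

lemma (in dirichlet_char) least_nonvanishing_ge_2: "least_nonvanishing chi \<ge> 2"
proof -
  have "chi (int (q + 1)) = 1" using chi_add_q[of 1] by (simp add: add.commute)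
  then have "q + 1 \<ge> 2 \<and> chi (int (q + 1)) \<noteq> 0" using q_gt_1 by simp
  from LeastI[of "\<lambda>n. n \<ge> 2 \<and> chi (int n) \<noteq> 0", OF this] show ?thesis
    unfolding least_nonvanishing_def by blast
qed

theorem theorem9:
  "\<exists>C :: real. \<forall>(q :: nat) (chi :: int \<Rightarrow> complex) (T :: real).
     q > 1 \<longrightarrow> primitive_character q chi \<longrightarrow> T \<ge> 2 \<longrightarrow>
       \<bar>real_of_int (N_minus T chi) - real_of_int (N1_minus T chi)\<bar>
         \<le> C * (sqrt (real (least_nonvanishing chi)) * ln (real q * T))"
proof -
  obtain K where K: "K \<ge> 0" "\<And>q chi T. primitive_char q chi \<Longrightarrow> T \<ge> 2 \<Longrightarrow>
     \<bar>real_of_int (N_minus T chi) - real_of_int (N1_minus T chi)\<bar> \<le> K * ln (real q * T)"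
    using zero_count_compare by blast
  have "\<bar>real_of_int (N_minus T chi) - real_of_int (N1_minus T chi)\<bar>
         \<le> K * (sqrt (real (least_nonvanishing chi)) * ln (real q * T))"
    if q: "q > 1" and chi: "primitive_character q chi" and T: "T \<ge> 2" for q chi and T :: real
  proof -
    interpret primitive_char q chi by (rule primitive_charI[OF q chi])
    have "\<bar>real_of_int (N_minus T chi) - real_of_int (N1_minus T chi)\<bar> \<le> K * (1 * ln (real q * T))"
      using K(2)[OF primitive_char_axioms T] by simp
    \<comment> \<open>The least admissible n is at least 2, so its square root is at least
      1.\<close>
    also have "\<dots> \<le> K * (sqrt (real (least_nonvanishing chi)) * ln (real q * T))"
    proof (intro mult_left_mono mult_right_mono K)
      show "1 \<le> sqrt (real (least_nonvanishing chi))" using least_nonvanishing_ge_2 by simp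
      have "real q * T \<ge> 1" using mult_mono[of 1 "real q" 1 T] q T by simp
      then show "0 \<le> ln (real q * T)" by simp
    qed
    finally show ?thesis .
  qed
  then show ?thesis by blast
qed

end
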